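(* Let $K$ be an infinite field of characteristic $p>0$ and let $\lambda=(\lambda_1,\dots,\lambda_n)$, $\mu=(\mu_1,\dots,\mu_n)$ be partitions of $r$ with at most $n$ parts such that $\mu_2\le\lambda_1$. Suppose $k,d$ are nonnegative integers such that $p^d>\min\{\lambda_2,\ \mu_1-\lambda_1\}$. Then \[\dim_K\operatorname{Hom}_S(\Delta(\lambda),\Delta(\mu))=\dim_K\operatorname{Hom}_{S'}(\Delta(\lambda^+),\Delta(\mu^+)),\] where $S=S_K(n,r)$, $S'=S_K(n,r+kp^d)$, $\lambda^+=(\lambda_1+kp^d,\lambda_2,\dots,\lambda_n)$ and $\mu^+=(\mu_1+kp^d,\mu_2,\dots,\mu_n)$.
   Context: $S_K(n,r)$ denotes the Schur algebra, whose modules are the homogeneous polynomial representations of degree $r$ of $GL_n(K)$. For a partition $\nu$ of $r$ with at most $n$ parts, $\Delta(\nu)$ denotes the Weyl module of highest weight $\nu$ for $S_K(n,r)$ (in the Akin–Buchsbaum–Weyman construction, the image of the map $d'_\nu: D_{\nu_1}V\otimes\cdots\otimes D_{\nu_n}V\to \Lambda^{\nu^t_1}V\otimes\cdots\otimes\Lambda^{\nu^t_{\nu_1}}V$, where $V=K^n$, $D$ denotes divided powers and $\nu^t$ is the transpose partition). *)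

theory Defs
  imports Main "HOL.Vector_Spaces" "HOL-Library.Multiset" "HOL-Library.Function_Algebras" "HOL-Combinatorics.Permutations"
begin

text \<open>A partition of r with at most n parts: a nonincreasing list of length n
  (padded with zeros) with sum r.  Parts are 0-indexed: part nu 0 is nu_1.\<close>

definition is_partition :: "nat \<Rightarrow> nat \<Rightarrow> nat list \<Rightarrow> bool" where
  "is_partition n r nu \<longleftrightarrow> length nu = n \<and> sorted (rev nu) \<and> sum_list nu = r"

definition part :: "nat list \<Rightarrow> nat \<Rightarrow> nat" where
  "part nu i = (if i < length nu then nu ! i else 0)"

definition conj_part :: "nat list \<Rightarrow> nat list" where
  "conj_part nu = map (\<lambda>j. length (filter (\<lambda>x. j < x) nu)) [0..<part nu 0]"

definition add_first :: "nat \<Rightarrow> nat list \<Rightarrow> nat list" where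
  "add_first m nu = nu[0 := nu ! 0 + m]"

text \<open>Basis of D_{nu_1}V \<otimes> ... \<otimes> D_{nu_n}V (V = K^n with basis e_0..e_{n-1}):
  e^{(alpha_1)} \<otimes> ... \<otimes> e^{(alpha_n)}, the i-th divided power monomial being
  recorded by its content multiset.\<close>
definition D_basis :: "nat \<Rightarrow> nat list \<Rightarrow> nat multiset list set" where
  "D_basis n nu = {ms. length ms = length nu \<and>
      (\<forall>i<length nu. size (ms ! i) = nu ! i \<and> set_mset (ms ! i) \<subseteq> {..<n})}"

definition D_space :: "nat \<Rightarrow> nat list \<Rightarrow> (nat multiset list \<Rightarrow> 'k::field) set" where
  "D_space n nu = {x. \<forall>ms. ms \<notin> D_basis n nu \<longrightarrow> x ms = 0}"

text \<open>Comultiplication of a divided power monomial: sum of all distinct words with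
  the given content.  A filling assigns a word to every row.\<close>
definition fillings :: "nat multiset list \<Rightarrow> nat list list set" where
  "fillings ms = {ws. length ws = length ms \<and> (\<forall>i<length ms. mset (ws ! i) = ms ! i)}"

definition col :: "nat list list \<Rightarrow> nat \<Rightarrow> nat list" where
  "col ws j = map (\<lambda>w. w ! j) (filter (\<lambda>w. j < length w) ws)"

definition inversions :: "nat list \<Rightarrow> nat" where
  "inversions w = card {(i, j). i < j \<and> j < length w \<and> w ! j < w ! i}"

text \<open>Coefficient of the basis vector e_S (S strictly increasing) in
  e_{w_1} \<and> ... \<and> e_{w_c}.\<close>
definition wedge_coeff :: "nat list \<Rightarrow> nat list \<Rightarrow> 'k::field" where
  "wedge_coeff w S = (if distinct w \<and> sort w = S then (-1) ^ inversions w else 0)"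

text \<open>Elements of \<Lambda>^{c_1}V \<otimes> ... \<otimes> \<Lambda>^{c_m}V are coefficient functions on lists
  [S_1,...,S_m] of strictly increasing index lists, S_j of length c_j.\<close>
definition ext_index :: "nat \<Rightarrow> nat list \<Rightarrow> nat list list set" where
  "ext_index n cs = {Ss. length Ss = length cs \<and> (\<forall>j<length cs. length (Ss ! j) = cs ! j
      \<and> sorted_wrt (<) (Ss ! j) \<and> set (Ss ! j) \<subseteq> {..<n})}"

text \<open>d'_nu: comultiply each divided power into D_1^{\<otimes> nu_i} (sum over fillings),
  then multiply the entries of each column in the exterior algebra.\<close>
definition d' :: "nat \<Rightarrow> nat list \<Rightarrow> (nat multiset list \<Rightarrow> 'k::field) \<Rightarrow> nat list list \<Rightarrow> 'k" where
  "d' n nu x = (\<lambda>Ss. if Ss \<in> ext_index n (conj_part nu)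
      then (\<Sum>ms\<in>D_basis n nu. x ms * (\<Sum>ws\<in>fillings ms.
               \<Prod>j<length Ss. wedge_coeff (col ws j) (Ss ! j)))
      else 0)"

definition weyl :: "nat \<Rightarrow> nat list \<Rightarrow> (nat list list \<Rightarrow> 'k::field) set" where
  "weyl n nu = d' n nu ` D_space n nu"

definition minor :: "(nat \<Rightarrow> nat \<Rightarrow> 'k::field) \<Rightarrow> nat list \<Rightarrow> nat list \<Rightarrow> 'k" where
  "minor g R C = (\<Sum>p | p permutes {..<length C}.
      of_int (sign p) * (\<Prod>i<length C. g (R ! i) (C ! p i)))"

definition GL :: "nat \<Rightarrow> (nat \<Rightarrow> nat \<Rightarrow> 'k::field) set" where
  "GL n = {g. minor g [0..<n] [0..<n] \<noteq> 0}"

text \<open>g acts on \<Lambda>^{c}V by g e_S = \<Sum>_{S'} det(g[S',S]) e_{S'}, and diagonally on tensors.\<close>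
definition act :: "nat \<Rightarrow> (nat \<Rightarrow> nat \<Rightarrow> 'k::field) \<Rightarrow> (nat list list \<Rightarrow> 'k) \<Rightarrow> nat list list \<Rightarrow> 'k" where
  "act n g f = (\<lambda>Ss'. if Ss' \<in> ext_index n (map length Ss')
      then (\<Sum>Ss\<in>ext_index n (map length Ss'). f Ss * (\<Prod>j<length Ss'. minor g (Ss' ! j) (Ss ! j)))
      else 0)"

text \<open>Hom_{S_K(n,r)}(\<Delta>(la), \<Delta>(mu)): K-linear maps \<Delta>(la) \<rightarrow> \<Delta>(mu) commuting with
  GL_n(K) (equivalently, for infinite K, with S_K(n,r)); maps are extended by 0.\<close>
definition hom_S :: "nat \<Rightarrow> nat list \<Rightarrow> nat list
    \<Rightarrow> ((nat list list \<Rightarrow> 'k::field) \<Rightarrow> (nat list list \<Rightarrow> 'k)) set" where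
  "hom_S n la mu = {\<phi>.
      (\<forall>x\<in>weyl n la. \<phi> x \<in> weyl n mu) \<and>
      (\<forall>x\<in>weyl n la. \<forall>y\<in>weyl n la. \<phi> (\<lambda>i. x i + y i) = (\<lambda>i. \<phi> x i + \<phi> y i)) \<and>
      (\<forall>c. \<forall>x\<in>weyl n la. \<phi> (\<lambda>i. c * x i) = (\<lambda>i. c * \<phi> x i)) \<and>
      (\<forall>g\<in>GL n. \<forall>x\<in>weyl n la. \<phi> (act n g x) = act n g (\<phi> x)) \<and>
      (\<forall>x. x \<notin> weyl n la \<longrightarrow> \<phi> x = (\<lambda>i. 0))}"

definition hom_dim :: "'k::field itself \<Rightarrow> nat \<Rightarrow> nat list \<Rightarrow> nat list \<Rightarrow> nat" where
  "hom_dim _ n la mu = vector_space.dim (\<lambda>(c::'k) \<phi> x i. c * \<phi> x i)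
      (hom_S n la mu :: ((nat list list \<Rightarrow> 'k) \<Rightarrow> (nat list list \<Rightarrow> 'k)) set)"

end

theory Submission
  imports Defs "HOL-Computational_Algebra.Polynomial" "HOL-Computational_Algebra.Primes"
begin

text \<open>
  A homomorphism out of \<open>\<Delta>(\<lambda>)\<close> is determined by the image of the highest weight vector.  The
  possible images are exactly the primitive vectors of \<open>\<Delta>(\<mu>)\<close>, on which the upper triangular group acts
  through the character \<open>\<lambda>\<close>: for such a vector \<open>w\<close> the coordinates of \<open>g w\<close> are polynomials in \<open>g\<close> that
  are semi-invariant under right multiplication, and such polynomials are combinations of the
  coordinates of the orbit of the highest weight vector, because a leading monomial of a
  semi-invariant is a semistandard tableau and hence the leading monomial of a bideterminant.

  Let \<open>N = k p\<^sup>d\<close>.  Restricting coordinates to tableaux whose last \<open>N\<close> columns are a single zero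
  (dually, multiplying functions by \<open>x\<^sub>1\<^sub>1\<^sup>N\<close>) maps \<open>\<Delta>(\<mu>\<^sup>+)\<close> to \<open>\<Delta>(\<mu>)\<close>.  As \<open>\<mu>\<^sub>2 \<le> \<lambda>\<^sub>1\<close>, every
  tableau of shape \<open>\<mu>\<^sup>+\<close> and weight \<open>\<lambda>\<^sup>+\<close> has \<open>N\<close> such columns, so this is a bijection on weight
  spaces.  It respects primitivity: an upper triangular matrix turns \<open>x\<^sub>1\<^sub>1\<^sup>N\<close> into the \<open>k\<close>-th power of a
  combination of the \<open>p\<^sup>d\<close>-th powers of the \<open>x\<^sub>j\<^sub>1\<close>, and since \<open>p\<^sup>d > min {\<lambda>\<^sub>2, \<mu>\<^sub>1 - \<lambda>\<^sub>1}\<close> only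
  the pure power of \<open>x\<^sub>1\<^sub>1\<close> contributes to the weight \<open>\<lambda>\<^sup>+\<close>.
\<close>

text \<open>The module \<Delta>(\<lambda>) is given only as the image of a map, with neither a
  presentation nor a basis, so maps out of it cannot be built by checking relations. Instead, facts
  about Weyl modules are checked on the vectors g hw, whose coordinates are products of minors of g
  on initial columns, and carried over by linearity. The combination that expresses a coordinate of
  g w through those of g hw does not depend on g; it therefore defines a linear map on all
  coordinate functions at once, and well-definedness on the span is automatic. An infinite field is
  what lets monomials be separated by values, and what allows the passage from all matrices to a
  dense set: invertible ones when homomorphisms are compared, ones with nonzero corner entry when
  vectors are lifted. The minimum in the bound has two terms because a trailing block of
  \<open>p\<^sup>d\<close> equal nonzero entries is excluded for either of two reasons: its entry
  would occur too often, or too few places would be left for zeros.\<close>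

section \<open>Monomials and polynomial functions over an infinite field\<close>

definition mon :: "('v \<Rightarrow> 'a::comm_monoid_mult) \<Rightarrow> 'v multiset \<Rightarrow> 'a" where
  "mon x M = (\<Prod>v\<in>#M. x v)"

lemma mon_empty [simp]: "mon x {#} = 1"
  by (simp add: mon_def)

lemma mon_add_mset [simp]: "mon x (add_mset v M) = x v * mon x M"
  by (simp add: mon_def)

lemma mon_union [simp]: "mon x (M + N) = mon x M * mon x N"
  by (simp add: mon_def)

lemma mon_mult: "mon (\<lambda>v. x v * y v) M = mon x M * mon y M"
  by (induction M) (simp_all add: mult_ac)

lemma mon_replicate: "mon x (replicate_mset k v) = x v ^ k"
  by (induction k) simp_all

lemma mon_sum: "finite I \<Longrightarrow> mon x (\<Sum>i\<in>I. M i) = (\<Prod>i\<in>I. mon x (M i))"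
  by (induction rule: finite_induct) simp_all

lemma mon_cong: "(\<And>v. v \<in># M \<Longrightarrow> x v = y v) \<Longrightarrow> mon x M = mon y M"
  unfolding mon_def by (metis image_mset_cong)

lemma mon_image: "mon x (image_mset f M) = mon (\<lambda>v. x (f v)) M"
  by (induction M) simp_all

lemma mon_fun_upd:
  "mon (x(v := s)) M = s ^ count M v * mon x (filter_mset (\<lambda>u. u \<noteq> v) M)"
  by (induction M) (auto simp: mult_ac)

lemma poly_zero_of_infinite:
  fixes q :: "'k::field poly"
  assumes "infinite (UNIV :: 'k set)" and "\<And>s. poly q s = 0"
  shows "q = 0"
  using assms poly_roots_finite[of q] by auto

text \<open>Induction on the variables: with all but \<open>v\<close> frozen, the sum is a
  univariate polynomial vanishing everywhere, so its coefficients vanish, and each of these is a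
  similar sum in fewer variables.\<close>

lemma mon_independent_aux:
  assumes inf: "infinite (UNIV :: 'k::field set)" and "finite X"
  shows "\<And>A c. finite A \<Longrightarrow> (\<And>M. M \<in> A \<Longrightarrow> set_mset M \<subseteq> X) \<Longrightarrow>
     (\<And>x :: 'v \<Rightarrow> 'k. (\<Sum>M\<in>A. c M * mon x M) = 0) \<Longrightarrow> M0 \<in> A \<Longrightarrow> c M0 = 0"
  using \<open>finite X\<close>
proof (induction X arbitrary: M0 rule: finite_induct)
  case empty
  have "A = {{#}}" using empty.prems(2,4) by fastforce
  with empty.prems(3)[of undefined] empty.prems(4) show ?case by simp
next
  case (insert v X)
  define k where "k = count M0 v"
  define B where "B = {M \<in> A. count M v = k}"
  define r where "r = filter_mset (\<lambda>u::'v. u \<noteq> v)"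
  have finB: "finite B" using insert.prems(1) by (simp add: B_def)
  have split: "M = r M + replicate_mset (count M v) v" for M
    unfolding r_def by (rule multiset_eqI) auto
  have inj: "inj_on r B"
  proof (rule inj_onI)
    fix M N assume "M \<in> B" "N \<in> B" "r M = r N"
    then show "M = N" using split[of M] split[of N] by (simp add: B_def)
  qed
  have sumB: "(\<Sum>M\<in>B. c M * mon x (r M)) = 0" for x
  proof -
    define q where "q = (\<Sum>M\<in>A. monom (c M * mon x (r M)) (count M v))"
    have "poly q s = 0" for s
    proof -
      have "poly q s = (\<Sum>M\<in>A. c M * mon (x(v := s)) M)"
        by (simp add: q_def poly_sum poly_monom mon_fun_upd r_def mult_ac)
      then show ?thesis using insert.prems(3) by simp
    qed
    then have "q = 0" by (rule poly_zero_of_infinite[OF inf])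
    then have "0 = coeff q k" by simp
    also have "\<dots> = (\<Sum>M\<in>A. if count M v = k then c M * mon x (r M) else 0)"
      by (simp add: q_def coeff_sum)
    also have "\<dots> = (\<Sum>M\<in>B. c M * mon x (r M))"
      unfolding B_def by (rule sum.inter_filter[OF insert.prems(1), symmetric])
    finally show ?thesis by simp
  qed
  \<comment> \<open>The coefficients are reindexed by the monomials stripped of \<open>v\<close>;
    adding back \<open>k\<close> copies recovers the original monomial.\<close>
  have "(\<lambda>N. c (N + replicate_mset k v)) (r M0) = 0"
  proof (rule insert.IH[where A = "r ` B" and c = "\<lambda>N. c (N + replicate_mset k v)"])
    show "finite (r ` B)" using finB by simp
    show "r M0 \<in> r ` B" using insert.prems(4) by (simp add: B_def k_def)
    show "set_mset N \<subseteq> X" if "N \<in> r ` B" for N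
      using that insert.prems(2) by (force simp: B_def r_def)
    show "(\<Sum>N\<in>r ` B. c (N + replicate_mset k v) * mon x N) = 0" for x
    proof -
      have "(\<Sum>N\<in>r ` B. c (N + replicate_mset k v) * mon x N) = (\<Sum>M\<in>B. c M * mon x (r M))"
        using split by (subst sum.reindex[OF inj]) (auto intro!: sum.cong simp: B_def)
      then show ?thesis using sumB by simp
    qed
  qed
  then show ?case using split[of M0] by (simp add: k_def)
qed

lemma mon_independent:
  fixes c :: "'v multiset \<Rightarrow> 'k::field"
  assumes "infinite (UNIV :: 'k set)" and "finite A"
    and "\<And>x. (\<Sum>M\<in>A. c M * mon x M) = 0" and "M \<in> A"
  shows "c M = 0"
  by (rule mon_independent_aux[where A = A and c = c and X = "\<Union> (set_mset ` A)"])
     (use assms in auto)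

text \<open>Expanding a substitution lists the same monomial several times, so only the total
  coefficient of each monomial is forced to vanish.\<close>

lemma mon_independent_family:
  fixes c :: "'i \<Rightarrow> 'k::field"
  assumes inf: "infinite (UNIV :: 'k set)" and I: "finite I"
    and eq: "\<And>x. (\<Sum>i\<in>I. c i * mon x (M i)) = 0"
  shows "(\<Sum>i\<in>{i \<in> I. M i = N}. c i) = 0"
proof (cases "N \<in> M ` I")
  case True
  show ?thesis
  proof (rule mon_independent[OF inf, where A = "M ` I" and c = "\<lambda>N. \<Sum>i\<in>{i \<in> I. M i = N}. c i"])
    fix x
    have "(\<Sum>i\<in>I. c i * mon x (M i)) = (\<Sum>N\<in>M ` I. \<Sum>i\<in>{i \<in> I. M i = N}. c i * mon x (M i))"
      by (rule sum.image_gen[OF I])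
    also have "\<dots> = (\<Sum>N\<in>M ` I. (\<Sum>i\<in>{i \<in> I. M i = N}. c i) * mon x N)"
      by (intro sum.cong refl) (simp add: sum_distrib_right)
    finally show "(\<Sum>N\<in>M ` I. (\<Sum>i\<in>{i \<in> I. M i = N}. c i) * mon x N) = 0"
      using eq by simp
  qed (use I True in auto)
next
  case False
  then have "{i \<in> I. M i = N} = {}" by auto
  then show ?thesis by (simp only: sum.empty)
qed

text \<open>Polynomials are handled as functions. The set \<open>W\<close> of admissible monomials
  has two uses: restricting the variables, and bounding \<open>Psi\<close> in the induction of
  \<open>semi_invariant_span\<close>.\<close>

definition polyspan :: "'v multiset set \<Rightarrow> (('v \<Rightarrow> 'k::field) \<Rightarrow> 'k) \<Rightarrow> bool" where
  "polyspan W F \<longleftrightarrow> (\<exists>A c. finite A \<and> A \<subseteq> W \<and> (\<forall>x. F x = (\<Sum>M\<in>A. c M * mon x M)))"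

abbreviation polyfun :: "'v set \<Rightarrow> (('v \<Rightarrow> 'k::field) \<Rightarrow> 'k) \<Rightarrow> bool" where
  "polyfun V \<equiv> polyspan {M. set_mset M \<subseteq> V}"

lemma polyspan_family:
  assumes I: "finite I" and W: "\<And>i. i \<in> I \<Longrightarrow> M i \<in> W"
    and F: "\<And>x. F x = (\<Sum>i\<in>I. c i * mon x (M i))"
  shows "polyspan W F"
  unfolding polyspan_def
proof (intro exI conjI allI)
  show "finite (M ` I)" using I by simp
  show "M ` I \<subseteq> W" using W by blast
  fix x
  have "F x = (\<Sum>N\<in>M ` I. \<Sum>i\<in>{i \<in> I. M i = N}. c i * mon x (M i))"
    unfolding F by (rule sum.image_gen[OF I])
  also have "\<dots> = (\<Sum>N\<in>M ` I. (\<Sum>i\<in>{i \<in> I. M i = N}. c i) * mon x N)"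
    by (intro sum.cong refl) (simp add: sum_distrib_right)
  finally show "F x = (\<Sum>N\<in>M ` I. (\<Sum>i\<in>{i \<in> I. M i = N}. c i) * mon x N)" .
qed

text \<open>Only monomials that really occur are kept; later arguments about a monomial of maximal
  \<open>Psi\<close> depend on its coefficient being nonzero.\<close>

lemma polyspanE:
  assumes "polyspan W F"
  obtains A c where "finite A" "A \<subseteq> W" "\<And>x. F x = (\<Sum>M\<in>A. c M * mon x M)" "\<And>M. M \<in> A \<Longrightarrow> c M \<noteq> 0"
proof -
  obtain A c where *: "finite A" "A \<subseteq> W" "\<And>x. F x = (\<Sum>M\<in>A. c M * mon x M)"
    using assms unfolding polyspan_def by blast
  show thesis
  proof (rule that[of "{M \<in> A. c M \<noteq> 0}" c])
    show "F x = (\<Sum>M\<in>{M \<in> A. c M \<noteq> 0}. c M * mon x M)" for x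
      unfolding *(3) using *(1) by (intro sum.mono_neutral_right) auto
  qed (use * in auto)
qed

lemma polyspan_add:
  assumes "polyspan W F" "polyspan W G" shows "polyspan W (\<lambda>x. F x + G x)"
proof -
  obtain A c where A: "finite A" "A \<subseteq> W" "\<And>x. F x = (\<Sum>M\<in>A. c M * mon x M)"
      "\<And>M. M \<in> A \<Longrightarrow> c M \<noteq> 0"
    by (rule polyspanE[OF assms(1)], rule that)
  obtain B d where B: "finite B" "B \<subseteq> W" "\<And>x. G x = (\<Sum>M\<in>B. d M * mon x M)"
      "\<And>M. M \<in> B \<Longrightarrow> d M \<noteq> 0"
    by (rule polyspanE[OF assms(2)], rule that)
  show ?thesis
    by (rule polyspan_family[where I = "A <+> B" and M = "case_sum id id" and c = "case_sum c d"])
       (use A B in \<open>auto simp: sum.Plus\<close>)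
qed

lemma polyspan_zero: "polyspan W (\<lambda>_. 0)"
  by (rule polyspan_family[where I = "{} :: unit set"]) auto

lemma polyspan_sum:
  "(\<And>i. i \<in> I \<Longrightarrow> polyspan W (F i)) \<Longrightarrow> polyspan W (\<lambda>x. \<Sum>i\<in>I. F i x)"
  by (induction I rule: infinite_finite_induct) (auto intro: polyspan_zero polyspan_add)

lemma polyspan_scale:
  assumes "polyspan W F" shows "polyspan W (\<lambda>x. a * F x)"
proof -
  obtain A c where A: "finite A" "A \<subseteq> W" "\<And>x. F x = (\<Sum>M\<in>A. c M * mon x M)"
      "\<And>M. M \<in> A \<Longrightarrow> c M \<noteq> 0"
    by (rule polyspanE[OF assms], rule that)
  show ?thesis
    by (rule polyspan_family[where I = A and M = id and c = "\<lambda>M. a * c M"])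
       (use A in \<open>auto simp: sum_distrib_left mult.assoc\<close>)
qed

lemma polyfun_const: "polyfun V (\<lambda>_. a)"
  by (rule polyspan_family[where I = "{()}" and M = "\<lambda>_. {#}" and c = "\<lambda>_. a"]) auto

lemma polyfun_var: "v \<in> V \<Longrightarrow> polyfun V (\<lambda>x. x v)"
  by (rule polyspan_family[where I = "{()}" and M = "\<lambda>_. {#v#}" and c = "\<lambda>_. 1"]) auto

lemma polyfun_mult:
  assumes "polyfun V F" "polyfun V G" shows "polyfun V (\<lambda>x. F x * G x)"
proof -
  obtain A c where A: "finite A" "A \<subseteq> {M. set_mset M \<subseteq> V}" "\<And>x. F x = (\<Sum>M\<in>A. c M * mon x M)"
      "\<And>M. M \<in> A \<Longrightarrow> c M \<noteq> 0"
    by (rule polyspanE[OF assms(1)], rule that)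
  obtain B d where B: "finite B" "B \<subseteq> {M. set_mset M \<subseteq> V}" "\<And>x. G x = (\<Sum>M\<in>B. d M * mon x M)"
      "\<And>M. M \<in> B \<Longrightarrow> d M \<noteq> 0"
    by (rule polyspanE[OF assms(2)], rule that)
  show ?thesis
    by (rule polyspan_family[where I = "A \<times> B" and M = "\<lambda>(M, N). M + N" and c = "\<lambda>(M, N). c M * d N"])
       (use A B in \<open>force simp: sum_product sum.cartesian_product mult_ac intro!: sum.cong\<close>)+
qed

lemma polyfun_prod:
  "(\<And>i. i \<in> I \<Longrightarrow> polyfun V (F i)) \<Longrightarrow> polyfun V (\<lambda>x. \<Prod>i\<in>I. F i x)"
  by (induction I rule: infinite_finite_induct) (auto intro: polyfun_const polyfun_mult)

lemma polyfun_line: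
  assumes "polyfun V F"
  shows "\<exists>q. \<forall>s. F (\<lambda>v. x v + s * y v) = poly q s"
proof -
  obtain A c where *: "finite A" "\<And>x. F x = (\<Sum>M\<in>A. c M * mon x M)"
      "\<And>M. M \<in> A \<Longrightarrow> c M \<noteq> 0"
    by (rule polyspanE[OF assms], rule that)
  have mon: "poly (mon (\<lambda>v. [:x v, y v:]) M) s = mon (\<lambda>v. x v + s * y v) M" for M s
    by (induction M) (simp_all add: algebra_simps)
  have "F (\<lambda>v. x v + s * y v) = poly (\<Sum>M\<in>A. smult (c M) (mon (\<lambda>v. [:x v, y v:]) M)) s" for s
    by (simp add: *(2) poly_sum mon)
  then show ?thesis by blast
qed

text \<open>On the line through \<open>x\<close> and \<open>x1\<close> the product of
  \<open>F\<close> and \<open>D\<close> vanishes identically, while \<open>D\<close> restricts to a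
  nonzero polynomial because of its value at \<open>x1\<close>; so \<open>F\<close> restricts to
  zero.\<close>

lemma polyfun_dense:
  fixes F :: "('v \<Rightarrow> 'k::field) \<Rightarrow> 'k"
  assumes inf: "infinite (UNIV :: 'k set)" and F: "polyfun V F" and D: "polyfun W D"
    and "D x1 \<noteq> 0" and zero: "\<And>x. D x \<noteq> 0 \<Longrightarrow> F x = 0"
  shows "F x = 0"
proof -
  obtain q where q: "\<And>s. F (\<lambda>v. x v + s * (x1 v - x v)) = poly q s"
    using polyfun_line[OF F, of x "\<lambda>v. x1 v - x v"] by blast
  obtain r where r: "\<And>s. D (\<lambda>v. x v + s * (x1 v - x v)) = poly r s"
    using polyfun_line[OF D, of x "\<lambda>v. x1 v - x v"] by blast
  have "r \<noteq> 0" using r[of 1] \<open>D x1 \<noteq> 0\<close> by auto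
  have "poly (q * r) s = 0" for s
    using zero[of "\<lambda>v. x v + s * (x1 v - x v)"] by (auto simp: q r)
  then have "q * r = 0" by (rule poly_zero_of_infinite[OF inf])
  with \<open>r \<noteq> 0\<close> have "q = 0" by simp
  then show ?thesis using q[of 0] by simp
qed

lemma mon_independent_dense:
  fixes c :: "'i \<Rightarrow> 'k::field"
  assumes inf: "infinite (UNIV :: 'k set)" and I: "finite I" and D: "polyfun W D" "D x1 \<noteq> 0"
    and eq: "\<And>x. D x \<noteq> 0 \<Longrightarrow> (\<Sum>i\<in>I. c i * mon x (M i)) = 0"
  shows "(\<Sum>i\<in>{i \<in> I. M i = N}. c i) = 0"
proof (rule mon_independent_family[OF inf I])
  have "polyfun UNIV (\<lambda>x. \<Sum>i\<in>I. c i * mon x (M i))"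
    by (rule polyspan_family[OF I]) auto
  then show "(\<Sum>i\<in>I. c i * mon x (M i)) = 0" for x
    by (rule polyfun_dense[OF inf _ D]) (use eq in auto)
qed

section \<open>Coefficients of vector-valued polynomials\<close>

lemma (in vector_space) separating_functional:
  assumes S: "subspace S" and v: "v \<notin> S"
  obtains f :: "'b \<Rightarrow> 'a" where "Vector_Spaces.linear scale (*) f" "\<And>x. x \<in> S \<Longrightarrow> f x = 0" "f v = 1"
proof -
  interpret K: vector_space "(*) :: 'a \<Rightarrow> 'a \<Rightarrow> 'a"
    by standard (simp_all add: algebra_simps)
  interpret P: vector_space_pair scale "(*) :: 'a \<Rightarrow> 'a \<Rightarrow> 'a" ..
  obtain B where B: "B \<subseteq> S" "independent B" "S \<subseteq> span B"
    using maximal_independent_subset by blast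
  have spB: "span B = S" using B S by (metis span_minimal subset_antisym)
  have "independent (insert v B)"
    using B v spB by (simp add: independent_insertI)
  then obtain f where f: "Vector_Spaces.linear scale (*) f" "\<forall>x\<in>insert v B. f x = (if x = v then 1 else 0)"
    using P.linear_independent_extend[of "insert v B" "\<lambda>x. if x = v then 1 else 0"] by auto
  have "f x = 0" if "x \<in> S" for x
  proof -
    have "x \<in> span B" using that spB by simp
    moreover have "f b = 0" if "b \<in> B" for b
      using f(2) that B(1) v by (metis insertCI subsetD)
    ultimately show ?thesis
      using P.linear_eq_0_on_span[OF f(1)] by blast
  qed
  with f show ?thesis by (intro that[of f]) auto
qed

text \<open>A functional that kills \<open>S\<close> and is 1 at \<open>v i\<close> would turn the
  hypothesis into a scalar polynomial vanishing wherever \<open>D\<close> does not, yet with a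
  coefficient 1. Both the spanning by dense parts of the orbit and the decomposition into weight
  components rest on this.\<close>

lemma (in vector_space) mon_coeff_mem:
  fixes v :: "'i \<Rightarrow> 'b" and M :: "'i \<Rightarrow> 'v multiset"
  assumes inf: "infinite (UNIV :: 'a set)" and I: "finite I" and inj: "inj_on M I"
    and D: "polyfun W D" "D x1 \<noteq> 0" and S: "subspace S"
    and mem: "\<And>x. D x \<noteq> 0 \<Longrightarrow> (\<Sum>i\<in>I. scale (mon x (M i)) (v i)) \<in> S" and i: "i \<in> I"
  shows "v i \<in> S"
proof (rule ccontr)
  assume "v i \<notin> S"
  then obtain f :: "'b \<Rightarrow> 'a" where f: "Vector_Spaces.linear scale (*) f" "\<And>x. x \<in> S \<Longrightarrow> f x = 0" "f (v i) = 1"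
    using separating_functional[OF S] by blast
  interpret f: Vector_Spaces.linear scale "(*)" f by (rule f(1))
  have "(\<Sum>j\<in>{j \<in> I. M j = M i}. f (v j)) = 0"
  proof (rule mon_independent_dense[OF inf I D])
    fix x assume "D x \<noteq> 0"
    then have "f (\<Sum>i\<in>I. scale (mon x (M i)) (v i)) = 0" using f(2) mem by blast
    then show "(\<Sum>i\<in>I. f (v i) * mon x (M i)) = 0"
      by (simp add: f.sum f.scale mult.commute)
  qed
  moreover have "{j \<in> I. M j = M i} = {i}" using inj i by (auto dest: inj_onD)
  ultimately show False using f(3) by simp
qed

section \<open>Lists as index sets of tensors\<close>

definition incr_lists :: "nat \<Rightarrow> nat \<Rightarrow> nat list set" where
  "incr_lists n c = {S. length S = c \<and> sorted_wrt (<) S \<and> set S \<subseteq> {..<n}}"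

lemma lists_lt_bij:
  "bij_betw (\<lambda>w. \<lambda>i\<in>{..<m}. w ! i) {w. length w = m \<and> (\<forall>i<m. w ! i \<in> A i)} (PiE {..<m} A)"
proof (rule bij_betw_byWitness[where f' = "\<lambda>f. map f [0..<m]"])
  show "\<forall>w\<in>{w. length w = m \<and> (\<forall>i<m. w ! i \<in> A i)}. map (\<lambda>i\<in>{..<m}. w ! i) [0..<m] = w"
    by (auto intro!: nth_equalityI)
  show "\<forall>f\<in>PiE {..<m} A. (\<lambda>i\<in>{..<m}. map f [0..<m] ! i) = f"
    by (auto simp: fun_eq_iff PiE_def extensional_def)
  show "(\<lambda>w. \<lambda>i\<in>{..<m}. w ! i) ` {w. length w = m \<and> (\<forall>i<m. w ! i \<in> A i)} \<subseteq> PiE {..<m} A"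
    by (intro image_subsetI restrict_PiE_iff[THEN iffD2]) simp
  show "(\<lambda>f. map f [0..<m]) ` PiE {..<m} A \<subseteq> {w. length w = m \<and> (\<forall>i<m. w ! i \<in> A i)}"
    by (intro image_subsetI) (simp add: PiE_mem)
qed

lemma prod_sum_lists:
  fixes f :: "nat \<Rightarrow> 'b \<Rightarrow> 'c::comm_semiring_1"
  assumes "\<And>i. i < m \<Longrightarrow> finite (A i)"
  shows "(\<Prod>i<m. \<Sum>x\<in>A i. f i x)
       = (\<Sum>w\<in>{w. length w = m \<and> (\<forall>i<m. w ! i \<in> A i)}. \<Prod>i<m. f i (w ! i))"
proof -
  have "(\<Prod>i<m. \<Sum>x\<in>A i. f i x) = (\<Sum>g\<in>PiE {..<m} A. \<Prod>i<m. f i (g i))"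
    using assms by (intro prod_sum_PiE) auto
  also have "\<dots> = (\<Sum>w\<in>{w. length w = m \<and> (\<forall>i<m. w ! i \<in> A i)}. \<Prod>i<m. f i (w ! i))"
    by (rule sum.reindex_bij_betw[OF lists_lt_bij, symmetric, THEN trans]) auto
  finally show ?thesis .
qed

lemma finite_lists_lt:
  assumes "\<And>i. i < m \<Longrightarrow> finite (A i)"
  shows "finite {w. length w = m \<and> (\<forall>i<m. w ! i \<in> A i)}"
proof -
  have "finite (PiE {..<m} A)" using assms by (intro finite_PiE) auto
  then show ?thesis using bij_betw_finite[OF lists_lt_bij] by blast
qed

lemma finite_incr_lists [simp]: "finite (incr_lists n c)"
proof (rule finite_subset)
  show "incr_lists n c \<subseteq> {S. set S \<subseteq> {..<n} \<and> length S = c}" by (auto simp: incr_lists_def)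
qed (rule finite_lists_length_eq, simp)

subsection \<open>The sign of a permutation as a parity of inversions\<close>

definition inv_pairs :: "nat \<Rightarrow> (nat \<times> nat) set" where
  "inv_pairs c = {(i, j). i < j \<and> j < c}"

definition inv_sign :: "nat \<Rightarrow> (nat \<Rightarrow> nat) \<Rightarrow> int" where
  "inv_sign c q = (\<Prod>(i, j)\<in>inv_pairs c. if q i < q j then 1 else - 1)"

lemma finite_inv_pairs [simp]: "finite (inv_pairs c)"
  by (rule finite_subset[of _ "{..<c} \<times> {..<c}"]) (auto simp: inv_pairs_def)

lemma inv_sign_card:
  "inv_sign c q = (- 1) ^ card {(i, j). i < j \<and> j < c \<and> \<not> q i < q j}"
proof -
  have "inv_sign c q = (\<Prod>x\<in>inv_pairs c. if x \<in> {(i, j). i < j \<and> j < c \<and> \<not> q i < q j} then - 1 else 1)"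
    unfolding inv_sign_def by (intro prod.cong) (auto simp: inv_pairs_def)
  also have "\<dots> = (\<Prod>x\<in>inv_pairs c \<inter> {(i, j). i < j \<and> j < c \<and> \<not> q i < q j}. - 1)"
    by (subst prod.inter_restrict) auto
  also have "inv_pairs c \<inter> {(i, j). i < j \<and> j < c \<and> \<not> q i < q j} = {(i, j). i < j \<and> j < c \<and> \<not> q i < q j}"
    by (auto simp: inv_pairs_def)
  finally show ?thesis by simp
qed

text \<open>\<open>q\<close> permutes the unordered pairs, and the sign of the composite at a pair
  is the sign of \<open>q\<close> there times the sign of \<open>p\<close> at the image
  pair.\<close>

lemma inv_sign_comp:
  assumes p: "p permutes {..<c}" and q: "q permutes {..<c}"
  shows "inv_sign c (p \<circ> q) = inv_sign c p * inv_sign c q"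
proof -
  \<comment> \<open>The image of a pair, put back into increasing order.\<close>
  define f where "f r = (\<lambda>(i, j). (min (r i) (r j), max (r i) (r j)))" for r :: "nat \<Rightarrow> nat"
  have inP: "f r x \<in> inv_pairs c" if r: "r permutes {..<c}" and x: "x \<in> inv_pairs c" for r x
  proof -
    obtain i j where ij: "x = (i, j)" "i < j" "j < c" using x by (auto simp: inv_pairs_def)
    then have "r i \<noteq> r j" using permutes_inj[OF r] by (auto simp: inj_def)
    moreover have "r i < c" "r j < c" using ij permutes_in_image[OF r] by auto
    ultimately show ?thesis by (auto simp: ij f_def inv_pairs_def min_def max_def)
  qed
  have cancel: "f s (f r x) = x" if "\<And>i. s (r i) = i" "x \<in> inv_pairs c" for r s x
    using that by (auto simp: f_def inv_pairs_def min_def max_def)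
  define s where "s r = (\<lambda>(i, j). if r i < r j then 1 else - 1 :: int)" for r :: "nat \<Rightarrow> nat"
  have "(\<Prod>x\<in>inv_pairs c. s p x) = (\<Prod>x\<in>inv_pairs c. s p (f q x))"
  proof (rule prod.reindex_bij_witness[where i = "f q" and j = "f (inv q)"])
    fix x assume x: "x \<in> inv_pairs c"
    show "f q (f (inv q) x) = x" "f (inv q) (f q x) = x"
      using cancel[OF _ x] permutes_inverses[OF q] by blast+
    show "f (inv q) x \<in> inv_pairs c" "f q x \<in> inv_pairs c"
      using inP[OF q x] inP[OF permutes_inv[OF q] x] by blast+
    show "s p (f q (f (inv q) x)) = s p x"
      using cancel[OF _ x, of q "inv q"] permutes_inverses[OF q] by simp
  qed
  moreover have "s p (f q x) * s q x = s (p \<circ> q) x" if xP: "x \<in> inv_pairs c" for x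
  proof -
    obtain i j where x: "x = (i, j)" "i < j" using xP unfolding inv_pairs_def by blast
    then have "q i \<noteq> q j" "p (q i) \<noteq> p (q j)"
      by (simp_all add: inj_eq[OF permutes_inj[OF p]] inj_eq[OF permutes_inj[OF q]])
    then show ?thesis by (auto simp: x f_def s_def min_def max_def)
  qed
  moreover have "inv_sign c r = (\<Prod>x\<in>inv_pairs c. s r x)" for r
    by (simp add: inv_sign_def s_def)
  ultimately show ?thesis by (simp add: prod.distrib[symmetric])
qed

text \<open>Each index k strictly between a and b is in two inverted pairs, (a, k) and (k, b); the
  pair (a, b) makes the total odd.\<close>

lemma inv_sign_transpose:
  assumes "a < b" "b < c"
  shows "inv_sign c (Transposition.transpose a b) = - 1"
proof -
  let ?t = "Transposition.transpose a b"
  have "{(i, j). i < j \<and> j < c \<and> \<not> ?t i < ?t j}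
      = insert (a, b) ((\<lambda>k. (a, k)) ` {a<..<b} \<union> (\<lambda>k. (k, b)) ` {a<..<b})" (is "?L = ?R")
    using assms by (auto simp: Transposition.transpose_def image_iff split: if_splits)
  moreover have "card ?R = Suc (card {a<..<b} + card {a<..<b})"
    by (subst card_insert_disjoint, simp, force)
      (subst card_Un_disjoint; force simp: card_image inj_on_def)
  ultimately show ?thesis by (simp add: inv_sign_card)
qed

lemma sign_eq_inv_sign:
  assumes "p permutes {..<c}"
  shows "sign p = inv_sign c p"
  using assms finite_lessThan
proof (induction rule: permutes_induct)
  case id
  show ?case by (auto simp: inv_sign_def inv_pairs_def intro!: prod.neutral)
next
  case (swap a b p)
  have t: "Transposition.transpose a b permutes {..<c}"
    using swap by (intro permutes_swap_id)
  have "inv_sign c (Transposition.transpose a b) = - 1"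
    using swap inv_sign_transpose[of a b c] inv_sign_transpose[of b a c]
    by (metis transpose_commute lessThan_iff linorder_neqE_nat)
  moreover have "permutation p" "permutation (Transposition.transpose a b)"
    using swap t by (auto intro: permutes_imp_permutation[OF finite_lessThan])
  ultimately show ?case
    using swap inv_sign_comp[OF t, of p] by (simp add: sign_compose sign_swap_id del: o_apply)
qed

text \<open>The bridge between the signs in \<open>wedge_coeff\<close>, which count inversions of
  words, and those in \<open>minor\<close>, which are signs of permutations.\<close>

lemma sign_inversions:
  assumes q: "q permutes {..<length S}" and S: "sorted_wrt (<) S"
  shows "sign q = (- 1) ^ inversions (permute_list q S)"
proof -
  have lt: "S ! i < S ! j \<longleftrightarrow> i < j" if "i < length S" "j < length S" for i j
    using sorted_wrt_nth_less[OF S] that by (metis linorder_neqE_nat order_less_asym order_less_irrefl)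
  have "{(i, j). i < j \<and> j < length (permute_list q S) \<and> permute_list q S ! j < permute_list q S ! i}
     = {(i, j). i < j \<and> j < length S \<and> \<not> q i < q j}"
  proof (intro Collect_cong, clarify)
    fix i j
    show "(i < j \<and> j < length (permute_list q S) \<and> permute_list q S ! j < permute_list q S ! i)
        = (i < j \<and> j < length S \<and> \<not> q i < q j)"
    proof (cases "i < j \<and> j < length S")
      case True
      then have "q i < length S" "q j < length S" "q i \<noteq> q j"
        using permutes_in_image[OF q] permutes_inj[OF q] by (auto simp: inj_def)
      then show ?thesis using True lt by (auto simp: permute_list_nth[OF q])
    qed auto
  qed
  then show ?thesis
    by (simp add: sign_eq_inv_sign[OF q] inv_sign_card inversions_def)
qed

subsection \<open>Minors\<close>

lemma permutes_lt: "q permutes {..<c} \<Longrightarrow> i < c \<Longrightarrow> q i < (c::nat)"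
  using permutes_in_image by fastforce

lemma permutation_lt: "q permutes {..<c} \<Longrightarrow> permutation q" for c :: nat
  by (rule permutes_imp_permutation[OF finite_lessThan])

lemma finite_perms [simp]: "finite {p. p permutes {..<c::nat}}"
  by (rule finite_permutations) simp

lemma minor_permute_rows:
  assumes q: "q permutes {..<length S}" and len: "length S = length C"
  shows "minor h (permute_list q S) C = of_int (sign q) * minor h S C"
proof -
  let ?c = "length C"
  have q': "q permutes {..<?c}" using q len by simp
  have "minor h (permute_list q S) C
     = (\<Sum>p | p permutes {..<?c}. of_int (sign p) * (\<Prod>i<?c. h (S ! q i) (C ! p i)))"
    unfolding minor_def
    by (intro sum.cong refl arg_cong2[of _ _ _ _ "(*)"] prod.cong) (simp add: permute_list_nth[OF q] len)
  also have "\<dots> = (\<Sum>p | p permutes {..<?c}. of_int (sign (p \<circ> q)) * (\<Prod>i<?c. h (S ! q i) (C ! (p \<circ> q) i)))"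
    by (rule sum_permutations_compose_right[OF q'])
  also have "\<dots> = (\<Sum>p | p permutes {..<?c}. of_int (sign q) * (of_int (sign p) * (\<Prod>i<?c. h (S ! i) (C ! p i))))"
  proof (intro sum.cong refl)
    fix p assume "p \<in> {p. p permutes {..<?c}}"
    then have "permutation p" by (simp add: permutation_lt)
    moreover have "(\<Prod>i<?c. h (S ! q i) (C ! (p \<circ> q) i)) = (\<Prod>i<?c. h (S ! i) (C ! p i))"
      using prod.reindex_bij_betw[OF permutes_imp_bij[OF q'], of "\<lambda>i. h (S ! i) (C ! p i)"] by simp
    ultimately show "of_int (sign (p \<circ> q)) * (\<Prod>i<?c. h (S ! q i) (C ! (p \<circ> q) i))
        = of_int (sign q) * (of_int (sign p) * (\<Prod>i<?c. h (S ! i) (C ! p i)))"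
      using permutation_lt[OF q'] by (simp add: sign_compose)
  qed
  finally show ?thesis by (simp add: minor_def sum_distrib_left)
qed


text \<open>Composition with the transposition of two equal rows matches even with odd permutations,
  so terms cancel in pairs. Antisymmetry alone would not be enough in characteristic two.\<close>

lemma minor_repeat:
  fixes h :: "nat \<Rightarrow> nat \<Rightarrow> 'k::field"
  assumes "\<not> distinct w" and len: "length w = length C"
  shows "minor h w C = 0"
proof -
  let ?c = "length C"
  obtain a b where ab: "a < ?c" "b < ?c" "a \<noteq> b" "w ! a = w ! b"
    using assms by (auto simp: distinct_conv_nth)
  let ?t = "Transposition.transpose a b"
  have t: "?t permutes {..<?c}" using ab by (intro permutes_swap_id) auto
  let ?F = "\<lambda>p. \<Prod>i<?c. h (w ! i) (C ! p i)"
  have F: "?F (p \<circ> ?t) = ?F p" for p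
  proof -
    have "?F (p \<circ> ?t) = (\<Prod>i<?c. h (w ! ?t i) (C ! p (?t i)))"
      using ab by (intro prod.cong) (auto simp: Transposition.transpose_def)
    also have "\<dots> = ?F p"
      using prod.reindex_bij_betw[OF permutes_imp_bij[OF t], of "\<lambda>i. h (w ! i) (C ! p i)"] by simp
    finally show ?thesis .
  qed
  let ?E = "{p. p permutes {..<?c} \<and> evenperm p}" and ?O = "{p. p permutes {..<?c} \<and> \<not> evenperm p}"
  have ev: "evenperm (p \<circ> ?t) \<longleftrightarrow> \<not> evenperm p" if "p permutes {..<?c}" for p
    using ab permutation_lt[OF that] permutation_lt[OF t] by (simp add: evenperm_comp evenperm_swap)
  have inv: "(p \<circ> ?t) \<circ> ?t = p" for p by (simp add: o_assoc[symmetric])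
  have "sum ?F ?O = sum ?F ?E"
    by (rule sum.reindex_bij_witness[where i = "\<lambda>p. p \<circ> ?t" and j = "\<lambda>p. p \<circ> ?t"])
      (use inv ev F t in \<open>auto simp: permutes_compose simp del: o_apply\<close>)
  moreover have "{p. p permutes {..<?c}} = ?E \<union> ?O" by auto
  then have "minor h w C = (\<Sum>p\<in>?E. ?F p) + (\<Sum>p\<in>?O. - ?F p)"
  proof -
    have fin: "finite ?E" "finite ?O" by (auto intro: finite_subset[OF _ finite_perms])
    have "(\<Sum>p\<in>?E \<union> ?O. of_int (sign p) * ?F p)
        = (\<Sum>p\<in>?E. of_int (sign p) * ?F p) + (\<Sum>p\<in>?O. of_int (sign p) * ?F p)"
      by (rule sum.union_disjoint[OF fin]) auto
    moreover have "(\<Sum>p\<in>?E. of_int (sign p) * ?F p) = (\<Sum>p\<in>?E. ?F p)"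
      "(\<Sum>p\<in>?O. of_int (sign p) * ?F p) = (\<Sum>p\<in>?O. - ?F p)"
      by (intro sum.cong refl; simp add: sign_def)+
    ultimately show ?thesis using \<open>{p. p permutes {..<?c}} = ?E \<union> ?O\<close> by (simp only: minor_def)
  qed
  ultimately show ?thesis by (simp add: sum_negf)
qed

lemma sum_words_of_sorted:
  assumes S: "sorted_wrt (<) (S :: nat list)"
  shows "(\<Sum>w\<in>{w. distinct w \<and> sort w = S}. f w) = (\<Sum>q | q permutes {..<length S}. f (permute_list q S))"
proof (rule sum.reindex_bij_betw[symmetric])
  have d: "distinct S" "sorted S" using S strict_sorted_iff by auto
  show "bij_betw (\<lambda>q. permute_list q S) {q. q permutes {..<length S}} {w. distinct w \<and> sort w = S}"
    unfolding bij_betw_def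
  proof (intro conjI inj_onI subset_antisym image_subsetI subsetI)
    fix p q assume pq: "p \<in> {q. q permutes {..<length S}}" "q \<in> {q. q permutes {..<length S}}"
      "permute_list p S = permute_list q S"
    show "p = q"
    proof
      fix i show "p i = q i"
      proof (cases "i < length S")
        case True
        then have "S ! p i = S ! q i"
          using pq by (metis mem_Collect_eq permute_list_nth)
        moreover have "p i < length S" "q i < length S" using pq True by (auto intro: permutes_lt)
        ultimately show ?thesis using d(1) by (simp add: nth_eq_iff_index_eq)
      next
        case False
        then show ?thesis using pq by (simp add: permutes_def)
      qed
    qed
  next
    fix q assume "q \<in> {q. q permutes {..<length S}}"
    then show "permute_list q S \<in> {w. distinct w \<and> sort w = S}"
      using d by (auto intro: properties_for_sort)
  next
    fix w assume "w \<in> {w. distinct w \<and> sort w = S}"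
    then have "mset w = mset S" by auto
    then obtain p where "p permutes {..<length S}" "permute_list p S = w"
      by (rule mset_eq_permutation)
    then show "w \<in> (\<lambda>q. permute_list q S) ` {q. q permutes {..<length S}}" by auto
  qed
qed

definition mmul :: "nat \<Rightarrow> (nat \<Rightarrow> nat \<Rightarrow> 'k::field) \<Rightarrow> (nat \<Rightarrow> nat \<Rightarrow> 'k) \<Rightarrow> nat \<Rightarrow> nat \<Rightarrow> 'k" where
  "mmul n g h = (\<lambda>a b. \<Sum>k<n. g a k * h k b)"

text \<open>Multiplying out the entries of the product gives a sum over words of intermediate
  indices. Words with a repetition contribute nothing by \<open>minor_repeat\<close>; the others are
  grouped by their sorted form.\<close>

lemma Cauchy_Binet:
  assumes len: "length R = length C"
  shows "minor (mmul n g h) R C = (\<Sum>S\<in>incr_lists n (length C). minor g R S * minor h S C)"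
proof -
  let ?c = "length C" and ?P = "{p. p permutes {..<length C}}"
  let ?W = "{w. length w = ?c \<and> (\<forall>i<?c. w ! i \<in> {..<n})}"
  have finW: "finite ?W" by (rule finite_lists_lt) simp
  have "minor (mmul n g h) R C
      = (\<Sum>p\<in>?P. \<Sum>w\<in>?W. of_int (sign p) * (\<Prod>i<?c. g (R ! i) (w ! i) * h (w ! i) (C ! p i)))"
    unfolding minor_def mmul_def by (subst prod_sum_lists) (simp_all add: sum_distrib_left)
  also have "\<dots> = (\<Sum>w\<in>?W. \<Sum>p\<in>?P. of_int (sign p) * (\<Prod>i<?c. g (R ! i) (w ! i) * h (w ! i) (C ! p i)))"
    by (rule sum.swap)
  also have "\<dots> = (\<Sum>w\<in>?W. (\<Prod>i<?c. g (R ! i) (w ! i)) * minor h w C)"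
    unfolding minor_def by (simp add: sum_distrib_left prod.distrib mult_ac)
  also have "\<dots> = (\<Sum>w\<in>{w\<in>?W. distinct w}. (\<Prod>i<?c. g (R ! i) (w ! i)) * minor h w C)"
    by (rule sum.mono_neutral_right[OF finW]) (auto simp: minor_repeat)
  also have "\<dots> = (\<Sum>S\<in>incr_lists n ?c. \<Sum>w\<in>{w\<in>{w\<in>?W. distinct w}. sort w = S}. (\<Prod>i<?c. g (R ! i) (w ! i)) * minor h w C)"
  proof (rule sum.group[symmetric])
    show "sort ` {w\<in>?W. distinct w} \<subseteq> incr_lists n ?c"
      by (auto simp: incr_lists_def strict_sorted_iff in_set_conv_nth)
    show "finite {w\<in>?W. distinct w}" by (rule finite_subset[OF _ finW]) auto
  qed simp
  also have "\<dots> = (\<Sum>S\<in>incr_lists n ?c. minor g R S * minor h S C)"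
  proof (rule sum.cong[OF refl])
    fix S assume S: "S \<in> incr_lists n ?c"
    then have lenS: "length S = ?c" and sS: "sorted_wrt (<) S" by (auto simp: incr_lists_def)
    have "{w\<in>{w\<in>?W. distinct w}. sort w = S} = {w. distinct w \<and> sort w = S}"
    proof -
      have "w \<in> ?W" if w: "sort w = S" for w
      proof -
        have "length w = ?c" "set w \<subseteq> {..<n}"
          using S arg_cong[OF w, of length] arg_cong[OF w, of set] by (simp_all add: incr_lists_def)
        then show ?thesis by (simp add: subset_iff)
      qed
      then show ?thesis by blast
    qed
    then have "(\<Sum>w\<in>{w\<in>{w\<in>?W. distinct w}. sort w = S}. (\<Prod>i<?c. g (R ! i) (w ! i)) * minor h w C)
       = (\<Sum>q | q permutes {..<length S}. (\<Prod>i<?c. g (R ! i) (permute_list q S ! i)) * minor h (permute_list q S) C)"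
      by (simp only: sum_words_of_sorted[OF sS])
    also have "\<dots> = (\<Sum>q | q permutes {..<length S}. (of_int (sign q) * (\<Prod>i<length S. g (R ! i) (S ! q i))) * minor h S C)"
    proof (intro sum.cong refl)
      fix q assume "q \<in> {q. q permutes {..<length S}}"
      then have q: "q permutes {..<length S}" by simp
      have "(\<Prod>i<?c. g (R ! i) (permute_list q S ! i)) = (\<Prod>i<length S. g (R ! i) (S ! q i))"
        by (intro prod.cong) (auto simp: lenS permute_list_nth[OF q])
      then show "(\<Prod>i<?c. g (R ! i) (permute_list q S ! i)) * minor h (permute_list q S) C
          = (of_int (sign q) * (\<Prod>i<length S. g (R ! i) (S ! q i))) * minor h S C"
        by (simp add: minor_permute_rows[OF q lenS])
    qed
    also have "\<dots> = minor g R S * minor h S C"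
      by (simp add: minor_def sum_distrib_right)
    finally show "(\<Sum>w\<in>{w\<in>{w\<in>?W. distinct w}. sort w = S}. (\<Prod>i<?c. g (R ! i) (w ! i)) * minor h w C)
       = minor g R S * minor h S C" .
  qed
  finally show ?thesis .
qed

lemma minor_cong:
  assumes "length R = length C" and "\<And>a b. a \<in> set R \<Longrightarrow> b \<in> set C \<Longrightarrow> g a b = h a b"
  shows "minor g R C = minor h R C"
  unfolding minor_def
proof (intro sum.cong refl arg_cong2[of _ _ _ _ "(*)"] prod.cong)
  fix p i assume "p \<in> {p. p permutes {..<length C}}" "i \<in> {..<length C}"
  then show "g (R ! i) (C ! p i) = h (R ! i) (C ! p i)"
    using assms(1) by (intro assms(2) nth_mem) (auto simp: permutes_lt)
qed

lemma polyfun_minor: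
  assumes "length R = length C" and "set R \<times> set C \<subseteq> V"
  shows "polyfun V (\<lambda>x. minor (curry x) R C)"
  unfolding minor_def curry_def
proof (intro polyspan_sum polyfun_mult polyfun_const polyfun_prod polyfun_var)
  fix p i assume "p \<in> {p. p permutes {..<length C}}" "i \<in> {..<length C}"
  then have "R ! i \<in> set R" "C ! p i \<in> set C" using assms(1) by (auto simp: permutes_lt)
  then show "(R ! i, C ! p i) \<in> V" using assms(2) by blast
qed

definition upper :: "(nat \<Rightarrow> nat \<Rightarrow> 'k::field) \<Rightarrow> bool" where
  "upper b \<longleftrightarrow> (\<forall>i j. j < i \<longrightarrow> b i j = 0)"

text \<open>Upper triangular matrices can only lower indices. If \<open>S ! i\<close> exceeded
  \<open>C ! i\<close>, the permutation of a nonzero term would inject the positions from i on into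
  the positions after i.\<close>

lemma minor_upper_nonzero:
  assumes b: "upper b" and S: "sorted_wrt (<) S" and C: "sorted_wrt (<) C"
    and len: "length S = length C" and nz: "minor b S C \<noteq> 0" and i: "i < length C"
  shows "S ! i \<le> C ! i"
proof (rule ccontr)
  assume less: "\<not> S ! i \<le> C ! i"
  let ?c = "length C"
  have "\<exists>p\<in>{p. p permutes {..<?c}}. of_int (sign p) * (\<Prod>i<?c. b (S ! i) (C ! p i)) \<noteq> 0"
    using nz unfolding minor_def by (meson sum.not_neutral_contains_not_neutral)
  then obtain p where p: "p permutes {..<?c}" and pz: "(\<Prod>i<?c. b (S ! i) (C ! p i)) \<noteq> 0"
    by auto
  have le: "S ! j \<le> C ! p j" if "j < ?c" for j
  proof -
    have "b (S ! j) (C ! p j) \<noteq> 0" using pz that by simp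
    then show ?thesis using b by (metis upper_def not_le)
  qed
  have "p ` {i..<?c} \<subseteq> {i<..<?c}"
  proof (intro image_subsetI)
    fix j assume j: "j \<in> {i..<?c}"
    have "S ! i \<le> S ! j" using S j len sorted_wrt_nth_less[OF S, of i j] by (cases "i = j") auto
    then have "C ! i < C ! p j" using le[of j] j less by auto
    moreover have "p j < ?c" using p j by (auto intro: permutes_lt)
    ultimately have "i < p j"
      using sorted_wrt_nth_less[OF C, of "p j" i] i by (metis linorder_neqE_nat less_asym less_irrefl)
    then show "p j \<in> {i<..<?c}" using \<open>p j < ?c\<close> by simp
  qed
  then have "card (p ` {i..<?c}) \<le> card {i<..<?c}" by (intro card_mono) auto
  moreover have "card (p ` {i..<?c}) = ?c - i"
    using card_image[of p "{i..<?c}"] permutes_inj_on[OF p] by simp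
  ultimately show False using i by simp
qed

lemma minor_upper_diag:
  assumes "upper b"
  shows "minor b [0..<c] [0..<c] = (\<Prod>i<c. b i i)"
proof -
  have "minor b [0..<c] [0..<c] = (\<Sum>p\<in>{id}. of_int (sign p) * (\<Prod>i<c. b i ([0..<c] ! p i)))"
    unfolding minor_def
  proof (rule sum.mono_neutral_cong_right)
    show "\<forall>p\<in>{p. p permutes {..<length [0..<c]}} - {id}.
        of_int (sign p) * (\<Prod>i<length [0..<c]. b ([0..<c] ! i) ([0..<c] ! p i)) = 0"
    proof
      fix p assume "p \<in> {p. p permutes {..<length [0..<c]}} - {id}"
      then have p: "p permutes {..<c}" "p \<noteq> id" by auto
      then obtain i where i: "i < c" "\<not> p i \<ge> i" using permutes_natset_ge by blast
      then have "b i (p i) = 0" using assms by (simp add: upper_def)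
      moreover have "p i < c" using p i by (auto intro: permutes_lt)
      ultimately have "(\<Prod>i<c. b ([0..<c] ! i) ([0..<c] ! p i)) = 0"
        using i by (intro prod_zero bexI[of _ i]) auto
      then show "of_int (sign p) * (\<Prod>i<length [0..<c]. b ([0..<c] ! i) ([0..<c] ! p i)) = 0" by simp
    qed
  qed (auto simp: permutes_id)
  then show ?thesis by simp
qed

text \<open>By \<open>minor_upper_nonzero\<close> a nonzero minor forces the entries of
  \<open>S\<close> below those of the initial segment, which is already the least increasing list.
  This is what makes the highest weight vector an eigenvector.\<close>

lemma minor_upper_flag:
  assumes b: "upper b" and S: "S \<in> incr_lists n c"
  shows "minor b S [0..<c] = (if S = [0..<c] then \<Prod>i<c. b i i else 0)"
proof (cases "minor b S [0..<c] = 0")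
  case True
  then show ?thesis using minor_upper_diag[OF b, of c] by auto
next
  case False
  have sS: "sorted_wrt (<) S" and len: "length S = c" using S by (auto simp: incr_lists_def)
  have le: "S ! i \<le> i" if "i < c" for i
    using minor_upper_nonzero[OF b sS _ _ False, of i] that len by simp
  have ge: "i \<le> S ! i" if "i < c" for i
    using that
  proof (induction i)
    case (Suc i)
    then have "S ! i < S ! Suc i" using sorted_wrt_nth_less[OF sS, of i "Suc i"] len by simp
    then show ?case using Suc by simp
  qed simp
  have "S = [0..<c]" using le ge len by (intro nth_equalityI) (auto intro: antisym)
  then show ?thesis using minor_upper_diag[OF b] by simp
qed

subsection \<open>Coordinate functions\<close>

definition scl :: "'k::field \<Rightarrow> ('i \<Rightarrow> 'k) \<Rightarrow> 'i \<Rightarrow> 'k" where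
  "scl c f = (\<lambda>i. c * f i)"

lemma scl_apply [simp]: "scl c f i = c * f i"
  by (simp add: scl_def)

interpretation fs: vector_space "scl :: 'k::field \<Rightarrow> ('i \<Rightarrow> 'k) \<Rightarrow> 'i \<Rightarrow> 'k"
  by standard (auto simp: fun_eq_iff algebra_simps)

interpretation fsp: vector_space_pair "scl :: 'k::field \<Rightarrow> ('i \<Rightarrow> 'k) \<Rightarrow> 'i \<Rightarrow> 'k"
    "scl :: 'k::field \<Rightarrow> ('j \<Rightarrow> 'k) \<Rightarrow> 'j \<Rightarrow> 'k" ..

lemma sum_fun_apply: "(\<Sum>i\<in>A. f i) x = (\<Sum>i\<in>A. f i x)"
  by (induction A rule: infinite_finite_induct) simp_all

lemma ext_index_eq:
  "ext_index n cs = {Ss. length Ss = length cs \<and> (\<forall>j<length cs. Ss ! j \<in> incr_lists n (cs ! j))}"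
  by (auto simp: ext_index_def incr_lists_def)

lemma finite_ext_index [simp]: "finite (ext_index n cs)"
  unfolding ext_index_eq by (rule finite_lists_lt) simp

lemma ext_index_map_length: "Ss \<in> ext_index n cs \<Longrightarrow> map length Ss = cs"
  by (auto simp: ext_index_def intro: nth_equalityI)

lemma ext_index_length: "Ss \<in> ext_index n cs \<Longrightarrow> length Ss = length cs"
  by (simp add: ext_index_def)

lemma ext_index_nth: "Ss \<in> ext_index n cs \<Longrightarrow> j < length cs \<Longrightarrow> Ss ! j \<in> incr_lists n (cs ! j)"
  by (simp add: ext_index_eq)

lemma incr_lists_length: "S \<in> incr_lists n c \<Longrightarrow> length S = c"
  by (simp add: incr_lists_def)

text \<open>The image of the highest weight vector of the Weyl module with column lengths \<open>cs\<close> under \<open>g\<close>.\<close>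
definition vec :: "nat \<Rightarrow> nat list \<Rightarrow> (nat \<Rightarrow> nat \<Rightarrow> 'k::field) \<Rightarrow> nat list list \<Rightarrow> 'k" where
  "vec n cs g = (\<lambda>Ss. if Ss \<in> ext_index n cs
     then \<Prod>j<length cs. minor g (Ss ! j) [0..<cs ! j] else 0)"

lemma vec_outside: "Ss \<notin> ext_index n cs \<Longrightarrow> vec n cs g Ss = 0"
  by (simp add: vec_def)

lemma linear_act: "Vector_Spaces.linear scl scl (act n g)"
  unfolding Vector_Spaces.linear_iff
proof (intro conjI allI fs.vector_space_axioms ext)
  fix x y :: "nat list list \<Rightarrow> 'a" and c :: 'a and Ss
  show "act n g (x + y) Ss = (act n g x + act n g y) Ss"
    by (simp add: act_def distrib_right sum.distrib)
  show "act n g (scl c x) Ss = scl c (act n g x) Ss"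
    by (simp add: act_def sum_distrib_left mult.assoc)
qed

lemma act_add: "act n g (x + y) = act n g x + act n g y"
  and act_scl: "act n g (scl c x) = scl c (act n g x)"
  using linear_act[of n g] by (simp_all only: Vector_Spaces.linear_iff)

lemma act_zero: "act n g 0 = 0"
  using act_scl[of n g 0 0] by (simp only: fs.scale_zero_left)

text \<open>\<open>act\<close> reads the column lengths off its argument. For a function supported
  on a single shape they can be fixed in advance, since every other shape meets only zeros.\<close>

lemma act_supported:
  assumes "\<And>Ss. Ss \<notin> ext_index n cs \<Longrightarrow> f Ss = 0"
  shows "act n g f Ss' = (if Ss' \<in> ext_index n cs
     then \<Sum>Ss\<in>ext_index n cs. f Ss * (\<Prod>j<length cs. minor g (Ss' ! j) (Ss ! j)) else 0)"
proof (cases "map length Ss' = cs")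
  case True
  then show ?thesis by (auto simp: act_def)
next
  case False
  then have "Ss' \<notin> ext_index n cs" using ext_index_map_length by blast
  moreover have "f Ss = 0" if "Ss \<in> ext_index n (map length Ss')" for Ss
    using False ext_index_map_length[OF that] ext_index_map_length[of Ss n cs] by (intro assms) auto
  ultimately show ?thesis by (simp add: act_def)
qed

text \<open>Cauchy-Binet in every column, followed by the distributive law across the
  columns.\<close>

lemma act_vec: "act n g (vec n cs h) = vec n cs (mmul n g h)"
proof
  fix Ss'
  show "act n g (vec n cs h) Ss' = vec n cs (mmul n g h) Ss'"
  proof (cases "Ss' \<in> ext_index n cs")
    case True
    have "act n g (vec n cs h) Ss' = (\<Sum>Ss\<in>ext_index n cs.
        (\<Prod>j<length cs. minor h (Ss ! j) [0..<cs ! j]) * (\<Prod>j<length cs. minor g (Ss' ! j) (Ss ! j)))"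
      by (subst act_supported[where cs = cs]) (auto simp: vec_def True)
    also have "\<dots> = (\<Sum>Ss\<in>ext_index n cs. \<Prod>j<length cs.
        minor g (Ss' ! j) (Ss ! j) * minor h (Ss ! j) [0..<cs ! j])"
      by (simp add: prod.distrib mult.commute)
    also have "\<dots> = (\<Prod>j<length cs. \<Sum>S\<in>incr_lists n (cs ! j).
        minor g (Ss' ! j) S * minor h S [0..<cs ! j])"
      unfolding ext_index_eq by (rule prod_sum_lists[symmetric]) simp
    also have "\<dots> = (\<Prod>j<length cs. minor (mmul n g h) (Ss' ! j) [0..<cs ! j])"
      using True by (intro prod.cong) (auto simp: Cauchy_Binet dest!: ext_index_nth incr_lists_length)
    finally show ?thesis by (simp add: vec_def True)
  next
    case False
    then show ?thesis by (subst act_supported[where cs = cs]) (auto simp: vec_def)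
  qed
qed

lemma vec_cong:
  assumes "\<And>a b. a < n \<Longrightarrow> b < n \<Longrightarrow> g a b = h a b"
    and cs: "\<And>c. c \<in> set cs \<Longrightarrow> c \<le> n"
  shows "vec n cs g = vec n cs h"
proof -
  have "minor g (Ss ! j) [0..<cs ! j] = minor h (Ss ! j) [0..<cs ! j]"
    if "Ss \<in> ext_index n cs" "j < length cs" for Ss j
  proof (rule minor_cong)
    have S: "Ss ! j \<in> incr_lists n (cs ! j)" using that by (rule ext_index_nth)
    then show "length (Ss ! j) = length [0..<cs ! j]" by (simp add: incr_lists_def)
    fix a b assume "a \<in> set (Ss ! j)" "b \<in> set [0..<cs ! j]"
    moreover have "cs ! j \<le> n" using cs that by simp
    ultimately show "g a b = h a b" using S by (intro assms(1)) (auto simp: incr_lists_def)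
  qed
  then show ?thesis by (auto simp: vec_def fun_eq_iff intro!: prod.cong)
qed

lemma polyfun_act:
  assumes "\<And>Ss. Ss \<notin> ext_index n cs \<Longrightarrow> f Ss = 0"
  shows "polyfun ({..<n} \<times> {..<n}) (\<lambda>x. act n (curry x) f Ss')"
proof (cases "Ss' \<in> ext_index n cs")
  case True
  have "polyfun ({..<n} \<times> {..<n}) (\<lambda>x. \<Sum>Ss\<in>ext_index n cs. f Ss * (\<Prod>j<length cs. minor (curry x) (Ss' ! j) (Ss ! j)))"
  proof (intro polyspan_sum polyfun_mult polyfun_const polyfun_prod polyfun_minor)
    fix Ss j assume "Ss \<in> ext_index n cs" and j: "j \<in> {..<length cs}"
    then have "Ss ! j \<in> incr_lists n (cs ! j)" "Ss' ! j \<in> incr_lists n (cs ! j)"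
      using True by (auto intro: ext_index_nth)
    then show "length (Ss' ! j) = length (Ss ! j)" "set (Ss' ! j) \<times> set (Ss ! j) \<subseteq> {..<n} \<times> {..<n}"
      by (auto simp: incr_lists_def)
  qed
  then show ?thesis using assms True by (simp add: act_supported[where cs = cs])
next
  case False
  then show ?thesis using assms by (simp add: act_supported[where cs = cs] polyfun_const)
qed

subsection \<open>Partitions and their conjugates\<close>

lemma filter_length_nth:
  fixes xs :: "nat list"
  shows "sorted_wrt (\<ge>) xs \<Longrightarrow> i < length (filter (\<lambda>x. j < x) xs) \<longleftrightarrow> i < length xs \<and> j < xs ! i"
proof (induction xs arbitrary: i)
  case (Cons x xs)
  show ?case
  proof (cases "j < x")
    case True
    then show ?thesis using Cons by (cases i) auto
  next
    case False
    then have "filter (\<lambda>x. j < x) (x # xs) = []" using Cons.prems by (force simp: filter_empty_conv)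
    moreover have "\<not> j < (x # xs) ! i" if "i < length (x # xs)"
      using Cons.prems False that by (cases i) (force dest: nth_mem)+
    ultimately show ?thesis by auto
  qed
qed simp

lemma filter_eq_take:
  fixes f :: "'a \<Rightarrow> nat"
  shows "sorted_wrt (\<ge>) (map f xs) \<Longrightarrow>
    filter (\<lambda>x. j < f x) xs = take (length (filter (\<lambda>x. j < f x) xs)) xs"
proof (induction xs)
  case (Cons x xs)
  show ?case
  proof (cases "j < f x")
    case False
    then have "filter (\<lambda>x. j < f x) (x # xs) = []"
      using Cons.prems by (force simp: filter_empty_conv)
    then show ?thesis by simp
  qed (use Cons in simp)
qed simp

lemma sorted_rev_iff: "sorted (rev xs) \<longleftrightarrow> sorted_wrt (\<ge>) (xs :: nat list)"
  by (simp add: sorted_wrt_rev)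

locale part_ctxt =
  fixes n :: nat and nu :: "nat list"
  assumes len: "length nu = n" and sorted: "sorted_wrt (\<ge>) nu"
begin

lemma length_conj: "length (conj_part nu) = part nu 0"
  by (simp add: conj_part_def)

lemma conj_nth: "j < part nu 0 \<Longrightarrow> i < conj_part nu ! j \<longleftrightarrow> i < n \<and> j < nu ! i"
  using filter_length_nth[OF sorted] by (simp add: conj_part_def len)

lemma conj_le: "c \<in> set (conj_part nu) \<Longrightarrow> c \<le> n"
  using len by (auto simp: conj_part_def)

lemma nu_le_part: "i < n \<Longrightarrow> nu ! i \<le> part nu 0"
  using sorted len by (cases i) (auto simp: part_def dest: sorted_wrt_nth_less[of _ _ 0])

lemma cells_eq:
  "{(j, i). j < part nu 0 \<and> i < conj_part nu ! j} = {(j, i). i < n \<and> j < nu ! i}"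
  using conj_nth nu_le_part by fastforce

lemma sum_cells: "(\<Sum>j<part nu 0. \<Sum>i<conj_part nu ! j. f i j) = (\<Sum>i<n. \<Sum>j<nu ! i. f i j)"
proof -
  have "(\<Sum>j<part nu 0. \<Sum>i<conj_part nu ! j. f i j)
     = (\<Sum>(j, i)\<in>{(j, i). j < part nu 0 \<and> i < conj_part nu ! j}. f i j)"
    by (subst sum.Sigma) (auto intro!: sum.cong)
  also have "\<dots> = (\<Sum>(i, j)\<in>{(i, j). i < n \<and> j < nu ! i}. f i j)"
    unfolding cells_eq
    by (rule sum.reindex_bij_witness[where i = prod.swap and j = prod.swap]) auto
  also have "\<dots> = (\<Sum>i<n. \<Sum>j<nu ! i. f i j)"
    by (subst sum.Sigma) (auto intro!: sum.cong)
  finally show ?thesis .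
qed

lemma prod_cells: "(\<Prod>j<part nu 0. \<Prod>i<conj_part nu ! j. f i j) = (\<Prod>i<n. \<Prod>j<nu ! i. f i j)"
proof -
  have "(\<Prod>j<part nu 0. \<Prod>i<conj_part nu ! j. f i j)
     = (\<Prod>(j, i)\<in>{(j, i). j < part nu 0 \<and> i < conj_part nu ! j}. f i j)"
    by (subst prod.Sigma) (auto intro!: prod.cong)
  also have "\<dots> = (\<Prod>(i, j)\<in>{(i, j). i < n \<and> j < nu ! i}. f i j)"
    unfolding cells_eq
    by (rule prod.reindex_bij_witness[where i = prod.swap and j = prod.swap]) auto
  also have "\<dots> = (\<Prod>i<n. \<Prod>j<nu ! i. f i j)"
    by (subst prod.Sigma) (auto intro!: prod.cong)
  finally show ?thesis .
qed

end

lemma part_ctxtI: "is_partition n r nu \<Longrightarrow> part_ctxt n nu"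
  by (simp add: is_partition_def part_ctxt_def sorted_rev_iff)

subsection \<open>The Weyl module is spanned by the orbit of the highest weight vector\<close>

definition words :: "nat \<Rightarrow> nat \<Rightarrow> nat list set" where
  "words n c = {w. length w = c \<and> set w \<subseteq> {..<n}}"

lemma finite_words [simp]: "finite (words n c)"
  using finite_lists_length_eq[of "{..<n}" c] by (simp add: words_def conj_commute)

text \<open>The minor is the coefficient of \<open>S\<close> in the wedge of the first c columns of
  g. A word records which row is used in each column, the permutation in \<open>minor\<close> which
  column is used in each row; hence the passage to the inverse.\<close>

lemma minor_wedge:
  assumes S: "S \<in> incr_lists n c"
  shows "(minor g S [0..<c] :: 'k::field) = (\<Sum>w\<in>words n c. wedge_coeff w S * (\<Prod>i<c. g (w ! i) i))"
proof -
  have lenS: "length S = c" and sS: "sorted_wrt (<) S" using S by (auto simp: incr_lists_def)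
  have sub: "w \<in> words n c" if w: "sort w = S" for w
    using S arg_cong[OF w, of length] arg_cong[OF w, of set] by (simp_all add: incr_lists_def words_def)
  have "(\<Sum>w\<in>words n c. wedge_coeff w S * (\<Prod>i<c. g (w ! i) i) :: 'k)
      = (\<Sum>w\<in>{w. distinct w \<and> sort w = S}. (- 1) ^ inversions w * (\<Prod>i<c. g (w ! i) i))"
    by (rule sum.mono_neutral_cong_right) (use sub in \<open>auto simp: wedge_coeff_def\<close>)
  also have "\<dots> = (\<Sum>q | q permutes {..<length S}. (- 1) ^ inversions (permute_list q S) * (\<Prod>i<c. g (permute_list q S ! i) i))"
    by (rule sum_words_of_sorted[OF sS])
  also have "\<dots> = (\<Sum>q | q permutes {..<c}. of_int (sign (inv q)) * (\<Prod>i<c. g (S ! i) (inv q i)))"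
  proof (rule sum.cong)
    fix q assume "q \<in> {q. q permutes {..<c}}"
    then have q: "q permutes {..<c}" "q permutes {..<length S}" by (simp_all add: lenS)
    have "(\<Prod>i<c. g (permute_list q S ! i) i) = (\<Prod>i<c. g (S ! q i) (inv q (q i)))"
      by (intro prod.cong) (auto simp: permute_list_nth[OF q(2)] lenS permutes_inverses[OF q(1)])
    also have "\<dots> = (\<Prod>i<c. g (S ! i) (inv q i))"
      by (rule prod.reindex_bij_betw[OF permutes_imp_bij[OF q(1)]])
    finally show "(- 1) ^ inversions (permute_list q S) * (\<Prod>i<c. g (permute_list q S ! i) i)
        = of_int (sign (inv q)) * (\<Prod>i<c. g (S ! i) (inv q i))"
      by (simp add: sign_inversions[OF q(2) sS] sign_inverse[OF permutation_lt[OF q(1)]])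
  qed (simp add: lenS)
  also have "\<dots> = (\<Sum>p | p permutes {..<c}. of_int (sign p) * (\<Prod>i<c. g (S ! i) (p i)))"
    by (rule sum_permutations_inverse[symmetric])
  also have "\<dots> = minor g S [0..<c]"
    unfolding minor_def by (intro sum.cong prod.cong arg_cong2[of _ _ _ _ "(*)"]) (auto simp: permutes_lt)
  finally show ?thesis by simp
qed

text \<open>The coefficient of the basis element \<open>ms\<close> in g applied to the tensor
  product of the divided powers of the basis vectors e_i. With divided powers no multinomial factors
  appear.\<close>

definition lmon :: "(nat \<Rightarrow> nat \<Rightarrow> 'k::field) \<Rightarrow> nat multiset list \<Rightarrow> 'k" where
  "lmon g ms = (\<Prod>i<length ms. mon (\<lambda>a. g a i) (ms ! i))"

context part_ctxt
begin

definition all_fillings :: "nat list list set" where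
  "all_fillings = {ws. length ws = n \<and> (\<forall>i<n. ws ! i \<in> words n (nu ! i))}"

lemma finite_all_fillings: "finite all_fillings"
  unfolding all_fillings_def by (rule finite_lists_lt) simp

lemma D_basis_eq: "D_basis n nu = map mset ` all_fillings"
proof (intro subset_antisym subsetI)
  fix ms assume ms: "ms \<in> D_basis n nu"
  define ws where "ws = map (\<lambda>M. SOME w. mset w = M) ms"
  have ex: "mset (SOME w. mset w = M) = M" for M :: "nat multiset"
    using ex_mset by (rule someI_ex)
  have "map mset ws = ms" by (simp add: ws_def comp_def ex)
  moreover have "ws ! i \<in> words n (nu ! i)" if "i < n" for i
  proof -
    have "mset (ws ! i) = ms ! i" using that ms len by (simp add: ws_def D_basis_def ex)
    from arg_cong[OF this, of size] arg_cong[OF this, of set_mset]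
    show ?thesis using ms that len by (simp add: words_def D_basis_def)
  qed
  moreover have "length ws = n" using ms len by (simp add: ws_def D_basis_def)
  ultimately show "ms \<in> map mset ` all_fillings" 
    by (intro image_eqI[of _ _ ws]) (simp_all add: all_fillings_def)
qed (auto simp: D_basis_def all_fillings_def words_def len subset_iff)

lemma finite_D_basis: "finite (D_basis n nu)"
  unfolding D_basis_eq using finite_all_fillings by simp

lemma fillings_eq: "ms \<in> D_basis n nu \<Longrightarrow> fillings ms = {ws \<in> all_fillings. map mset ws = ms}"
proof (intro subset_antisym subsetI)
  fix ws assume ms: "ms \<in> D_basis n nu" and ws: "ws \<in> fillings ms"
  have "ws ! i \<in> words n (nu ! i)" if "i < n" for i
  proof -
    have "mset (ws ! i) = ms ! i" using that ms ws len by (simp add: fillings_def D_basis_def)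
    from arg_cong[OF this, of size] arg_cong[OF this, of set_mset]
    show ?thesis using ms that len by (simp add: words_def D_basis_def)
  qed
  then show "ws \<in> {ws \<in> all_fillings. map mset ws = ms}"
    using ms ws len by (auto simp: fillings_def all_fillings_def D_basis_def intro!: nth_equalityI)
qed (auto simp: fillings_def)

lemma sum_fillings:
  "(\<Sum>ms\<in>D_basis n nu. \<Sum>ws\<in>fillings ms. f ms ws) = (\<Sum>ws\<in>all_fillings. f (map mset ws) ws)"
proof -
  have "(\<Sum>ms\<in>D_basis n nu. \<Sum>ws\<in>fillings ms. f ms ws)
      = (\<Sum>ms\<in>D_basis n nu. \<Sum>ws\<in>{ws \<in> all_fillings. map mset ws = ms}. f (map mset ws) ws)"
    by (intro sum.cong) (auto simp: fillings_eq)
  also have "\<dots> = (\<Sum>ws\<in>all_fillings. f (map mset ws) ws)"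
    by (rule sum.group) (auto simp: finite_all_fillings finite_D_basis D_basis_eq)
  finally show ?thesis .
qed

text \<open>Row lengths decrease, so the rows long enough to meet column j form an initial segment,
  and filtering is truncation.\<close>

lemma col_eq:
  assumes ws: "ws \<in> all_fillings" and j: "j < part nu 0"
  shows "col ws j = map (\<lambda>i. ws ! i ! j) [0..<conj_part nu ! j]"
proof -
  have ml: "map length ws = nu"
    using ws by (auto simp: all_fillings_def words_def len intro!: nth_equalityI)
  have c: "length (filter (\<lambda>w. j < length w) ws) = conj_part nu ! j"
    using j by (simp add: conj_part_def filter_map comp_def flip: ml)
  have "filter (\<lambda>w. j < length w) ws = take (conj_part nu ! j) ws"
    using filter_eq_take[of length ws j] sorted ml c by simp
  moreover have "conj_part nu ! j \<le> length ws" using c length_filter_le by metis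
  ultimately show ?thesis by (auto simp: col_def intro!: nth_equalityI)
qed

lemma lmon_fillings:
  fixes g :: "nat \<Rightarrow> nat \<Rightarrow> 'b::field"
  assumes "ws \<in> all_fillings"
  shows "lmon g (map mset ws) = (\<Prod>i<n. \<Prod>j<nu ! i. g (ws ! i ! j) i)"
proof -
  have "mon f (mset w) = (\<Prod>j<length w. f (w ! j))" for f :: "nat \<Rightarrow> 'b" and w
    by (induction w) (simp_all add: prod.lessThan_Suc_shift del: prod.lessThan_Suc)
  then show ?thesis using assms by (auto simp: lmon_def all_fillings_def words_def intro!: prod.cong)
qed

text \<open>Computes d' on the orbit of the generating tensor. Reading a filling by columns instead
  of rows turns it into independent column words, so the sum factors into one minor per
  column.\<close>

lemma d'_lmon:
  assumes Ss: "Ss \<in> ext_index n (conj_part nu)"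
  shows "(\<Sum>ms\<in>D_basis n nu. lmon g ms * (\<Sum>ws\<in>fillings ms. \<Prod>j<length Ss. wedge_coeff (col ws j) (Ss ! j)))
     = (\<Prod>j<part nu 0. minor g (Ss ! j) [0..<conj_part nu ! j])"
proof -
  let ?m = "part nu 0" and ?c = "conj_part nu"
  let ?X = "{cols. length cols = ?m \<and> (\<forall>j<?m. cols ! j \<in> words n (?c ! j))}"
  have lenS: "length Ss = ?m" using Ss ext_index_length length_conj by simp
  have "(\<Sum>ms\<in>D_basis n nu. lmon g ms * (\<Sum>ws\<in>fillings ms. \<Prod>j<length Ss. wedge_coeff (col ws j) (Ss ! j)))
     = (\<Sum>ws\<in>all_fillings. lmon g (map mset ws) * (\<Prod>j<?m. wedge_coeff (col ws j) (Ss ! j)))"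
    by (simp add: sum_distrib_left sum_fillings lenS)
  also have "\<dots> = (\<Sum>ws\<in>all_fillings. \<Prod>j<?m. wedge_coeff (col ws j) (Ss ! j) * (\<Prod>i<?c ! j. g (ws ! i ! j) i))"
    by (intro sum.cong refl) (simp add: lmon_fillings prod_cells[symmetric] prod.distrib mult.commute)
  also have "\<dots> = (\<Sum>cols\<in>?X. \<Prod>j<?m. wedge_coeff (cols ! j) (Ss ! j) * (\<Prod>i<?c ! j. g (cols ! j ! i) i))"
  proof (rule sum.reindex_bij_witness[where j = "\<lambda>ws. map (col ws) [0..<?m]"
        and i = "\<lambda>cols. map (\<lambda>i. map (\<lambda>j. cols ! j ! i) [0..<nu ! i]) [0..<n]"])
    fix ws assume ws: "ws \<in> all_fillings"
    then have l: "length ws = n" "\<And>i. i < n \<Longrightarrow> length (ws ! i) = nu ! i"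
      "\<And>i j. i < n \<Longrightarrow> j < nu ! i \<Longrightarrow> ws ! i ! j < n"
      by (simp_all add: all_fillings_def words_def subset_iff)
    show "map (\<lambda>i. map (\<lambda>j. map (col ws) [0..<?m] ! j ! i) [0..<nu ! i]) [0..<n] = ws"
    proof (rule nth_equalityI)
      fix i assume "i < length (map (\<lambda>i. map (\<lambda>j. map (col ws) [0..<?m] ! j ! i) [0..<nu ! i]) [0..<n])"
      then have i: "i < n" by simp
      show "map (\<lambda>i. map (\<lambda>j. map (col ws) [0..<?m] ! j ! i) [0..<nu ! i]) [0..<n] ! i = ws ! i"
      proof (rule nth_equalityI)
        fix j assume "j < length (map (\<lambda>i. map (\<lambda>j. map (col ws) [0..<?m] ! j ! i) [0..<nu ! i]) [0..<n] ! i)"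
        then have j: "j < nu ! i" using i by simp
        then have "j < ?m" using nu_le_part[OF i] by simp
        then show "map (\<lambda>i. map (\<lambda>j. map (col ws) [0..<?m] ! j ! i) [0..<nu ! i]) [0..<n] ! i ! j = ws ! i ! j"
          using i j conj_nth[of j i] by (simp add: col_eq[OF ws])
      qed (use i l in simp)
    qed (use l in simp)
    show "map (col ws) [0..<?m] \<in> ?X"
      using l conj_nth by (auto simp: col_eq[OF ws] words_def)
    show "(\<Prod>j<?m. wedge_coeff (map (col ws) [0..<?m] ! j) (Ss ! j) * (\<Prod>i<?c ! j. g (map (col ws) [0..<?m] ! j ! i) i))
       = (\<Prod>j<?m. wedge_coeff (col ws j) (Ss ! j) * (\<Prod>i<?c ! j. g (ws ! i ! j) i))"
      by (intro prod.cong arg_cong2[of _ _ _ _ "(*)"]) (auto simp: col_eq[OF ws])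
  next
    fix cols assume cols: "cols \<in> ?X"
    then have l: "length cols = ?m" "\<And>j. j < ?m \<Longrightarrow> length (cols ! j) = ?c ! j"
      "\<And>i j. j < ?m \<Longrightarrow> i < ?c ! j \<Longrightarrow> cols ! j ! i < n"
      by (simp_all add: words_def subset_iff)
    let ?ws = "map (\<lambda>i. map (\<lambda>j. cols ! j ! i) [0..<nu ! i]) [0..<n]"
    have "cols ! j ! i < n" if "i < n" "j < nu ! i" for i j
    proof -
      have "j < ?m" using nu_le_part[OF that(1)] that(2) by simp
      then show ?thesis using l(3)[of j i] conj_nth[of j i] that by blast
    qed
    then show ws: "?ws \<in> all_fillings" by (auto simp: all_fillings_def words_def)
    show "map (col ?ws) [0..<?m] = cols"
    proof (rule nth_equalityI)
      fix j assume "j < length (map (col ?ws) [0..<?m])"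
      then have j: "j < ?m" by simp
      show "map (col ?ws) [0..<?m] ! j = cols ! j"
        using j l conj_nth[OF j] by (auto simp: col_eq[OF ws j] intro!: nth_equalityI)
    qed (use l in simp)
  qed
  also have "\<dots> = (\<Prod>j<?m. \<Sum>w\<in>words n (?c ! j). wedge_coeff w (Ss ! j) * (\<Prod>i<?c ! j. g (w ! i) i))"
    by (rule prod_sum_lists[symmetric]) simp
  also have "\<dots> = (\<Prod>j<?m. minor g (Ss ! j) [0..<?c ! j])"
    using Ss by (intro prod.cong refl minor_wedge[symmetric] ext_index_nth) (auto simp: length_conj)
  finally show ?thesis .
qed

definition dB :: "nat multiset list \<Rightarrow> nat list list \<Rightarrow> 'k::field" where
  "dB ms = d' n nu (\<lambda>ms'. if ms' = ms then 1 else 0)"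

lemma dB_apply:
  assumes "ms \<in> D_basis n nu"
  shows "(dB ms Ss :: 'k::field) = (if Ss \<in> ext_index n (conj_part nu)
     then \<Sum>ws\<in>fillings ms. \<Prod>j<length Ss. wedge_coeff (col ws j) (Ss ! j) else 0)"
proof -
  have "(\<Sum>ms'\<in>D_basis n nu. (if ms' = ms then 1 else 0) * f ms') = (f ms :: 'k)" for f
    using finite_D_basis assms by (simp add: if_distrib[of "\<lambda>x. x * _"] cong: if_cong)
  then show ?thesis unfolding dB_def d'_def by simp
qed

lemma d'_eq: "d' n nu x = (\<Sum>ms\<in>D_basis n nu. scl (x ms) (dB ms))"
  by (rule ext) (simp add: sum_fun_apply dB_apply, simp add: d'_def)

lemma vec_eq: "vec n (conj_part nu) g = (\<Sum>ms\<in>D_basis n nu. scl (lmon g ms) (dB ms))"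
  by (rule ext) (simp add: sum_fun_apply dB_apply vec_def d'_lmon length_conj)

lemma weyl_eq_span: "weyl n nu = fs.span (dB ` D_basis n nu :: (nat list list \<Rightarrow> 'k::field) set)"
proof (intro subset_antisym subsetI)
  fix y :: "nat list list \<Rightarrow> 'k" assume "y \<in> weyl n nu"
  then obtain x where "y = d' n nu x" by (auto simp: weyl_def)
  then show "y \<in> fs.span (dB ` D_basis n nu)"
    unfolding d'_eq by (simp only:) (intro fs.span_sum fs.span_scale fs.span_base imageI)
next
  fix y :: "nat list list \<Rightarrow> 'k" assume y: "y \<in> fs.span (dB ` D_basis n nu)"
  \<comment> \<open>d' only sees the coordinates in \<open>D_basis\<close>, so the support condition
    of \<open>D_space\<close> can be ignored.\<close>
  have inj: "d' n nu x \<in> weyl n nu" for x :: "nat multiset list \<Rightarrow> 'k"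
  proof -
    have "d' n nu x = d' n nu (\<lambda>ms. if ms \<in> D_basis n nu then x ms else 0)"
      unfolding d'_eq by (intro sum.cong) auto
    then show ?thesis by (auto simp: weyl_def D_space_def)
  qed
  from y show "y \<in> weyl n nu"
  proof (induction rule: fs.span_induct_alt)
    case base
    have "d' n nu (\<lambda>_. 0) = (0 :: nat list list \<Rightarrow> 'k)" by (simp add: d'_eq fun_eq_iff sum_fun_apply)
    then show ?case using inj by metis
  next
    case (step c b y)
    then obtain ms x where ms: "ms \<in> D_basis n nu" "b = dB ms" "y = d' n nu x" by (auto simp: weyl_def)
    have "scl c b + y = d' n nu (\<lambda>ms'. (if ms' = ms then c else 0) + x ms')"
      using ms finite_D_basis
      by (simp add: d'_eq fun_eq_iff sum_fun_apply distrib_right sum.distrib if_distrib[of "\<lambda>x. x * _"] cong: if_cong)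
    then show ?case using inj by metis
  qed
qed

lemma subspace_weyl: "fs.subspace (weyl n nu)"
  unfolding weyl_eq_span by (rule fs.subspace_span)

lemma vec_mem_weyl: "vec n (conj_part nu) g \<in> weyl n nu"
  unfolding weyl_eq_span vec_eq by (intro fs.span_sum fs.span_scale fs.span_base imageI)

lemma weyl_supported: "w \<in> weyl n nu \<Longrightarrow> Ss \<notin> ext_index n (conj_part nu) \<Longrightarrow> w Ss = 0"
  by (auto simp: weyl_def d'_def)

text \<open>A divided power monomial is the coefficient vector of a monomial in the matrix entries, so
  over an infinite field the Weyl module is spanned by any Zariski dense part of the orbit.\<close>
lemma weyl_span_dense:
  fixes D :: "(nat \<times> nat \<Rightarrow> 'k::field) \<Rightarrow> 'k"
  assumes inf: "infinite (UNIV :: 'k set)" and D: "polyfun W D" "D x1 \<noteq> 0"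
  shows "weyl n nu = fs.span {vec n (conj_part nu) g | g. D (case_prod g) \<noteq> 0}" (is "_ = fs.span ?V")
proof (rule subset_antisym)
  \<comment> \<open>A letter a in row i becomes the matrix variable (a, i). Row i is recovered from
    the second components, so different \<open>ms\<close> give different monomials.\<close>
  define P where "P ms = (\<Sum>i<n. image_mset (\<lambda>a. (a, i)) (ms ! i))" for ms :: "nat multiset list"
  have lmon: "lmon g ms = mon (case_prod g) (P ms)" if "ms \<in> D_basis n nu" for ms and g :: "nat \<Rightarrow> nat \<Rightarrow> 'k"
    using that len by (simp add: lmon_def P_def mon_sum mon_image D_basis_def)
  have inj: "inj_on P (D_basis n nu)"
  proof (rule inj_on_inverseI)
    fix ms assume ms: "ms \<in> D_basis n nu"
    have "image_mset fst (filter_mset (\<lambda>x. snd x = i) (P ms)) = ms ! i" if "i < n" for i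
    proof -
      have 1: "filter_mset (\<lambda>x. snd x = i) (P ms) = (\<Sum>k<n. if k = i then image_mset (\<lambda>a. (a, k)) (ms ! k) else {#})"
        unfolding P_def
        by (induction n) (auto simp: filter_mset_image_mset comp_def)
      show ?thesis unfolding 1 using that by (simp add: multiset.map_comp comp_def)
    qed
    then show "map (\<lambda>i. image_mset fst (filter_mset (\<lambda>x. snd x = i) (P ms))) [0..<n] = ms"
      using ms len by (auto simp: D_basis_def intro!: nth_equalityI)
  qed
  have "dB ms \<in> fs.span ?V" if "ms \<in> D_basis n nu" for ms
  proof (rule fs.mon_coeff_mem[OF inf finite_D_basis inj D fs.subspace_span _ that])
    fix x :: "nat \<times> nat \<Rightarrow> 'k" assume "D x \<noteq> 0"
    then have "vec n (conj_part nu) (curry x) \<in> ?V" by (intro CollectI exI[of _ "curry x"]) simp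
    moreover have "vec n (conj_part nu) (curry x) = (\<Sum>ms\<in>D_basis n nu. scl (mon x (P ms)) (dB ms))"
      unfolding vec_eq by (intro sum.cong refl) (simp add: lmon)
    ultimately show "(\<Sum>ms\<in>D_basis n nu. scl (mon x (P ms)) (dB ms)) \<in> fs.span ?V"
      by (simp only: fs.span_base)
  qed
  then show "weyl n nu \<subseteq> fs.span ?V"
    unfolding weyl_eq_span by (intro fs.span_minimal fs.subspace_span image_subsetI)
  show "fs.span ?V \<subseteq> weyl n nu"
    by (intro fs.span_minimal subspace_weyl) (blast intro: vec_mem_weyl)
qed

lemma act_mem_weyl:
  assumes inf: "infinite (UNIV :: 'k::field set)" and w: "w \<in> (weyl n nu :: (nat list list \<Rightarrow> 'k) set)"
  shows "act n g w \<in> weyl n nu"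
proof -
  interpret A: Vector_Spaces.linear scl scl "act n g :: (nat list list \<Rightarrow> 'k) \<Rightarrow> _" by (rule linear_act)
  have w: "w \<in> fs.span {vec n (conj_part nu) h | h. (\<lambda>_. 1 :: 'k) (case_prod h) \<noteq> 0}"
    using w weyl_span_dense[OF inf polyfun_const, of 1] by simp
  then show ?thesis
  proof (induction rule: fs.span_induct_alt)
    case base
    show ?case unfolding A.zero by (rule fs.subspace_0[OF subspace_weyl])
  next
    case (step c x y)
    then obtain h where "x = vec n (conj_part nu) h" by blast
    then show ?case unfolding A.add A.scale
      using step.IH by (simp only: act_vec) (intro fs.subspace_add fs.subspace_scale subspace_weyl vec_mem_weyl)
  qed
qed

lemma act_act:
  assumes inf: "infinite (UNIV :: 'k::field set)" and w: "w \<in> (weyl n nu :: (nat list list \<Rightarrow> 'k) set)"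
  shows "act n g (act n h w) = act n (mmul n g h) w"
proof -
  interpret A: Vector_Spaces.linear scl scl "act n g :: (nat list list \<Rightarrow> 'k) \<Rightarrow> _" by (rule linear_act)
  interpret B: Vector_Spaces.linear scl scl "act n h :: (nat list list \<Rightarrow> 'k) \<Rightarrow> _" by (rule linear_act)
  interpret C: Vector_Spaces.linear scl scl "act n (mmul n g h) :: (nat list list \<Rightarrow> 'k) \<Rightarrow> _" by (rule linear_act)
  have mmul: "mmul n g (mmul n h k) = mmul n (mmul n g h) k" for k
    by (simp add: mmul_def fun_eq_iff sum_distrib_left sum_distrib_right mult.assoc) (auto intro: sum.swap)
  have w: "w \<in> fs.span {vec n (conj_part nu) h | h. (\<lambda>_. 1 :: 'k) (case_prod h) \<noteq> 0}"
    using w weyl_span_dense[OF inf polyfun_const, of 1] by simp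
  then show ?thesis
  proof (induction rule: fs.span_induct_alt)
    case base
    show ?case by (simp only: A.zero B.zero C.zero)
  next
    case (step c x y)
    then obtain k where "x = vec n (conj_part nu) k" by blast
    then show ?case
      by (simp only: step.IH A.add B.add C.add A.scale B.scale C.scale act_vec mmul)
  qed
qed

end

subsection \<open>Semi-invariants of the upper triangular group\<close>

text \<open>The uniqueness clause is the point: it singles out the diagonal term of a minor as the
  only one of maximal \<open>Psi\<close>.\<close>

lemma rearrangement:
  assumes "sorted_wrt (<) S" "length S = c" "p permutes {..<c}"
  shows "(\<Sum>i<c. S ! i * p i) \<le> (\<Sum>i<c. S ! i * i)
    \<and> ((\<Sum>i<c. S ! i * p i) = (\<Sum>i<c. S ! i * i) \<longrightarrow> p = id)"
  using assms
proof (induction c arbitrary: p S)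
  case 0
  then show ?case by simp
next
  case (Suc c)
  let ?S = "butlast S"
  have S: "sorted_wrt (<) ?S" "length ?S = c" "\<And>i. i < c \<Longrightarrow> ?S ! i = S ! i"
    using Suc.prems by (auto simp: nth_butlast butlast_conv_take sorted_wrt_take)
  have step: "(\<Sum>i<Suc c. S ! i * q i) \<le> (\<Sum>i<Suc c. S ! i * i)
    \<and> ((\<Sum>i<Suc c. S ! i * q i) = (\<Sum>i<Suc c. S ! i * i) \<longrightarrow> q = id)"
    if q: "q permutes {..<Suc c}" "q c = c" for q
  proof -
    have "q permutes {..<c}"
      using q by (intro permutes_superset[OF q(1)]) (auto simp: less_Suc_eq)
    note IH = Suc.IH[OF S(1,2) this]
    have "(\<Sum>i<Suc c. S ! i * r i) = (\<Sum>i<c. ?S ! i * r i) + S ! c * r c" for r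
      using S(3) by simp
    from this[of q] this[of "\<lambda>i. i"]
    have e: "(\<Sum>i<Suc c. S ! i * q i) = (\<Sum>i<c. ?S ! i * q i) + S ! c * c"
      "(\<Sum>i<Suc c. S ! i * i) = (\<Sum>i<c. ?S ! i * i) + S ! c * c" using q(2) by simp_all
    show ?thesis unfolding e add_right_cancel add_le_cancel_right by (rule IH)
  qed
  show ?case
  proof (cases "p c = c")
    case True
    then show ?thesis using step Suc.prems by blast
  next
    case False
    note p = Suc.prems(3)
    define k where "k = inv p c"
    have pk: "p k = c" using permutes_inverses[OF p] by (simp add: k_def)
    have "k < Suc c" using permutes_lt[OF permutes_inv[OF p], of c] by (simp add: k_def)
    moreover have "k \<noteq> c" using pk False by auto
    ultimately have k: "k < c" by simp
    have pc: "p c < c" using permutes_lt[OF p, of c] False by simp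
    \<comment> \<open>Exchanging the values at \<open>k\<close> and c gives the largest entry the
      largest factor. The sum grows by the product of the two gaps \<open>u\<close> and
      \<open>v\<close> below, and the new permutation fixes c, so the induction hypothesis
      applies.\<close>
    define q where "q = p \<circ> Transposition.transpose k c"
    have q: "q permutes {..<Suc c}"
      unfolding q_def using k by (intro permutes_compose[OF _ p] permutes_swap_id) auto
    have qv: "q c = c" "q k = p c" "\<And>i. i \<noteq> c \<Longrightarrow> i \<noteq> k \<Longrightarrow> q i = p i"
      using pk by (auto simp: q_def)
    have split: "(\<Sum>i<Suc c. f i) = f k + f c + (\<Sum>i\<in>{..<c} - {k}. f i)" for f :: "nat \<Rightarrow> nat"
      using k by (simp add: sum.remove[of "{..<c}" k])
    have rest: "(\<Sum>i\<in>{..<c} - {k}. S ! i * q i) = (\<Sum>i\<in>{..<c} - {k}. S ! i * p i)"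
      using qv by (intro sum.cong) auto
    have "S ! k < S ! c" using Suc.prems k sorted_wrt_nth_less[of "(<)" S k c] by simp
    then obtain u where u: "S ! c = S ! k + u" "u > 0" using less_imp_add_positive by metis
    obtain v where v: "c = p c + v" "v > 0" using pc less_imp_add_positive by metis
    have "S ! k * p k + S ! c * p c < S ! k * q k + S ! c * q c"
      unfolding pk qv u(1) using u(2) v(2)
      by (subst v(1), subst (2) v(1)) (simp add: algebra_simps)
    then have "(\<Sum>i<Suc c. S ! i * p i) < (\<Sum>i<Suc c. S ! i * q i)"
      unfolding split rest by simp
    also have "\<dots> \<le> (\<Sum>i<Suc c. S ! i * i)" using step[OF q qv(1)] by (rule conjunct1)
    finally have less: "(\<Sum>i<Suc c. S ! i * p i) < (\<Sum>i<Suc c. S ! i * i)" .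
    show ?thesis by (intro conjI impI) (use less in \<open>linarith+\<close>)
  qed
qed

section \<open>Expanding a monomial when sums are substituted for variables\<close>

definition some_list :: "'a multiset \<Rightarrow> 'a list" where
  "some_list M = (SOME xs. mset xs = M)"

lemma mset_some_list [simp]: "mset (some_list M) = M"
  unfolding some_list_def using ex_mset by (rule someI_ex)

lemma length_some_list [simp]: "length (some_list M) = size M"
  by (metis mset_some_list size_mset)

lemma set_some_list [simp]: "set (some_list M) = set_mset M"
  by (metis mset_some_list set_mset_mset)

text \<open>The terms in the expansion of \<open>M\<close> when each v becomes the sum of the
  variables in \<open>R v\<close>. A list, unlike a function on variables, lets repeated factors
  choose differently.\<close>

definition choices :: "('v \<Rightarrow> 'w set) \<Rightarrow> 'v multiset \<Rightarrow> 'w list set" where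
  "choices R M = {h. length h = size M \<and> (\<forall>i<size M. h ! i \<in> R (some_list M ! i))}"

lemma finite_choices: "(\<And>v. finite (R v)) \<Longrightarrow> finite (choices R M)"
  unfolding choices_def by (rule finite_lists_lt)

lemma prod_list_nth: "(\<Prod>x\<in>#mset xs. f x) = (\<Prod>i<length xs. f (xs ! i))"
  by (induction xs) (simp_all add: prod.lessThan_Suc_shift del: prod.lessThan_Suc)

lemma sum_list_nth': "(\<Sum>x\<in>#mset xs. f x) = (\<Sum>i<length xs. f (xs ! i))"
  by (induction xs) (simp_all add: sum.lessThan_Suc_shift del: sum.lessThan_Suc)

lemma mon_choices:
  fixes x :: "'w \<Rightarrow> 'k::field"
  assumes "\<And>v. finite (R v)"
  shows "mon (\<lambda>v. \<Sum>w\<in>R v. x w) M = (\<Sum>h\<in>choices R M. mon x (mset h))"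
proof -
  have "mon (\<lambda>v. \<Sum>w\<in>R v. x w) M = mon (\<lambda>v. \<Sum>w\<in>R v. x w) (mset (some_list M))" by simp
  also have "\<dots> = (\<Prod>i<size M. \<Sum>w\<in>R (some_list M ! i). x w)"
    by (simp add: mon_def prod_list_nth del: mset_some_list)
  also have "\<dots> = (\<Sum>h\<in>choices R M. \<Prod>i<size M. x (h ! i))"
    unfolding choices_def by (rule prod_sum_lists) (rule assms)
  also have "\<dots> = (\<Sum>h\<in>choices R M. mon x (mset h))"
    by (intro sum.cong refl) (simp add: mon_def prod_list_nth choices_def)
  finally show ?thesis .
qed

lemma mon_independent_two_families:
  fixes c :: "'i \<Rightarrow> 'k::field"
  assumes inf: "infinite (UNIV :: 'k set)" and I: "finite I" and J: "finite J"
    and eq: "\<And>x. (\<Sum>i\<in>I. c i * mon x (M i)) = (\<Sum>j\<in>J. d j * mon x (N j))"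
  shows "(\<Sum>i\<in>{i \<in> I. M i = L}. c i) = (\<Sum>j\<in>{j \<in> J. N j = L}. d j)"
proof -
  have "(\<Sum>i\<in>{i \<in> I <+> J. case_sum M N i = L}. case_sum c (\<lambda>j. - d j) i) = 0"
    by (rule mon_independent_family[OF inf]) (use I J eq in \<open>auto simp: sum.Plus sum_negf\<close>)
  moreover have "{i \<in> I <+> J. case_sum M N i = L} = {i \<in> I. M i = L} <+> {j \<in> J. N j = L}"
    by (auto simp: Plus_def)
  ultimately show ?thesis using I J by (simp add: sum.Plus sum_negf)
qed

text \<open>A grading rather than a monomial order: it ranks the terms of a minor with the diagonal
  one strictly on top, but different monomials may tie.\<close>

definition Psi :: "(nat \<times> nat) multiset \<Rightarrow> nat" where
  "Psi M = (\<Sum>v\<in>#M. fst v * snd v)"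

text \<open>A Garnir argument.  Split column \<open>b\<close> of the matrix as \<open>u + u'\<close>, where \<open>u\<close> has entries in the rows below
  \<open>m\<close> only and is stored in the spare column \<open>n\<close>; adding \<open>u'\<close> to column \<open>b + 1\<close> then has the same effect
  on \<open>F\<close> as subtracting \<open>u\<close>.  A violation of semistandardness makes a monomial of the first
  expression, whose coefficient is \<open>c T\<close> by maximality of \<open>Psi T\<close>, too poor in \<open>u\<close> to occur in the second.\<close>
lemma Psi_max_semistandard:
  fixes F :: "(nat \<times> nat \<Rightarrow> 'k::field) \<Rightarrow> 'k"
  assumes inf: "infinite (UNIV :: 'k set)"
    and A: "finite A" "\<And>x. F x = (\<Sum>M\<in>A. c M * mon x M)" "\<And>M. M \<in> A \<Longrightarrow> c M \<noteq> 0"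
    and V: "\<And>M. M \<in> A \<Longrightarrow> set_mset M \<subseteq> {..<n} \<times> {..<n}"
    and L: "\<And>M. M \<in> A \<Longrightarrow> image_mset snd M = L"
    and inv: "\<And>x. F (\<lambda>(a, j). if j = Suc b then x (a, Suc b) - x (a, b) else x (a, j)) = F x"
    and T: "T \<in> A" and max: "\<And>M. M \<in> A \<Longrightarrow> Psi M \<le> Psi T" and b: "Suc b < n"
  shows "size (filter_mset (\<lambda>v. snd v = Suc b \<and> fst v \<le> m) T) \<le> size (filter_mset (\<lambda>v. snd v = b \<and> fst v < m) T)"
proof (rule ccontr)
  assume viol: "\<not> ?thesis"
  \<comment> \<open>Column b becomes u + u' and column b + 1 becomes v + u', where v lives in the
    rows > m. Subtracting the first from the second leaves v - u, which is what \<open>R2\<close>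
    and the signs \<open>e\<close> encode; the empty set in row m is the cancellation of u' with
    itself.\<close>
  define R1 where "R1 = (\<lambda>(a::nat, j).
     if j = b then (if a < m then {(a, n), (a, b)} else {(a, b)})
     else if j = Suc b then (if a > m then {(a, Suc b), (a, b)} else {(a, b)}) else {(a, j)})"
  define R2 where "R2 = (\<lambda>(a::nat, j).
     if j = b then (if a < m then {(a, n), (a, b)} else {(a, b)})
     else if j = Suc b then (if a < m then {(a, n)} else if a = m then {} else {(a, Suc b)}) else {(a, j)})"
  define e where "e = (\<lambda>(a, j). if j = Suc b \<and> a < m then - 1 else 1 :: 'k)"
  define g where "g x v = (\<Sum>w\<in>R1 v. x w)" for x :: "nat \<times> nat \<Rightarrow> 'k" and v
  have fin: "finite (R1 v)" "finite (R2 v)" for v by (auto simp: R1_def R2_def split: prod.splits)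
  have g2: "(case v of (a, j) \<Rightarrow> if j = Suc b then g x (a, Suc b) - g x (a, b) else g x (a, j))
      = e v * (\<Sum>w\<in>R2 v. x w)" for v x
    using b by (auto simp: g_def e_def R1_def R2_def split: prod.splits)
  have eq: "(\<Sum>(M, h)\<in>(SIGMA M:A. choices R1 M). c M * mon x (mset h))
      = (\<Sum>(M, h)\<in>(SIGMA M:A. choices R2 M). (c M * mon e M) * mon x (mset h))" for x
  proof -
    have "(\<Sum>(M, h)\<in>(SIGMA M:A. choices R1 M). c M * mon x (mset h)) = F (g x)"
      using A(1) fin unfolding A(2) g_def
      by (simp add: mon_choices sum_distrib_left sum.Sigma finite_choices)
    also have "\<dots> = F (\<lambda>v. e v * (\<Sum>w\<in>R2 v. x w))"
      using inv[of "g x"] by (simp add: g2[symmetric] case_prod_beta')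
    also have "\<dots> = (\<Sum>M\<in>A. c M * mon e M * (\<Sum>h\<in>choices R2 M. mon x (mset h)))"
      unfolding A(2) mon_mult using fin by (simp add: mon_choices mult.assoc)
    also have "\<dots> = (\<Sum>(M, h)\<in>(SIGMA M:A. choices R2 M). (c M * mon e M) * mon x (mset h))"
      using A(1) fin by (simp add: sum_distrib_left sum.Sigma finite_choices)
    finally show ?thesis .
  qed
  \<comment> \<open>The choice that produces the critical monomial \<open>N0\<close>: in column b
    the rows < m go to u, in column b + 1 the rows \<le> m go to u'.\<close>
  define f0 where "f0 = (\<lambda>(a::nat, j).
     if j = b then (if a < m then (a, n) else (a, b))
     else if j = Suc b then (if a > m then (a, Suc b) else (a, b)) else (a, j))"
  \<comment> \<open>Potentials on the old and the new variables, tuned so that no choice raises the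
    potential and \<open>f0\<close> alone preserves it. Up to constants fixed by \<open>L\<close>
    the total of \<open>\<theta>\<close> is \<open>Psi\<close>, so maximality of
    \<open>Psi T\<close> leaves \<open>f0\<close> as the only way to reach
    \<open>N0\<close>.\<close>
  define \<theta> where "\<theta> = (\<lambda>(a, j). if j = Suc b then a * j else a * j + m)"
  define \<omega> where "\<omega> = (\<lambda>(a, j). if j = n then a * b + m else if j = b then a * b + min a m
     else if j = Suc b then a * j else a * j + m)"
  define N0 where "N0 = image_mset f0 T"
  have \<omega>: "\<omega> w \<le> \<theta> v \<and> (\<omega> w = \<theta> v \<longleftrightarrow> w = f0 v)" if wv: "w \<in> R1 v" "v \<in> {..<n} \<times> {..<n}" for v w
  proof -
    obtain a j where v: "v = (a, j)" "j < n" using wv(2) by auto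
    consider "j = b" "a < m" | "j = b" "a \<ge> m" | "j = Suc b" "a \<le> m" | "j = Suc b" "a > m" | "j \<noteq> b" "j \<noteq> Suc b"
      by linarith
    then show ?thesis
    proof cases
      case 1
      with wv(1) v b have "w = (a, n) \<or> w = (a, b)" by (simp add: R1_def)
      with 1 v b show ?thesis by (auto simp: \<omega>_def \<theta>_def f0_def)
    next
      case 2
      with wv(1) v b have "w = (a, b)" by (simp add: R1_def)
      with 2 v b show ?thesis by (simp add: \<omega>_def \<theta>_def f0_def)
    next
      case 3
      with wv(1) v b have "w = (a, b)" by (simp add: R1_def)
      with 3 v b show ?thesis by (simp add: \<omega>_def \<theta>_def f0_def)
    next
      case 4
      with wv(1) v b have "w = (a, Suc b) \<or> w = (a, b)" by (simp add: R1_def)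
      with 4 v b show ?thesis by (auto simp: \<omega>_def \<theta>_def f0_def)
    next
      case 5
      with wv(1) v b have "w = (a, j)" by (simp add: R1_def)
      with 5 v b show ?thesis by (simp add: \<omega>_def \<theta>_def f0_def)
    qed
  qed
  have f0: "f0 v \<in> R1 v" for v by (auto simp: R1_def f0_def split: prod.splits)
  have sum\<theta>: "(\<Sum>v\<in>#M. \<theta> v) + m * count (image_mset snd M) (Suc b) = Psi M + m * size M" for M
    by (induction M) (auto simp: \<theta>_def Psi_def split: prod.splits)
  have sizeL: "size M = size L" if "M \<in> A" for M
    using L[OF that] by (metis size_image_mset)
  have key: "M = T \<and> h = map f0 (some_list M)"
    if M: "M \<in> A" and h: "h \<in> choices R1 M" and hN: "mset h = N0" for M h
  proof -
    have hi: "length h = size M" "\<And>i. i < size M \<Longrightarrow> h ! i \<in> R1 (some_list M ! i)"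
      using h by (auto simp: choices_def)
    have xi: "some_list M ! i \<in> {..<n} \<times> {..<n}" if "i < size M" for i
    proof -
      have "some_list M ! i \<in> set (some_list M)" using that by (intro nth_mem) simp
      then show ?thesis using V[OF M] by (simp only: set_some_list) blast
    qed
    have "(\<Sum>w\<in>#mset h. \<omega> w) = (\<Sum>v\<in>#T. \<omega> (f0 v))" by (simp add: hN N0_def multiset.map_comp comp_def)
    also have "\<dots> = (\<Sum>v\<in>#T. \<theta> v)"
      using \<omega>[OF f0] V[OF T] by (intro arg_cong[where f = sum_mset] image_mset_cong) auto
    also have "\<dots> \<ge> (\<Sum>v\<in>#M. \<theta> v)"
      using sum\<theta>[of T] sum\<theta>[of M] max[OF M] L[OF M] L[OF T] sizeL[OF M] sizeL[OF T] by simp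
    finally have "(\<Sum>i<size M. \<theta> (some_list M ! i)) \<le> (\<Sum>i<size M. \<omega> (h ! i))"
      using sum_list_nth'[of \<theta> "some_list M"] sum_list_nth'[of \<omega> h] hi(1) by simp
    moreover have "\<omega> (h ! i) \<le> \<theta> (some_list M ! i)" if "i \<in> {..<size M}" for i
      using \<omega>[OF hi(2) xi] that by simp
    ultimately have "\<omega> (h ! i) = \<theta> (some_list M ! i)" if "i < size M" for i
      using sum_strict_mono_ex1[of "{..<size M}" "\<lambda>i. \<omega> (h ! i)" "\<lambda>i. \<theta> (some_list M ! i)"] that
      by (metis finite_lessThan lessThan_iff linorder_not_less order_le_imp_less_or_eq)
    then have h0: "h = map f0 (some_list M)"
      using \<omega>[OF hi(2) xi] hi(1) by (intro nth_equalityI) auto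
    \<comment> \<open>Within the matrix \<open>f0\<close> merges only (m, b) with (m, b + 1), and
      \<open>r\<close> inverts it up to that merging. The number of entries in column b + 1,
      prescribed by \<open>L\<close>, then tells the two apart.\<close>
    define \<rho> where "\<rho> v = (if v = (m, Suc b) then (m, b) else v)" for v :: "nat \<times> nat"
    define r where "r = (\<lambda>(a::nat, j). if j = n then (a, b) else if j = b \<and> a < m then (a, Suc b) else (a, j))"
    have r: "r (f0 v) = \<rho> v" if "v \<in> {..<n} \<times> {..<n}" for v
      using that b by (auto simp: r_def f0_def \<rho>_def split: prod.splits)
    have "image_mset f0 M = image_mset f0 T"
      using hN h0 by (simp add: N0_def mset_map)
    then have "image_mset r (image_mset f0 M) = image_mset r (image_mset f0 T)" by simp
    then have "image_mset (\<lambda>v. r (f0 v)) M = image_mset (\<lambda>v. r (f0 v)) T"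
      by (simp add: multiset.map_comp comp_def)
    moreover have "image_mset (\<lambda>v. r (f0 v)) M = image_mset \<rho> M" "image_mset (\<lambda>v. r (f0 v)) T = image_mset \<rho> T"
      using V[OF M] V[OF T] by (auto intro!: image_mset_cong r)
    ultimately have \<rho>eq: "image_mset \<rho> M = image_mset \<rho> T" by simp
    have c\<rho>: "count (image_mset \<rho> M) v = (if v = (m, b) then count M v + count M (m, Suc b)
        else if v = (m, Suc b) then 0 else count M v)" for M v
      by (induction M) (auto simp: \<rho>_def)
    have cs: "count (image_mset snd M) (Suc b) = count M (m, Suc b) + count (image_mset snd (image_mset \<rho> M)) (Suc b)" for M
      by (induction M) (auto simp: \<rho>_def)
    have 1: "count M (m, Suc b) = count T (m, Suc b)"
      using cs[of M] cs[of T] \<rho>eq L[OF M] L[OF T] by simp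
    have "count M v = count T v" for v
      using c\<rho>[of M v] c\<rho>[of T v] 1 unfolding \<rho>eq
      by (cases "v = (m, b)"; cases "v = (m, Suc b)") simp_all
    then have "M = T" by (rule multiset_eqI)
    with h0 show ?thesis by simp
  qed
  have s1: "{x \<in> (SIGMA M:A. choices R1 M). mset (snd x) = N0} = {(T, map f0 (some_list T))}"
  proof -
    have "map f0 (some_list T) \<in> choices R1 T" using f0 by (simp add: choices_def)
    moreover have "mset (map f0 (some_list T)) = N0" by (simp add: N0_def mset_map)
    ultimately have "(T, map f0 (some_list T)) \<in> {x \<in> (SIGMA M:A. choices R1 M). mset (snd x) = N0}"
      using T by (simp del: mset_map)
    moreover have "x = (T, map f0 (some_list T))"
      if "x \<in> {x \<in> (SIGMA M:A. choices R1 M). mset (snd x) = N0}" for x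
    proof (cases x)
      case (Pair M h)
      then have "M \<in> A" "h \<in> choices R1 M" "mset h = N0" using that by simp_all
      from key[OF this] show ?thesis using Pair by simp
    qed
    ultimately show ?thesis by blast
  qed
  have s2: "{x \<in> (SIGMA M:A. choices R2 M). mset (snd x) = N0} = {}"
  proof -
    \<comment> \<open>Counts the entries stored in u or v. In the second expansion each factor from
      column b + 1 supplies one, whatever is chosen; the violation says that \<open>N0\<close> has
      fewer than that.\<close>
    define \<pi> where "\<pi> w = (if snd w = n \<or> snd w = Suc b then 1 else 0 :: nat)" for w :: "nat \<times> nat"
    have "mset h \<noteq> N0" if M: "M \<in> A" and h: "h \<in> choices R2 M" for M h
    proof
      assume hN: "mset h = N0"
      have hi: "length h = size M" "\<And>i. i < size M \<Longrightarrow> h ! i \<in> R2 (some_list M ! i)"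
        using h by (auto simp: choices_def)
      have "(if snd v = Suc b then 1 else 0) \<le> \<pi> w" if "w \<in> R2 v" for v w
        using that by (auto simp: R2_def \<pi>_def split: prod.splits if_splits)
      then have "(\<Sum>i<size M. if snd (some_list M ! i) = Suc b then 1 else 0) \<le> (\<Sum>i<size M. \<pi> (h ! i))"
        using hi(2) by (intro sum_mono) auto
      then have "(\<Sum>v\<in>#M. if snd v = Suc b then 1 else 0) \<le> (\<Sum>w\<in>#N0. \<pi> w)"
        using sum_list_nth'[of "\<lambda>v. if snd v = Suc b then 1 else 0 :: nat" "some_list M"] sum_list_nth'[of \<pi> h] hi(1) hN
        by simp
      also have "(\<Sum>w\<in>#N0. \<pi> w) = (\<Sum>v\<in>#T. \<pi> (f0 v))" by (simp add: N0_def multiset.map_comp comp_def)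
      also have "\<dots> = (\<Sum>v\<in>#T. if snd v = b \<and> fst v < m \<or> snd v = Suc b \<and> fst v > m then 1 else 0)"
      proof (intro arg_cong[where f = sum_mset] image_mset_cong)
        fix v assume "v \<in># T"
        then have "snd v < n" using V[OF T] by auto
        then show "\<pi> (f0 v) = (if snd v = b \<and> fst v < m \<or> snd v = Suc b \<and> fst v > m then 1 else 0)"
          using b by (cases v) (simp add: \<pi>_def f0_def)
      qed
      also have "\<dots> + size (filter_mset (\<lambda>v. snd v = Suc b \<and> fst v \<le> m) T)
          = size (filter_mset (\<lambda>v. snd v = b \<and> fst v < m) T) + count (image_mset snd T) (Suc b)"
        by (induction T) auto
      moreover have "(\<Sum>v\<in>#M. if snd v = Suc b then 1 else 0) = count (image_mset snd M) (Suc b)"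
        by (induction M) auto
      ultimately show False using viol L[OF M] L[OF T] by simp
    qed
    then show ?thesis by auto
  qed
  have "(\<Sum>x\<in>{x \<in> (SIGMA M:A. choices R1 M). mset (snd x) = N0}. c (fst x))
      = (\<Sum>x\<in>{x \<in> (SIGMA M:A. choices R2 M). mset (snd x) = N0}. c (fst x) * mon e (fst x))"
    by (rule mon_independent_two_families[OF inf])
      (use A(1) fin eq in \<open>auto simp: finite_choices case_prod_beta'\<close>)
  then have "c T = 0" unfolding s1 s2 by simp
  then show False using A(3)[OF T] by simp
qed


lemma power_exponent_unique:
  assumes inf: "infinite (UNIV :: 'k::field set)" and pow: "\<And>s :: 'k. s \<noteq> 0 \<Longrightarrow> s ^ d = s ^ e"
  shows "d = e"
proof -
  \<comment> \<open>The extra factor s makes the equation hold at s = 0 too.\<close>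
  have "monom (1 :: 'k) (Suc d) - monom 1 (Suc e) = 0"
  proof (rule poly_zero_of_infinite[OF inf])
    fix s :: 'k
    show "poly (monom 1 (Suc d) - monom 1 (Suc e)) s = 0"
      using pow[of s] by (cases "s = 0") (simp_all add: poly_monom)
  qed
  then show ?thesis by (metis diff_eq_eq add_0 degree_monom_eq nat.inject zero_neq_one)
qed

definition chi :: "nat \<Rightarrow> nat list \<Rightarrow> (nat \<Rightarrow> nat \<Rightarrow> 'k::field) \<Rightarrow> 'k" where
  "chi n nu b = (\<Prod>i<n. b i i ^ (nu ! i))"

context part_ctxt
begin

abbreviation cs :: "nat list" where "cs \<equiv> conj_part nu"

text \<open>In each column Cauchy-Binet leaves only the term of the initial segment; the resulting
  diagonal factors, collected over the cells row by row, give \<open>chi\<close>.\<close>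

lemma vec_right:
  assumes "upper b"
  shows "vec n cs (mmul n g b) = scl (chi n nu b) (vec n cs g)"
proof
  fix Ss
  show "vec n cs (mmul n g b) Ss = scl (chi n nu b) (vec n cs g) Ss"
  proof (cases "Ss \<in> ext_index n cs")
    case True
    have "vec n cs (mmul n g b) Ss = (\<Prod>j<length cs. minor g (Ss ! j) [0..<cs ! j] * (\<Prod>i<cs ! j. b i i))"
      unfolding vec_def using True
    proof (simp only: if_True, intro prod.cong refl)
      fix j assume "j \<in> {..<length cs}"
      then have j: "j < length cs" by simp
      have lenS: "length (Ss ! j) = cs ! j" using ext_index_nth[OF True j] by (rule incr_lists_length)
      have "cs ! j \<le> n" using conj_le j by simp
      then have flag: "[0..<cs ! j] \<in> incr_lists n (cs ! j)" by (auto simp: incr_lists_def)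
      have "minor (mmul n g b) (Ss ! j) [0..<cs ! j]
          = (\<Sum>S\<in>incr_lists n (cs ! j). minor g (Ss ! j) S * (if S = [0..<cs ! j] then \<Prod>i<cs ! j. b i i else 0))"
        using lenS by (simp add: Cauchy_Binet minor_upper_flag[OF assms] cong: sum.cong)
      also have "\<dots> = minor g (Ss ! j) [0..<cs ! j] * (\<Prod>i<cs ! j. b i i)"
        using flag by (simp add: if_distrib[of "\<lambda>x. _ * x"] cong: if_cong)
      finally show "minor (mmul n g b) (Ss ! j) [0..<cs ! j]
          = minor g (Ss ! j) [0..<cs ! j] * (\<Prod>i<cs ! j. b i i)" .
    qed
    also have "\<dots> = (\<Prod>j<length cs. minor g (Ss ! j) [0..<cs ! j]) * chi n nu b"
      by (simp add: prod.distrib length_conj prod_cells chi_def)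
    finally show ?thesis using True by (simp add: vec_def mult.commute)
  next
    case False
    then show ?thesis by (simp add: vec_def)
  qed
qed

subsection \<open>Bideterminants of semistandard tableaux\<close>

text \<open>The variable (a, i) is read as the entry a in row i of a tableau with sorted rows, so
  matrix columns are tableau rows. The counts for adjacent rows express strict increase down the
  columns.\<close>

definition semistandard :: "(nat \<times> nat) multiset \<Rightarrow> bool" where
  "semistandard M \<longleftrightarrow> (\<forall>b m. Suc b < n \<longrightarrow>
     size (filter_mset (\<lambda>v. snd v = Suc b \<and> fst v \<le> m) M) \<le> size (filter_mset (\<lambda>v. snd v = b \<and> fst v < m) M))"

definition row :: "(nat \<times> nat) multiset \<Rightarrow> nat \<Rightarrow> nat list" where
  "row M i = sorted_list_of_multiset (image_mset fst (filter_mset (\<lambda>v. snd v = i) M))"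

definition tab :: "(nat \<times> nat) multiset \<Rightarrow> nat list list" where
  "tab M = map (\<lambda>j. map (\<lambda>i. row M i ! j) [0..<cs ! j]) [0..<part nu 0]"

definition Mon :: "nat list list \<Rightarrow> (nat \<Rightarrow> nat) list \<Rightarrow> (nat \<times> nat) multiset" where
  "Mon Ss ps = (\<Sum>j<part nu 0. \<Sum>i<cs ! j. {#(Ss ! j ! i, (ps ! j) i)#})"

text \<open>The count condition says at once that the tableau has shape \<open>nu\<close> and that
  the monomial has weight \<open>nu\<close> under scaling of the matrix columns.\<close>

definition tab_weight :: "(nat \<times> nat) multiset \<Rightarrow> bool" where
  "tab_weight M \<longleftrightarrow> set_mset M \<subseteq> {..<n} \<times> {..<n} \<and> (\<forall>i<n. count (image_mset snd M) i = nu ! i)"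

lemma tab_weight_count:
  assumes "tab_weight M"
  shows "count (image_mset snd M) i = (if i < n then nu ! i else 0)"
proof (cases "i < n")
  case False
  then have "i \<notin># image_mset snd M" using assms by (auto simp: tab_weight_def)
  then have "count (image_mset snd M) i = 0" by (simp only: not_in_iff)
  then show ?thesis using False by simp
qed (use assms in \<open>simp add: tab_weight_def\<close>)

lemma length_row: "tab_weight M \<Longrightarrow> i < n \<Longrightarrow> length (row M i) = nu ! i"
proof -
  assume "tab_weight M" "i < n"
  then have "count (image_mset snd M) i = nu ! i" by (simp add: tab_weight_def)
  moreover have "length (row M i) = size (mset (row M i))" by simp
  moreover have "mset (row M i) = image_mset fst (filter_mset (\<lambda>v. snd v = i) M)"
    unfolding row_def by simp
  moreover have "count (image_mset snd M) i = size (filter_mset (\<lambda>v. snd v = i) M)"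
    by (induction M) auto
  ultimately show ?thesis by simp
qed

lemma Mon_tab:
  assumes "tab_weight M"
  shows "(\<Sum>j<part nu 0. \<Sum>i<cs ! j. {#(tab M ! j ! i, i)#}) = M"
proof -
  have "(\<Sum>j<part nu 0. \<Sum>i<cs ! j. {#(tab M ! j ! i, i)#}) = (\<Sum>j<part nu 0. \<Sum>i<cs ! j. {#(row M i ! j, i)#})"
    by (intro sum.cong refl) (simp add: tab_def)
  also have "\<dots> = (\<Sum>i<n. \<Sum>j<nu ! i. {#(row M i ! j, i)#})" by (rule sum_cells)
  also have "\<dots> = (\<Sum>i<n. filter_mset (\<lambda>v. snd v = i) M)"
  proof (intro sum.cong refl)
    fix i assume "i \<in> {..<n}"
    then have i: "i < n" by simp
    have "(\<Sum>j<length xs. {#(xs ! j, i)#}) = image_mset (\<lambda>a. (a, i)) (mset xs)" for xs :: "nat list"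
      by (induction xs) (simp_all add: sum.lessThan_Suc_shift del: sum.lessThan_Suc)
    from this[of "row M i"] have "(\<Sum>j<nu ! i. {#(row M i ! j, i)#}) = image_mset (\<lambda>a. (a, i)) (mset (row M i))"
      by (simp add: length_row[OF assms i])
    also have "\<dots> = image_mset (\<lambda>v. (fst v, i)) (filter_mset (\<lambda>v. snd v = i) M)"
      unfolding row_def by (simp add: multiset.map_comp comp_def)
    also have "\<dots> = image_mset id (filter_mset (\<lambda>v. snd v = i) M)"
      by (rule image_mset_cong) auto
    finally show "(\<Sum>j<nu ! i. {#(row M i ! j, i)#}) = filter_mset (\<lambda>v. snd v = i) M" by simp
  qed
  also have "\<dots> = M"
  proof -
    have "set_mset M \<subseteq> {..<n} \<times> {..<n}" using assms by (simp add: tab_weight_def)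
    then show ?thesis
    proof (induction M)
      case (add v M)
      then have "snd v < n" by auto
      then have "(\<Sum>i<n. if snd v = i then {#v#} else {#}) = {#v#}" by simp
      moreover have "filter_mset (\<lambda>u. snd u = i) (add_mset v M) = (if snd v = i then {#v#} else {#}) + filter_mset (\<lambda>u. snd u = i) M" for i
        by simp
      ultimately show ?case using add by (simp only: sum.distrib) simp
    qed simp
  qed
  finally show ?thesis .
qed

lemma sorted_nth_less_of_count:
  assumes "sorted xs" and "j < length (filter (\<lambda>x. x < m) xs)"
  shows "xs ! j < (m::nat)"
  using assms
proof (induction xs arbitrary: j)
  case (Cons x xs)
  show ?case
  proof (cases "x < m")
    case True
    then show ?thesis using Cons by (cases j) auto
  next
    case False
    then have "filter (\<lambda>x. x < m) (x # xs) = []" using Cons.prems(1) by (force simp: filter_empty_conv)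
    then show ?thesis using Cons.prems(2) by simp
  qed
qed simp

lemma sorted_count_le:
  assumes "sorted xs" and "j < length xs"
  shows "j < length (filter (\<lambda>x. x \<le> xs ! j) xs)"
proof -
  have "set (take (Suc j) xs) \<subseteq> {x. x \<le> xs ! j}"
    using assms by (auto simp: in_set_conv_nth less_Suc_eq_le intro!: sorted_nth_mono)
  then have "filter (\<lambda>x. x \<le> xs ! j) (take (Suc j) xs) = take (Suc j) xs"
    by (auto simp: filter_id_conv)
  then have "length (filter (\<lambda>x. x \<le> xs ! j) (take (Suc j) xs)) = Suc j" using assms(2) by simp
  moreover have "length (filter (\<lambda>x. x \<le> xs ! j) xs) = length (filter (\<lambda>x. x \<le> xs ! j) (take (Suc j) xs))
      + length (filter (\<lambda>x. x \<le> xs ! j) (drop (Suc j) xs))"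
    by (metis append_take_drop_id filter_append length_append)
  ultimately show ?thesis by simp
qed

text \<open>If x is the entry at position j of row i + 1, more than j entries of that row are at
  most x; hence more than j entries of row i are less than x, and the one at position j is among
  them because the row is sorted.\<close>

lemma tab_ext:
  assumes M: "tab_weight M" "semistandard M"
  shows "tab M \<in> ext_index n cs"
proof -
  have filt: "length (filter P (row M i)) = size (filter_mset (\<lambda>v. snd v = i \<and> P (fst v)) M)" for P i
  proof -
    have "length (filter P (row M i)) = size (filter_mset P (mset (row M i)))" by (simp flip: mset_filter)
    also have "\<dots> = size (filter_mset (\<lambda>v. P (fst v)) (filter_mset (\<lambda>v. snd v = i) M))"
      unfolding row_def by (simp add: filter_mset_image_mset)
    finally show ?thesis by (simp add: filter_filter_mset conj_commute)
  qed
  have "map (\<lambda>i. row M i ! j) [0..<cs ! j] \<in> incr_lists n (cs ! j)" if j: "j < part nu 0" for j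
  proof -
    have c: "i < n" "j < nu ! i" if "i < cs ! j" for i using conj_nth[OF j] that by auto
    have "row M i ! j < row M (Suc i) ! j" if "Suc i < cs ! j" for i
    proof -
      have "j < length (row M (Suc i))" using c[OF that] length_row[OF M(1)] by simp
      then have "j < length (filter (\<lambda>x. x \<le> row M (Suc i) ! j) (row M (Suc i)))"
        by (rule sorted_count_le[rotated]) (simp add: row_def)
      also have "\<dots> \<le> length (filter (\<lambda>x. x < row M (Suc i) ! j) (row M i))"
        using M(2) c[OF that] by (simp add: filt semistandard_def)
      finally show ?thesis
        by (rule sorted_nth_less_of_count[rotated]) (simp add: row_def)
    qed
    then have "sorted_wrt (<) (map (\<lambda>i. row M i ! j) [0..<cs ! j])"
      by (subst sorted_wrt_iff_nth_Suc_transp) (auto simp: transp_def)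
    moreover have "row M i ! j < n" if "i < cs ! j" for i
    proof -
      have "row M i ! j \<in> set (row M i)" using c[OF that] length_row[OF M(1)] by (intro nth_mem) simp
      also have "\<dots> \<subseteq> {..<n}" using M(1) by (auto simp: row_def tab_weight_def)
      finally show ?thesis by simp
    qed
    ultimately show ?thesis by (auto simp: incr_lists_def)
  qed
  then show ?thesis by (simp add: ext_index_eq tab_def length_conj)
qed

definition perm_lists :: "(nat \<Rightarrow> nat) list set" where
  "perm_lists = {ps. length ps = part nu 0 \<and> (\<forall>j<part nu 0. ps ! j \<in> {p. p permutes {..<cs ! j}})}"

lemma finite_perm_lists: "finite perm_lists"
  unfolding perm_lists_def by (rule finite_lists_lt) simp

lemma vec_expand:
  fixes x :: "nat \<times> nat \<Rightarrow> 'k::field"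
  assumes Ss: "Ss \<in> ext_index n cs"
  shows "vec n cs (curry x) Ss
     = (\<Sum>ps\<in>perm_lists. of_int (\<Prod>j<part nu 0. sign (ps ! j)) * mon x (Mon Ss ps))"
proof -
  have "vec n cs (curry x) Ss = (\<Prod>j<part nu 0. \<Sum>p | p permutes {..<cs ! j}.
      of_int (sign p) * (\<Prod>i<cs ! j. x (Ss ! j ! i, p i)))"
    unfolding vec_def minor_def using Ss
    by (simp only: if_True length_conj length_upt diff_zero)
      (intro prod.cong sum.cong refl arg_cong2[of _ _ _ _ "(*)"], simp add: permutes_lt)
  also have "\<dots> = (\<Sum>ps\<in>perm_lists. \<Prod>j<part nu 0. of_int (sign (ps ! j)) * (\<Prod>i<cs ! j. x (Ss ! j ! i, (ps ! j) i)))"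
    unfolding perm_lists_def by (rule prod_sum_lists) simp
  also have "\<dots> = (\<Sum>ps\<in>perm_lists. of_int (\<Prod>j<part nu 0. sign (ps ! j)) * mon x (Mon Ss ps))"
    by (intro sum.cong refl) (simp add: prod.distrib Mon_def mon_sum)
  finally show ?thesis .
qed

lemma Psi_sum: "finite I \<Longrightarrow> Psi (\<Sum>i\<in>I. M i) = (\<Sum>i\<in>I. Psi (M i))"
  by (induction rule: finite_induct) (simp_all add: Psi_def)

lemma Psi_Mon: "Psi (Mon Ss ps) = (\<Sum>j<part nu 0. \<Sum>i<cs ! j. Ss ! j ! i * (ps ! j) i)"
  by (simp add: Mon_def Psi_sum) (simp add: Psi_def)

lemma Mon_set:
  assumes "Ss \<in> ext_index n cs" "ps \<in> perm_lists"
  shows "set_mset (Mon Ss ps) \<subseteq> {..<n} \<times> {..<n}"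
proof -
  have "Ss ! j ! i < n" "(ps ! j) i < n" if "j < part nu 0" "i < cs ! j" for j i
  proof -
    have S: "Ss ! j \<in> incr_lists n (cs ! j)" using assms(1) that by (intro ext_index_nth) (simp_all add: length_conj)
    then show "Ss ! j ! i < n" using that by (simp add: incr_lists_def subset_iff)
    have "ps ! j permutes {..<cs ! j}" using assms(2) that(1) by (simp add: perm_lists_def)
    then have "(ps ! j) i < cs ! j" using that(2) by (rule permutes_lt)
    also have "\<dots> \<le> n" using that by (intro conj_le) (simp add: length_conj)
    finally show "(ps ! j) i < n" .
  qed
  note lt = this
  show ?thesis
  proof
    fix v assume "v \<in># Mon Ss ps"
    then obtain j i where "j < part nu 0" "i < cs ! j" "v = (Ss ! j ! i, (ps ! j) i)"
      by (auto simp: Mon_def set_mset_sum)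
    then show "v \<in> {..<n} \<times> {..<n}" using lt by simp
  qed
qed

text \<open>The terms of the product of minors correspond to one permutation per column. The
  identities give back \<open>M\<close>, and by \<open>rearrangement\<close> any other choice loses
  \<open>Psi\<close> in some column without gaining in another.\<close>

lemma bideterminant_leading:
  assumes M: "tab_weight M" "semistandard M"
  shows "polyspan {N. set_mset N \<subseteq> {..<n} \<times> {..<n} \<and> Psi N < Psi M}
     (\<lambda>x :: nat \<times> nat \<Rightarrow> 'k::field. mon x M - vec n cs (curry x) (tab M))"
proof (rule polyspan_family)
  let ?ids = "replicate (part nu 0) id :: (nat \<Rightarrow> nat) list"
  have T: "tab M \<in> ext_index n cs" using M by (rule tab_ext)
  have ids: "?ids \<in> perm_lists" by (simp add: perm_lists_def permutes_id)
  have Mids: "Mon (tab M) ?ids = M"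
    by (subst (2) Mon_tab[OF M(1), symmetric]) (simp add: Mon_def)
  show "finite (perm_lists - {?ids})" using finite_perm_lists by simp
  show "mon x M - vec n cs (curry x) (tab M)
      = (\<Sum>ps\<in>perm_lists - {?ids}. - of_int (\<Prod>j<part nu 0. sign (ps ! j)) * mon x (Mon (tab M) ps))"
    for x :: "nat \<times> nat \<Rightarrow> 'k"
    unfolding vec_expand[OF T] sum.remove[OF finite_perm_lists ids] Mids
    by (simp add: sum_negf)
  fix ps assume ps: "ps \<in> perm_lists - {?ids}"
  have re: "(\<Sum>i<cs ! j. tab M ! j ! i * (ps ! j) i) \<le> (\<Sum>i<cs ! j. tab M ! j ! i * i)
     \<and> ((\<Sum>i<cs ! j. tab M ! j ! i * (ps ! j) i) = (\<Sum>i<cs ! j. tab M ! j ! i * i) \<longrightarrow> ps ! j = id)"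
    if j: "j < part nu 0" for j
  proof (rule rearrangement)
    have "tab M ! j \<in> incr_lists n (cs ! j)" using T j by (intro ext_index_nth) (simp_all add: length_conj)
    then show "sorted_wrt (<) (tab M ! j)" "length (tab M ! j) = cs ! j" by (auto simp: incr_lists_def)
    show "ps ! j permutes {..<cs ! j}" using ps j by (auto simp: perm_lists_def)
  qed
  obtain j where j: "j < part nu 0" "ps ! j \<noteq> id"
    using ps by (auto simp: perm_lists_def list_eq_iff_nth_eq)
  have "Psi (Mon (tab M) ps) < Psi (Mon (tab M) ?ids)"
    unfolding Psi_Mon
  proof (rule sum_strict_mono_ex1)
    show "\<forall>j\<in>{..<part nu 0}. (\<Sum>i<cs ! j. tab M ! j ! i * (ps ! j) i) \<le> (\<Sum>i<cs ! j. tab M ! j ! i * (?ids ! j) i)"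
      using re by simp
    show "\<exists>j\<in>{..<part nu 0}. (\<Sum>i<cs ! j. tab M ! j ! i * (ps ! j) i) < (\<Sum>i<cs ! j. tab M ! j ! i * (?ids ! j) i)"
      using re[OF j(1)] j by (intro bexI[of _ j]) (auto simp: order.strict_iff_order)
  qed simp
  then show "Mon (tab M) ps \<in> {N. set_mset N \<subseteq> {..<n} \<times> {..<n} \<and> Psi N < Psi M}"
    using Mon_set[OF T, of ps] ps by (simp add: Mids)
qed


text \<open>Scaling column j of the matrix by s multiplies each monomial by a power of s and
  \<open>F\<close> by another; independence of monomials makes the exponents agree.\<close>

lemma semi_invariant_weight:
  fixes F :: "(nat \<Rightarrow> nat \<Rightarrow> 'k::field) \<Rightarrow> 'k"
  assumes inf: "infinite (UNIV :: 'k set)"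
    and A: "finite A" "\<And>x. F (curry x) = (\<Sum>M\<in>A. c M * mon x M)" "\<And>M. M \<in> A \<Longrightarrow> c M \<noteq> 0"
    and V: "\<And>M. M \<in> A \<Longrightarrow> set_mset M \<subseteq> {..<n} \<times> {..<n}"
    and inv: "\<And>g b. upper b \<Longrightarrow> (\<forall>i<n. b i i \<noteq> 0) \<Longrightarrow> F (mmul n g b) = chi n nu b * F g"
    and M: "M \<in> A"
  shows "tab_weight M"
  unfolding tab_weight_def
proof (intro conjI allI impI V M)
  fix j assume j: "j < n"
  let ?d = "count (image_mset snd M) j" and ?e = "nu ! j"
  have pow: "s ^ ?d = s ^ ?e" if s: "s \<noteq> 0" for s :: 'k
  proof -
    define b where "b = (\<lambda>i l. if i = l then (if i = j then s else 1) else 0 :: 'k)"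
    have b: "upper b" "\<forall>i<n. b i i \<noteq> 0" using s by (auto simp: b_def upper_def)
    have chi: "chi n nu b = s ^ ?e"
    proof -
      have "chi n nu b = (\<Prod>i<n. if i = j then s ^ ?e else 1)" unfolding chi_def b_def by (intro prod.cong) auto
      then show ?thesis using j by simp
    qed
    have "c M * s ^ ?d - s ^ ?e * c M = 0"
    proof (rule mon_independent[OF inf A(1) _ M])
      fix x
      have "(\<Sum>N\<in>A. c N * (s ^ count (image_mset snd N) j * mon x N)) = F (mmul n (curry x) b)"
      proof -
        have "mon (case_prod (mmul n (curry x) b)) N = s ^ count (image_mset snd N) j * mon x N" if N: "N \<in> A" for N
        proof -
          have "mon (case_prod (mmul n (curry x) b)) N = mon (\<lambda>v. (if snd v = j then s else 1) * x v) N"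
          proof (rule mon_cong)
            fix v assume "v \<in># N"
            with V[OF N] have "snd v < n" by auto
            then show "(case v of (a, i) \<Rightarrow> mmul n (curry x) b a i) = (if snd v = j then s else 1) * x v"
              by (cases v) (simp add: mmul_def b_def if_distrib[of "\<lambda>y. _ * y"] cong: if_cong)
          qed
          also have "\<dots> = mon (\<lambda>v. if snd v = j then s else 1) N * mon x N" by (rule mon_mult)
          also have "mon (\<lambda>v. if snd v = j then s else 1) N = s ^ count (image_mset snd N) j"
            by (induction N) auto
          finally show ?thesis .
        qed
        moreover have "F (mmul n (curry x) b) = (\<Sum>N\<in>A. c N * mon (case_prod (mmul n (curry x) b)) N)"
          using A(2)[of "case_prod (mmul n (curry x) b)"] by simp
        ultimately show ?thesis by (simp cong: sum.cong)
      qed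
      also have "\<dots> = s ^ ?e * (\<Sum>N\<in>A. c N * mon x N)" by (simp add: inv[OF b] chi A(2))
      finally show "(\<Sum>N\<in>A. (c N * s ^ count (image_mset snd N) j - s ^ ?e * c N) * mon x N) = 0"
        by (simp add: left_diff_distrib sum_subtractf sum_distrib_left mult.assoc)
    qed
    then show ?thesis using A(3)[OF M] by (simp add: mult.commute)
  qed
  then show "?d = ?e" by (rule power_exponent_unique[OF inf])
qed

text \<open>Induction on a strict bound for \<open>Psi\<close>. Several monomials may share the top
  value, so their bideterminants are subtracted together; this lowers the bound and keeps
  semi-invariance because of \<open>vec_right\<close>.\<close>

theorem semi_invariant_span:
  fixes F :: "(nat \<Rightarrow> nat \<Rightarrow> 'k::field) \<Rightarrow> 'k"
  assumes inf: "infinite (UNIV :: 'k set)"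
    and poly: "polyfun ({..<n} \<times> {..<n}) (\<lambda>x. F (curry x))"
    and inv: "\<And>g b. upper b \<Longrightarrow> (\<forall>i<n. b i i \<noteq> 0) \<Longrightarrow> F (mmul n g b) = chi n nu b * F g"
  shows "\<exists>\<beta>. \<forall>g. F g = (\<Sum>Ss\<in>ext_index n cs. \<beta> Ss * vec n cs g Ss)"
proof -
  let ?V = "{..<n} \<times> {..<n} :: (nat \<times> nat) set"
  have main: "\<exists>\<beta>. \<forall>g. F g = (\<Sum>Ss\<in>ext_index n cs. \<beta> Ss * vec n cs g Ss)"
    if "polyspan {N. set_mset N \<subseteq> ?V \<and> Psi N < k} (\<lambda>x. F (curry x))"
      and "\<And>g b. upper b \<Longrightarrow> (\<forall>i<n. b i i \<noteq> 0) \<Longrightarrow> F (mmul n g b) = chi n nu b * F g" for F :: "(nat \<Rightarrow> nat \<Rightarrow> 'k) \<Rightarrow> 'k" and k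
    using that
  proof (induction k arbitrary: F)
    case 0
    then have "F (curry x) = 0" for x by (auto simp: polyspan_def curry_def)
    then have "F g = 0" for g by (metis curry_case_prod)
    then show ?case by (intro exI[of _ "\<lambda>_. 0"]) simp
  next
    case (Suc k)
    note inv = Suc.prems(2)
    obtain A c where A: "finite A" "A \<subseteq> {N. set_mset N \<subseteq> ?V \<and> Psi N < Suc k}"
        "\<And>x. F (curry x) = (\<Sum>M\<in>A. c M * mon x M)" "\<And>M. M \<in> A \<Longrightarrow> c M \<noteq> 0"
      by (rule polyspanE[OF Suc.prems(1)], rule that)
    have AV: "\<And>M. M \<in> A \<Longrightarrow> set_mset M \<subseteq> ?V" and AP: "\<And>M. M \<in> A \<Longrightarrow> Psi M \<le> k"
      using A(2) by auto
    have wt: "tab_weight M" if "M \<in> A" for M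
      by (rule semi_invariant_weight[OF inf A(1,3,4) AV inv that])
    define top where "top = {M \<in> A. Psi M = k}"
    have ss: "semistandard M" if M: "M \<in> top" for M
      unfolding semistandard_def
    proof (intro allI impI)
      fix b m assume b: "Suc b < n"
      show "size (filter_mset (\<lambda>v. snd v = Suc b \<and> fst v \<le> m) M) \<le> size (filter_mset (\<lambda>v. snd v = b \<and> fst v < m) M)"
      proof (rule Psi_max_semistandard[OF inf A(1) A(3) A(4) AV, where L = "image_mset snd M"])
        fix N assume N: "N \<in> A"
        show "image_mset snd N = image_mset snd M"
        proof (rule multiset_eqI)
          fix i
          have "M \<in> A" using M by (simp add: top_def)
          then show "count (image_mset snd N) i = count (image_mset snd M) i"
            using wt[OF N] wt[of M] by (simp add: tab_weight_count)
        qed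
      next
        fix x :: "nat \<times> nat \<Rightarrow> 'k"
        \<comment> \<open>Right multiplication by this unipotent matrix subtracts column
          \<open>b\<close> from the next one, and \<open>chi\<close> is 1 on it.\<close>
        define u where "u = (\<lambda>i j. if i = j then 1 else if i = b \<and> j = Suc b then - 1 else 0 :: 'k)"
        let ?y = "\<lambda>(a, j). if j = Suc b then x (a, Suc b) - x (a, b) else x (a, j)"
        have u: "upper u" "\<forall>i<n. u i i \<noteq> 0" "chi n nu u = 1" by (auto simp: u_def upper_def chi_def)
        have "F (curry ?y) = F (mmul n (curry x) u)"
        proof -
          have eq: "mmul n (curry x) u a j = ?y (a, j)" if "j < n" for a j
          proof (cases "j = Suc b")
            case True
            have "mmul n (curry x) u a j = (\<Sum>k<n. (if k = Suc b then x (a, Suc b) else 0) - (if k = b then x (a, b) else 0))"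
              unfolding mmul_def u_def using True by (intro sum.cong) auto
            then show ?thesis using True b by (simp add: sum_subtractf)
          next
            case False
            have "mmul n (curry x) u a j = (\<Sum>k<n. if k = j then x (a, j) else 0)"
              unfolding mmul_def u_def using False by (intro sum.cong) auto
            then show ?thesis using False that by simp
          qed
          have "mon ?y M = mon (case_prod (mmul n (curry x) u)) M" if "M \<in> A" for M
          proof (rule mon_cong)
            fix v assume "v \<in># M"
            then show "?y v = (case v of (a, j) \<Rightarrow> mmul n (curry x) u a j)"
              using AV[OF that] eq by (cases v) auto
          qed
          then have "(\<Sum>M\<in>A. c M * mon ?y M) = (\<Sum>M\<in>A. c M * mon (case_prod (mmul n (curry x) u)) M)"
            by (intro sum.cong) simp_all
          then have "F (curry ?y) = F (curry (case_prod (mmul n (curry x) u)))" by (simp only: A(3))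
          then show ?thesis by simp
        qed
        then show "F (curry ?y) = F (curry x)" using inv[OF u(1,2), of "curry x"] u(3) by (simp only: mult_1_left)
      qed (use M AP b in \<open>auto simp: top_def\<close>)
    qed
    define F2 where "F2 g = F g - (\<Sum>M\<in>top. c M * vec n cs g (tab M))" for g
    have fintop: "finite top" using A(1) by (simp add: top_def)
    have "\<exists>\<beta>. \<forall>g. F2 g = (\<Sum>Ss\<in>ext_index n cs. \<beta> Ss * vec n cs g Ss)"
    proof (rule Suc.IH)
      have "A - top \<subseteq> {N. set_mset N \<subseteq> ?V \<and> Psi N < k}" using A(2) by (auto simp: top_def)
      then have 1: "polyspan {N. set_mset N \<subseteq> ?V \<and> Psi N < k} (\<lambda>x. \<Sum>M\<in>A - top. c M * mon x M)"
        using A(1) by (intro polyspan_family[where I = "A - top" and M = id and c = c]) auto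
      have 2: "polyspan {N. set_mset N \<subseteq> ?V \<and> Psi N < k} (\<lambda>x. \<Sum>M\<in>top. c M * (mon x M - vec n cs (curry x) (tab M)))"
      proof (intro polyspan_sum polyspan_scale)
        fix M assume "M \<in> top"
        then show "polyspan {N. set_mset N \<subseteq> ?V \<and> Psi N < k} (\<lambda>x :: nat \<times> nat \<Rightarrow> 'k. mon x M - vec n cs (curry x) (tab M))"
          using bideterminant_leading[OF wt ss, of M] by (simp add: top_def)
      qed
      have "F2 (curry x) = (\<Sum>M\<in>A - top. c M * mon x M) + (\<Sum>M\<in>top. c M * (mon x M - vec n cs (curry x) (tab M)))" for x
      proof -
        have "(\<Sum>M\<in>A. c M * mon x M) = (\<Sum>M\<in>A - top. c M * mon x M) + (\<Sum>M\<in>top. c M * mon x M)"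
          using A(1) by (intro sum.subset_diff) (auto simp: top_def)
        then show ?thesis by (simp add: F2_def A(3) right_diff_distrib sum_subtractf)
      qed
      then show "polyspan {N. set_mset N \<subseteq> ?V \<and> Psi N < k} (\<lambda>x. F2 (curry x))"
        using polyspan_add[OF 1 2] by simp
      fix g b assume "upper (b :: nat \<Rightarrow> nat \<Rightarrow> 'k)" "\<forall>i<n. b i i \<noteq> 0"
      then show "F2 (mmul n g b) = chi n nu b * F2 g"
        by (simp add: F2_def inv vec_right right_diff_distrib sum_distrib_left mult.left_commute)
    qed
    then obtain \<beta> where \<beta>: "\<And>g. F2 g = (\<Sum>Ss\<in>ext_index n cs. \<beta> Ss * vec n cs g Ss)" by blast
    show ?case
    proof (intro exI[of _ "\<lambda>Ss. \<beta> Ss + (\<Sum>M\<in>top. if Ss = tab M then c M else 0)"] allI)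
      fix g
      have "(\<Sum>Ss\<in>ext_index n cs. (\<Sum>M\<in>top. if Ss = tab M then c M else 0) * vec n cs g Ss)
          = (\<Sum>M\<in>top. \<Sum>Ss\<in>ext_index n cs. if Ss = tab M then c M * vec n cs g (tab M) else 0)"
        unfolding sum_distrib_right by (subst sum.swap) (auto intro!: sum.cong)
      also have "\<dots> = (\<Sum>M\<in>top. c M * vec n cs g (tab M))"
      proof (intro sum.cong refl)
        fix M assume M: "M \<in> top"
        then have "tab M \<in> ext_index n cs" using tab_ext[OF wt ss, of M] by (simp add: top_def)
        then show "(\<Sum>Ss\<in>ext_index n cs. if Ss = tab M then c M * vec n cs g (tab M) else 0) = c M * vec n cs g (tab M)"
          by simp
      qed
      finally show "F g = (\<Sum>Ss\<in>ext_index n cs. (\<beta> Ss + (\<Sum>M\<in>top. if Ss = tab M then c M else 0)) * vec n cs g Ss)"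
        using \<beta>[of g] by (simp add: F2_def distrib_right sum.distrib algebra_simps)
    qed
  qed
  obtain A c where A: "finite A" "A \<subseteq> {N. set_mset N \<subseteq> ?V}"
      "\<And>x. F (curry x) = (\<Sum>M\<in>A. c M * mon x M)" "\<And>M. M \<in> A \<Longrightarrow> c M \<noteq> 0"
    by (rule polyspanE[OF poly], rule that)
  obtain k where "\<forall>M\<in>A. Psi M < k"
    using A(1) finite_nat_set_iff_bounded[of "Psi ` A"] by auto
  then have "polyspan {N. set_mset N \<subseteq> ?V \<and> Psi N < k} (\<lambda>x. F (curry x))"
    using A by (intro polyspan_family[where I = A and M = id and c = c]) auto
  then show ?thesis using inv by (rule main)
qed

end

subsection \<open>Homomorphisms and primitive vectors\<close>

lemma (in vector_space_pair) dim_inj_image: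
  assumes f: "Vector_Spaces.linear s1 s2 f" and S: "vs1.subspace S" and inj: "inj_on f S"
  shows "vs2.dim (f ` S) = vs1.dim S"
proof -
  interpret f: Vector_Spaces.linear s1 s2 f by (rule f)
  obtain B where B: "B \<subseteq> S" "vs1.independent B" "S \<subseteq> vs1.span B" "card B = vs1.dim S"
    using vs1.basis_exists by blast
  have sp: "vs1.span B = S" using B(1,3) vs1.span_minimal[OF _ S] by blast
  have "vs2.independent (f ` B)"
    using f.dependent_inj_imageD[of B] B(2) inj by (auto simp: sp)
  moreover have "f ` S \<subseteq> vs2.span (f ` B)" by (simp add: f.span_image sp)
  ultimately have "vs2.dim (f ` S) = card (f ` B)"
    using B(1) by (intro vs2.dim_unique[OF _ _ _ refl]) auto
  also have "card (f ` B) = card B" using inj_on_subset[OF inj B(1)] by (rule card_image)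
  finally show ?thesis using B(4) by simp
qed

text \<open>The very scaling that occurs in \<open>hom_dim\<close>, so that its dimension is the one
  of the interpretation \<open>hs\<close>.\<close>

definition hscl :: "'k::field \<Rightarrow> ('a \<Rightarrow> 'i \<Rightarrow> 'k) \<Rightarrow> 'a \<Rightarrow> 'i \<Rightarrow> 'k" where
  "hscl = (\<lambda>c \<phi> x i. c * \<phi> x i)"

interpretation hs: vector_space "hscl :: 'k::field \<Rightarrow> ('a \<Rightarrow> 'i \<Rightarrow> 'k) \<Rightarrow> 'a \<Rightarrow> 'i \<Rightarrow> 'k"
  by standard (auto simp: hscl_def fun_eq_iff algebra_simps)

interpretation hsp: vector_space_pair "hscl :: 'k::field \<Rightarrow> ('a \<Rightarrow> 'i \<Rightarrow> 'k) \<Rightarrow> 'a \<Rightarrow> 'i \<Rightarrow> 'k"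
    "scl :: 'k::field \<Rightarrow> ('j \<Rightarrow> 'k) \<Rightarrow> 'j \<Rightarrow> 'k" ..

definition primitive :: "nat \<Rightarrow> nat list \<Rightarrow> nat list \<Rightarrow> (nat list list \<Rightarrow> 'k::field) set" where
  "primitive n la mu = {w \<in> weyl n mu.
     \<forall>b. upper b \<longrightarrow> (\<forall>i<n. b i i \<noteq> 0) \<longrightarrow> act n b w = scl (chi n la b) w}"

definition id_mat :: "nat \<Rightarrow> nat \<Rightarrow> 'k::field" where
  "id_mat = (\<lambda>i j. if i = j then 1 else 0)"

lemma id_mat_simps: "upper (id_mat :: nat \<Rightarrow> nat \<Rightarrow> 'k::field)" "id_mat i i = (1 :: 'k)"
    "chi n la (id_mat :: nat \<Rightarrow> nat \<Rightarrow> 'k) = 1"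
  by (auto simp: id_mat_def upper_def chi_def)

lemma mmul_id_right: "j < n \<Longrightarrow> mmul n g id_mat i j = g i j"
  by (simp add: mmul_def id_mat_def if_distrib[of "\<lambda>x. _ * x"] cong: if_cong)

lemma mmul_id_left: "i < n \<Longrightarrow> mmul n id_mat g i j = g i j"
  by (simp add: mmul_def id_mat_def if_distrib[of "\<lambda>x. x * _"] cong: if_cong)

locale two_parts = la: part_ctxt n la + mu: part_ctxt n mu for n la mu
begin

lemma subspace_primitive: "fs.subspace (primitive n la mu :: (nat list list \<Rightarrow> 'k::field) set)"
proof (rule fs.subspaceI)
  note lin = act_add act_scl act_zero
  fix x y :: "nat list list \<Rightarrow> 'k" and c :: 'k
  show "(0 :: nat list list \<Rightarrow> 'k) \<in> primitive n la mu"
    by (simp add: primitive_def lin fs.scale_zero_right fs.subspace_0[OF mu.subspace_weyl])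
  show "x + y \<in> primitive n la mu" if "x \<in> primitive n la mu" "y \<in> primitive n la mu"
    using that by (simp add: primitive_def lin fs.scale_right_distrib fs.subspace_add[OF mu.subspace_weyl])
  show "scl c x \<in> primitive n la mu" if "x \<in> primitive n la mu"
    using that by (simp add: primitive_def lin fs.scale_left_commute fs.subspace_scale[OF mu.subspace_weyl])
qed

lemma homD:
  assumes "\<phi> \<in> hom_S n la mu"
  shows "x \<in> weyl n la \<Longrightarrow> \<phi> x \<in> weyl n mu"
    and "x \<in> weyl n la \<Longrightarrow> y \<in> weyl n la \<Longrightarrow> \<phi> (x + y) = \<phi> x + \<phi> y"
    and "x \<in> weyl n la \<Longrightarrow> \<phi> (scl c x) = scl c (\<phi> x)"
    and "g \<in> GL n \<Longrightarrow> x \<in> weyl n la \<Longrightarrow> \<phi> (act n g x) = act n g (\<phi> x)"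
    and "x \<notin> weyl n la \<Longrightarrow> \<phi> x = 0"
  using assms by (auto simp: hom_S_def plus_fun_def scl_def zero_fun_def)

lemma homI:
  fixes \<phi> :: "(nat list list \<Rightarrow> 'k::field) \<Rightarrow> (nat list list \<Rightarrow> 'k)"
  assumes "\<And>x. x \<in> weyl n la \<Longrightarrow> \<phi> x \<in> weyl n mu"
    and "\<And>x y. x \<in> weyl n la \<Longrightarrow> y \<in> weyl n la \<Longrightarrow> \<phi> (x + y) = \<phi> x + \<phi> y"
    and "\<And>x c. x \<in> weyl n la \<Longrightarrow> \<phi> (scl c x) = scl c (\<phi> x)"
    and "\<And>g x. g \<in> GL n \<Longrightarrow> x \<in> weyl n la \<Longrightarrow> \<phi> (act n g x) = act n g (\<phi> x)"
    and "\<And>x. x \<notin> weyl n la \<Longrightarrow> \<phi> x = 0"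
  shows "\<phi> \<in> hom_S n la mu"
proof -
  note A = assms[unfolded plus_fun_def scl_def zero_fun_def]
  show ?thesis unfolding hom_S_def
    by (intro CollectI conjI ballI allI impI; rule A; assumption)
qed

lemma subspace_hom: "hs.subspace (hom_S n la mu :: ((nat list list \<Rightarrow> 'k::field) \<Rightarrow> _) set)"
proof (rule hs.subspaceI)
  note W = la.subspace_weyl mu.subspace_weyl
  note lin = act_add act_scl act_zero
  have h: "hscl c \<phi> x = scl c (\<phi> x)" for c :: 'k and \<phi> :: "(nat list list \<Rightarrow> 'k) \<Rightarrow> (nat list list \<Rightarrow> 'k)" and x
    by (simp add: hscl_def scl_def)
  show "(0 :: (nat list list \<Rightarrow> 'k) \<Rightarrow> _) \<in> hom_S n la mu"
    using fs.subspace_0[OF W(2)] by (intro homI) (simp_all add: lin fs.scale_zero_right)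
  fix \<phi> \<psi> :: "(nat list list \<Rightarrow> 'k) \<Rightarrow> (nat list list \<Rightarrow> 'k)" and c :: 'k
  assume \<phi>: "\<phi> \<in> hom_S n la mu"
  show "\<phi> + \<psi> \<in> hom_S n la mu" if \<psi>: "\<psi> \<in> hom_S n la mu"
    by (intro homI)
      (simp_all add: homD[OF \<phi>] homD[OF \<psi>] lin fs.subspace_add[OF W(2)] fs.scale_right_distrib add_ac)
  show "hscl c \<phi> \<in> hom_S n la mu"
    by (intro homI)
      (simp_all add: h homD[OF \<phi>] lin fs.subspace_scale[OF W(2)] fs.scale_right_distrib fs.scale_left_commute fs.scale_zero_right)
qed

definition hw :: "nat list list \<Rightarrow> 'k::field" where
  "hw = vec n la.cs id_mat"

lemma act_hw: "act n g hw = vec n la.cs g"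
  unfolding hw_def act_vec by (rule vec_cong) (simp_all add: mmul_id_right la.conj_le)

lemma hom_hw_primitive:
  assumes \<phi>: "\<phi> \<in> hom_S n la mu"
  shows "\<phi> hw \<in> (primitive n la mu :: (nat list list \<Rightarrow> 'k::field) set)"
proof -
  have hw: "hw \<in> (weyl n la :: (nat list list \<Rightarrow> 'k) set)" unfolding hw_def by (rule la.vec_mem_weyl)
  have "act n b (\<phi> hw) = scl (chi n la b) (\<phi> hw)" if b: "upper b" "\<forall>i<n. b i i \<noteq> 0" for b :: "nat \<Rightarrow> nat \<Rightarrow> 'k"
  proof -
    have "b \<in> GL n" using b by (simp add: GL_def minor_upper_diag)
    then have "act n b (\<phi> hw) = \<phi> (act n b hw)" using homD(4)[OF \<phi> _ hw] by simp
    \<comment> \<open>For the identity matrix, left multiplication by b is also right multiplication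
      by b, and there \<open>vec_right\<close> applies.\<close>
    also have "act n b hw = vec n la.cs (mmul n id_mat b)"
      unfolding act_hw by (rule vec_cong) (simp_all add: mmul_id_left la.conj_le)
    also have "\<dots> = scl (chi n la b) hw" unfolding hw_def by (rule la.vec_right[OF b(1)])
    also have "\<phi> \<dots> = scl (chi n la b) (\<phi> hw)" by (rule homD(3)[OF \<phi> hw])
    finally show ?thesis .
  qed
  then show ?thesis using homD(1)[OF \<phi> hw] by (simp add: primitive_def)
qed

text \<open>\<open>hom_S\<close> demands commutation with invertible matrices only, so the orbit is
  cut down to them; the determinant plays the part of \<open>D\<close> in
  \<open>weyl_span_dense\<close>.\<close>

lemma weyl_span_GL:
  assumes inf: "infinite (UNIV :: 'k::field set)"
  shows "weyl n la = fs.span {vec n la.cs g | g :: nat \<Rightarrow> nat \<Rightarrow> 'k. g \<in> GL n}"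
proof -
  have "polyfun ({..<n} \<times> {..<n}) (\<lambda>x :: nat \<times> nat \<Rightarrow> 'k. minor (curry x) [0..<n] [0..<n])"
    by (rule polyfun_minor) auto
  from la.weyl_span_dense[OF inf this, of "case_prod id_mat"] show ?thesis
    by (simp add: minor_upper_diag id_mat_simps GL_def)
qed

lemma hom_hw_inj:
  assumes inf: "infinite (UNIV :: 'k::field set)"
  shows "inj_on (\<lambda>\<phi>. \<phi> hw) (hom_S n la mu :: ((nat list list \<Rightarrow> 'k) \<Rightarrow> _) set)"
proof (rule inj_onI)
  fix \<phi> \<psi> :: "(nat list list \<Rightarrow> 'k) \<Rightarrow> (nat list list \<Rightarrow> 'k)"
  assume \<phi>: "\<phi> \<in> hom_S n la mu" and \<psi>: "\<psi> \<in> hom_S n la mu" and eq: "\<phi> hw = \<psi> hw"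
  have hw: "hw \<in> (weyl n la :: (nat list list \<Rightarrow> 'k) set)" unfolding hw_def by (rule la.vec_mem_weyl)
  have "x \<in> weyl n la \<and> \<phi> x = \<psi> x" if "x \<in> weyl n la" for x
    using that unfolding weyl_span_GL[OF inf]
  proof (induction rule: fs.span_induct_alt)
    case base
    have "\<phi> (scl 0 hw) = \<psi> (scl 0 hw)" 
      by (simp only: homD(3)[OF \<phi> hw] homD(3)[OF \<psi> hw] eq)
    then show ?case by (simp only: fs.scale_zero_left fs.span_zero simp_thms)
  next
    case (step c x y)
    then obtain g where g: "x = vec n la.cs g" "g \<in> GL n" by blast
    have x: "x \<in> weyl n la" unfolding g by (rule la.vec_mem_weyl)
    have y: "y \<in> weyl n la" using step.IH by (simp only: weyl_span_GL[OF inf])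
    have cx: "scl c x \<in> weyl n la" by (rule fs.subspace_scale[OF la.subspace_weyl x])
    have "\<phi> x = \<psi> x"
      using homD(4)[OF \<phi> g(2) hw] homD(4)[OF \<psi> g(2) hw] eq by (simp add: g(1) act_hw)
    then have "\<phi> (scl c x + y) = \<psi> (scl c x + y)"
      using step.IH by (simp only: homD(2)[OF \<phi> cx y] homD(2)[OF \<psi> cx y] homD(3)[OF \<phi> x] homD(3)[OF \<psi> x])
    moreover have "scl c x + y \<in> weyl n la" by (rule fs.subspace_add[OF la.subspace_weyl cx y])
    ultimately show ?case by (simp only: weyl_span_GL[OF inf])
  qed
  note on_weyl = this
  show "\<phi> = \<psi>"
  proof
    fix x
    show "\<phi> x = \<psi> x"
    proof (cases "x \<in> weyl n la")
      case True
      then show ?thesis using on_weyl by blast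
    next
      case False
      from homD(5)[OF \<phi> this] homD(5)[OF \<psi> this] show ?thesis by (simp only:)
    qed
  qed
qed

text \<open>Each coordinate of g w is a polynomial semi-invariant of weight \<open>la\<close>, hence
  a combination, with coefficients independent of g, of the coordinates of the orbit of
  \<open>hw\<close>. Applying these combinations to arbitrary coordinate functions gives a linear
  \<open>\<Phi>\<close> that takes g hw to g w.\<close>

lemma primitive_hom_ex:
  assumes inf: "infinite (UNIV :: 'k::field set)" and w: "w \<in> (primitive n la mu :: (nat list list \<Rightarrow> 'k) set)"
  shows "\<exists>\<phi>\<in>hom_S n la mu. \<phi> hw = w"
proof -
  have wW: "w \<in> weyl n mu" using w by (simp add: primitive_def)
  have wb: "act n b w = scl (chi n la b) w" if "upper b" "\<forall>i<n. b i i \<noteq> 0" for b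
    using w that by (simp add: primitive_def)
  have "\<exists>\<beta>. \<forall>g. act n g w Ss' = (\<Sum>Ss\<in>ext_index n la.cs. \<beta> Ss * vec n la.cs g Ss)" for Ss'
  proof (rule la.semi_invariant_span[OF inf])
    show "polyfun ({..<n} \<times> {..<n}) (\<lambda>x. act n (curry x) w Ss')"
      by (rule polyfun_act) (rule mu.weyl_supported[OF wW])
    fix g b :: "nat \<Rightarrow> nat \<Rightarrow> 'k" assume b: "upper b" "\<forall>i<n. b i i \<noteq> 0"
    have "act n (mmul n g b) w = act n g (scl (chi n la b) w)"
      by (simp only: mu.act_act[OF inf wW, symmetric] wb[OF b])
    also have "\<dots> = scl (chi n la b) (act n g w)"
      by (rule act_scl)
    finally show "act n (mmul n g b) w Ss' = chi n la b * act n g w Ss'" by simp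
  qed
  then obtain \<beta> where \<beta>: "\<And>Ss' g. act n g w Ss' = (\<Sum>Ss\<in>ext_index n la.cs. \<beta> Ss' Ss * vec n la.cs g Ss)"
    by metis
  define \<Phi> where "\<Phi> x = (\<lambda>Ss'. \<Sum>Ss\<in>ext_index n la.cs. \<beta> Ss' Ss * x Ss)" for x :: "nat list list \<Rightarrow> 'k"
  have \<Phi>vec: "\<Phi> (vec n la.cs g) = act n g w" for g by (rule ext) (simp only: \<Phi>_def \<beta>)
  have \<Phi>add: "\<Phi> (x + y) = \<Phi> x + \<Phi> y" for x y
    by (rule ext) (simp add: \<Phi>_def distrib_left sum.distrib)
  have \<Phi>scl: "\<Phi> (scl c x) = scl c (\<Phi> x)" for x c
    by (rule ext) (simp add: \<Phi>_def sum_distrib_left mult.left_commute)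
  note lin = act_add act_scl
  have main: "\<Phi> x \<in> weyl n mu \<and> \<Phi> (act n g x) = act n g (\<Phi> x)" if "x \<in> weyl n la" for x g
    using that unfolding weyl_span_GL[OF inf]
  proof (induction rule: fs.span_induct_alt)
    case base
    have z: "\<Phi> 0 = 0" "act n g 0 = (0 :: nat list list \<Rightarrow> 'k)"
      using \<Phi>scl[of 0 0] by (simp_all only: fs.scale_zero_left act_zero)
    show ?case by (simp only: z fs.subspace_0[OF mu.subspace_weyl] simp_thms)
  next
    case (step c x y)
    then obtain h where h: "x = vec n la.cs h" by blast
    have x: "\<Phi> x \<in> weyl n mu" unfolding h \<Phi>vec by (rule mu.act_mem_weyl[OF inf wW])
    have "\<Phi> (act n g x) = act n g (\<Phi> x)"
      unfolding h act_vec \<Phi>vec by (rule mu.act_act[OF inf wW, symmetric])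
    moreover have "scl c (\<Phi> x) + \<Phi> y \<in> weyl n mu"
      using x step.IH by (blast intro: fs.subspace_add[OF mu.subspace_weyl] fs.subspace_scale[OF mu.subspace_weyl])
    ultimately show ?case using step.IH by (simp only: lin \<Phi>add \<Phi>scl simp_thms)
  qed
  \<comment> \<open>\<open>hom_S\<close> requires its maps to vanish off the Weyl module.\<close>
  define \<phi> where "\<phi> x = (if x \<in> weyl n la then \<Phi> x else 0)" for x
  have hw: "hw \<in> (weyl n la :: (nat list list \<Rightarrow> 'k) set)" unfolding hw_def by (rule la.vec_mem_weyl)
  have "\<phi> \<in> hom_S n la mu"
  proof (rule homI)
    fix x y :: "nat list list \<Rightarrow> 'k" assume xy: "x \<in> weyl n la" "y \<in> weyl n la"
    then show "\<phi> (x + y) = \<phi> x + \<phi> y"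
      by (simp only: \<phi>_def fs.subspace_add[OF la.subspace_weyl xy] if_True \<Phi>add)
  next
    fix x :: "nat list list \<Rightarrow> 'k" and c assume x: "x \<in> weyl n la"
    then show "\<phi> (scl c x) = scl c (\<phi> x)"
      by (simp only: \<phi>_def fs.subspace_scale[OF la.subspace_weyl x] if_True \<Phi>scl)
  next
    fix g and x :: "nat list list \<Rightarrow> 'k" assume x: "x \<in> weyl n la"
    then show "\<phi> (act n g x) = act n g (\<phi> x)"
      using main[OF x, of g] la.act_mem_weyl[OF inf x, of g] by (simp only: \<phi>_def if_True)
  qed (use main in \<open>simp_all add: \<phi>_def\<close>)
  moreover have "\<phi> hw = w"
  proof -
    have "\<phi> hw = act n id_mat w" unfolding \<phi>_def using hw by (simp only: if_True) (simp only: hw_def \<Phi>vec)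
    also have "\<dots> = w" using wb[of id_mat] by (simp add: id_mat_simps fs.scale_one)
    finally show ?thesis .
  qed
  ultimately show ?thesis by blast
qed

theorem hom_dim_eq_dim_primitive:
  assumes inf: "infinite (UNIV :: 'k::field set)"
  shows "hom_dim TYPE('k) n la mu = fs.dim (primitive n la mu :: (nat list list \<Rightarrow> 'k) set)"
proof -
  let ?H = "hom_S n la mu :: ((nat list list \<Rightarrow> 'k) \<Rightarrow> (nat list list \<Rightarrow> 'k)) set"
  let ?E = "\<lambda>\<phi> :: (nat list list \<Rightarrow> 'k) \<Rightarrow> (nat list list \<Rightarrow> 'k). \<phi> hw"
  have "?E ` ?H = primitive n la mu"
    using hom_hw_primitive primitive_hom_ex[OF inf] by blast
  moreover have "fs.dim (?E ` ?H) = hs.dim ?H"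
  proof (rule hsp.dim_inj_image)
    show "Vector_Spaces.linear hscl scl ?E"
      unfolding Vector_Spaces.linear_iff
      by (intro conjI hs.vector_space_axioms fs.vector_space_axioms) (simp_all add: hscl_def scl_def)
  qed (rule subspace_hom, rule hom_hw_inj[OF inf])
  ultimately show ?thesis by (simp add: hom_dim_def hscl_def)
qed

end

subsection \<open>Appending columns of length one\<close>

abbreviation sing :: "nat list \<Rightarrow> nat list list" where
  "sing qs \<equiv> map (\<lambda>q. [q]) qs"

lemma minor_single: "minor g [a] [b] = g a b"
proof -
  have "{p. p permutes {..<Suc 0}} = {id}"
    by (auto simp: lessThan_Suc permutes_insert)
  then show ?thesis by (simp add: minor_def lessThan_Suc)
qed

lemma prod_lessThan_add: "(\<Prod>j<a + b. f j) = (\<Prod>j<a. f j) * (\<Prod>j<b. f (a + j))" for a b :: nat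
  by (induction b) (simp_all add: mult.assoc)

lemma words_alt: "words n k = {w. length w = k \<and> (\<forall>i<k. w ! i \<in> {..<n})}"
  by (auto simp: words_def subset_iff in_set_conv_nth)

lemma prod_mset_words: "w \<in> words n k \<Longrightarrow> (\<Prod>i<k. f (w ! i)) = mon f (mset w)"
  by (auto simp: words_def mon_def prod_list_nth)

lemma ext_index_append:
  "Ss \<in> ext_index n c0 \<Longrightarrow> qs \<in> words n k \<Longrightarrow> Ss @ sing qs \<in> ext_index n (c0 @ replicate k 1)"
  by (auto simp: ext_index_eq incr_lists_def words_alt nth_append)

lemma ext_index_split:
  assumes T: "T \<in> ext_index n (c0 @ replicate k 1)"
  obtains Ss qs where "Ss \<in> ext_index n c0" "qs \<in> words n k" "T = Ss @ sing qs"
proof -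
  have len: "length T = length c0 + k" using ext_index_length[OF T] by simp
  have nth: "T ! j \<in> incr_lists n ((c0 @ replicate k 1) ! j)" if "j < length c0 + k" for j
    using ext_index_nth[OF T] that by simp
  define Ss where "Ss = take (length c0) T"
  define qs where "qs = map hd (drop (length c0) T)"
  have "Ss \<in> ext_index n c0"
    using len nth by (auto simp: Ss_def ext_index_eq) (metis nth_append trans_less_add1)
  moreover have one: "length (T ! (length c0 + i)) = 1 \<and> set (T ! (length c0 + i)) \<subseteq> {..<n}" if "i < k" for i
    using nth[of "length c0 + i"] that by (simp add: nth_append incr_lists_def)
  then have hd: "T ! (length c0 + i) = [hd (T ! (length c0 + i))]" if "i < k" for i
    using that by (metis One_nat_def length_0_conv length_Suc_conv list.sel(1))
  have "qs \<in> words n k"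
  proof -
    have "hd (T ! (length c0 + i)) < n" if "i < k" for i
    proof -
      have "set [hd (T ! (length c0 + i))] \<subseteq> {..<n}" using one[OF that] hd[OF that] by metis
      then show ?thesis by simp
    qed
    then show ?thesis using len by (simp add: qs_def words_alt)
  qed
  moreover have "T = Ss @ sing qs"
  proof -
    have "sing qs = drop (length c0) T"
      using len hd by (intro nth_equalityI) (simp_all add: qs_def)
    then show ?thesis by (simp add: Ss_def)
  qed
  ultimately show thesis by (rule that)
qed

lemma sum_ext_index_append:
  "(\<Sum>T\<in>ext_index n (c0 @ replicate k 1). f T) = (\<Sum>Ss\<in>ext_index n c0. \<Sum>qs\<in>words n k. f (Ss @ sing qs))"
proof -
  let ?h = "\<lambda>(Ss, qs). Ss @ sing qs"
  have "inj_on ?h (ext_index n c0 \<times> words n k)"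
    by (rule inj_onI) (auto dest!: ext_index_length simp: inj_map_eq_map inj_def)
  moreover have "ext_index n (c0 @ replicate k 1) = ?h ` (ext_index n c0 \<times> words n k)"
    using ext_index_split[of _ n c0 k] ext_index_append by (auto simp: image_iff) metis
  ultimately show ?thesis
    by (simp add: sum.reindex sum.cartesian_product case_prod_beta')
qed

lemma prod_columns_append:
  assumes Ss: "Ss \<in> ext_index n c0" and qs: "qs \<in> words n k" and T: "T \<in> ext_index n c0" and rs: "rs \<in> words n k"
  shows "(\<Prod>j<length (c0 @ replicate k 1). minor g ((Ss @ sing qs) ! j) ((T @ sing rs) ! j))
     = (\<Prod>j<length c0. minor g (Ss ! j) (T ! j)) * (\<Prod>i<k. g (qs ! i) (rs ! i))"
proof -
  have "length Ss = length c0" "length T = length c0" "length qs = k" "length rs = k"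
    using assms by (auto simp: words_def dest: ext_index_length)
  then show ?thesis by (simp add: prod_lessThan_add nth_append minor_single)
qed

text \<open>A column of length one contributes a single matrix entry, so on the orbit the appended
  columns enter as a commutative product. Symmetry in these columns and the Frobenius argument both
  come from this.\<close>

lemma vec_append:
  assumes Ss: "Ss \<in> ext_index n c0" and qs: "qs \<in> words n k"
  shows "vec n (c0 @ replicate k 1) g (Ss @ sing qs) = vec n c0 g Ss * mon (\<lambda>q. g q 0) (mset qs)"
proof -
  have "length Ss = length c0" "length qs = k" using assms by (auto simp: words_def dest: ext_index_length)
  then show ?thesis
    using ext_index_append[OF Ss qs] Ss
    by (simp add: vec_def prod_lessThan_add nth_append minor_single prod_mset_words[OF qs, of "\<lambda>q. g q 0", symmetric])
qed

subsection \<open>Weights\<close>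

definition diag :: "(nat \<Rightarrow> 'k::field) \<Rightarrow> nat \<Rightarrow> nat \<Rightarrow> 'k" where
  "diag t = (\<lambda>i j. if i = j then t i else 0)"

abbreviation tab_content :: "nat list list \<Rightarrow> nat multiset" where
  "tab_content Ss \<equiv> mset (concat Ss)"

lemma mon_content: "mon t (tab_content Ss) = (\<Prod>j<length Ss. \<Prod>i<length (Ss ! j). t (Ss ! j ! i))"
  by (induction Ss) (simp_all add: prod.lessThan_Suc_shift mon_def prod_list_nth del: prod.lessThan_Suc)

lemma vec_diag_left: "vec n c0 (mmul n (diag t) g) Ss = mon t (tab_content Ss) * vec n c0 g Ss"
proof (cases "Ss \<in> ext_index n c0")
  case True
  have "minor (mmul n (diag t) g) (Ss ! j) [0..<c0 ! j] = (\<Prod>i<length (Ss ! j). t (Ss ! j ! i)) * minor g (Ss ! j) [0..<c0 ! j]"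
    if j: "j < length c0" for j
  proof -
    have S: "Ss ! j \<in> incr_lists n (c0 ! j)" using True j by (rule ext_index_nth)
    then have l: "length (Ss ! j) = c0 ! j" by (rule incr_lists_length)
    have "mmul n (diag t) g (Ss ! j ! i) b = t (Ss ! j ! i) * g (Ss ! j ! i) b" if "i < c0 ! j" for i b
    proof -
      have "Ss ! j ! i < n" using S that by (simp add: incr_lists_def subset_iff)
      then show ?thesis by (simp add: mmul_def diag_def if_distrib[of "\<lambda>x. x * _"] cong: if_cong)
    qed
    then show ?thesis
      by (simp add: minor_def l prod.distrib sum_distrib_left mult.left_commute)
  qed
  then show ?thesis
    using True ext_index_length[OF True] by (simp add: vec_def mon_content prod.distrib)
qed (simp add: vec_outside)

lemma content_lt: "Ss \<in> ext_index n c0 \<Longrightarrow> i \<in># tab_content Ss \<Longrightarrow> i < n"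
  by (auto simp: ext_index_def in_set_conv_nth) (metis lessThan_iff nth_mem subsetD)

context part_ctxt
begin

lemma act_diag:
  assumes inf: "infinite (UNIV :: 'k::field set)" and w: "w \<in> (weyl n nu :: (nat list list \<Rightarrow> 'k) set)"
  shows "act n (diag t) w Ss = mon t (tab_content Ss) * w Ss"
proof -
  have w: "w \<in> fs.span {vec n cs h | h. (\<lambda>_. 1 :: 'k) (case_prod h) \<noteq> 0}"
    using w weyl_span_dense[OF inf polyfun_const, of 1] by simp
  then show ?thesis
  proof (induction rule: fs.span_induct_alt)
    case base
    show ?case unfolding act_zero by simp
  next
    case (step c x y)
    then obtain h where "x = vec n cs h" by blast
    have e: "act n (diag t) (scl c x + y) Ss = c * act n (diag t) x Ss + act n (diag t) y Ss"
      by (subst act_add, subst act_scl) simp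
    show ?case
      unfolding e step.IH unfolding \<open>x = _\<close> act_vec vec_diag_left
      by (simp only: plus_fun_apply scl_apply distrib_left mult.left_commute)
  qed
qed

definition proj :: "nat multiset \<Rightarrow> (nat list list \<Rightarrow> 'k::field) \<Rightarrow> nat list list \<Rightarrow> 'k" where
  "proj \<kappa> w = (\<lambda>Ss. if tab_content Ss = \<kappa> then w Ss else 0)"

text \<open>Diagonal matrices multiply the component of content \<open>\<kappa>\<close> by the
  monomial of \<open>\<kappa>\<close> in their entries, so \<open>mon_coeff_mem\<close> separates
  the components without leaving the module.\<close>

lemma proj_mem_weyl:
  assumes inf: "infinite (UNIV :: 'k::field set)" and w: "w \<in> (weyl n nu :: (nat list list \<Rightarrow> 'k) set)"
  shows "proj \<kappa> w \<in> weyl n nu"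
proof (cases "\<kappa> \<in> tab_content ` ext_index n cs")
  case True
  show ?thesis
  proof (rule fs.mon_coeff_mem[OF inf, where I = "tab_content ` ext_index n cs" and M = id and D = "\<lambda>_. 1" and v = "\<lambda>\<kappa>. proj \<kappa> w"])
    show "polyfun UNIV (\<lambda>_. 1 :: 'k)" by (rule polyfun_const)
    fix t :: "nat \<Rightarrow> 'k"
    have "(\<Sum>\<kappa>\<in>tab_content ` ext_index n cs. scl (mon t (id \<kappa>)) (proj \<kappa> w)) = act n (diag t) w"
    proof
      fix Ss
      have "(\<Sum>\<kappa>\<in>tab_content ` ext_index n cs. scl (mon t (id \<kappa>)) (proj \<kappa> w)) Ss
          = (\<Sum>\<kappa>\<in>tab_content ` ext_index n cs. if tab_content Ss = \<kappa> then mon t \<kappa> * w Ss else 0)"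
        unfolding sum_fun_apply by (intro sum.cong) (auto simp: proj_def)
      also have "\<dots> = (if Ss \<in> ext_index n cs then mon t (tab_content Ss) * w Ss else 0)"
        using weyl_supported[OF w] by (simp del: mset_concat)
      also have "\<dots> = act n (diag t) w Ss"
        using weyl_supported[OF w] by (simp add: act_diag[OF inf w])
      finally show "(\<Sum>\<kappa>\<in>tab_content ` ext_index n cs. scl (mon t (id \<kappa>)) (proj \<kappa> w)) Ss = act n (diag t) w Ss" .
    qed
    then show "(\<Sum>\<kappa>\<in>tab_content ` ext_index n cs. scl (mon t (id \<kappa>)) (proj \<kappa> w)) \<in> weyl n nu"
      using act_mem_weyl[OF inf w] by (simp only:)
  qed (use True subspace_weyl in auto)
next
  case False
  have "proj \<kappa> w = 0"
    using False weyl_supported[OF w] by (auto simp: proj_def fun_eq_iff simp del: mset_concat)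
  then show ?thesis using fs.subspace_0[OF subspace_weyl] by (simp only:)
qed

text \<open>Clear on the orbit by \<open>vec_append\<close>, and the identity is linear in
  \<open>w\<close>.\<close>

lemma weyl_permute_singles:
  assumes inf: "infinite (UNIV :: 'k::field set)" and w: "w \<in> (weyl n nu :: (nat list list \<Rightarrow> 'k) set)"
    and cs: "cs = c0 @ replicate k 1" and Ss: "Ss \<in> ext_index n c0"
    and qs: "qs \<in> words n k" "rs \<in> words n k" "mset qs = mset rs"
  shows "w (Ss @ sing qs) = w (Ss @ sing rs)"
proof -
  have w: "w \<in> fs.span {vec n cs h | h. (\<lambda>_. 1 :: 'k) (case_prod h) \<noteq> 0}"
    using w weyl_span_dense[OF inf polyfun_const, of 1] by simp
  then show ?thesis
  proof (induction rule: fs.span_induct_alt)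
    case base
    then show ?case by (simp only: zero_fun_apply)
  next
    case (step c x y)
    then obtain h where h: "x = vec n cs h" by blast
    show ?case
      unfolding plus_fun_apply scl_apply step.IH h cs vec_append[OF Ss qs(1)] vec_append[OF Ss qs(2)] qs(3) by (rule refl)
  qed
qed

end

lemma (in two_parts) primitive_content:
  assumes inf: "infinite (UNIV :: 'k::field set)" and w: "w \<in> (primitive n la mu :: (nat list list \<Rightarrow> 'k) set)"
    and nz: "w Ss \<noteq> 0" and i: "i < n"
  shows "count (tab_content Ss) i = la ! i"
proof (rule power_exponent_unique[OF inf])
  fix s :: 'k assume s: "s \<noteq> 0"
  define t where "t j = (if j = i then s else 1)" for j
  have W: "w \<in> weyl n mu" using w by (simp add: primitive_def)
  have "upper (diag t)" "\<forall>i<n. diag t i i \<noteq> 0" using s by (auto simp: upper_def diag_def t_def)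
  then have "act n (diag t) w = scl (chi n la (diag t)) w" using w by (simp add: primitive_def)
  from arg_cong[OF this, of "\<lambda>f. f Ss"] have "mon t (tab_content Ss) * w Ss = chi n la (diag t) * w Ss"
    by (simp only: mu.act_diag[OF inf W] scl_apply)
  then have "mon t (tab_content Ss) = chi n la (diag t)" using nz by simp
  also have "chi n la (diag t) = (\<Prod>j<n. if j = i then s ^ (la ! i) else 1)"
    unfolding chi_def by (intro prod.cong) (auto simp: diag_def t_def)
  also have "\<dots> = s ^ (la ! i)" using i by simp
  also have "mon t M = s ^ count M i" for M by (induction M) (auto simp: t_def)
  finally show "s ^ count (tab_content Ss) i = s ^ (la ! i)" .
qed


subsection \<open>Lengthening the first rows\<close>

text \<open>Here \<open>N\<close> is arbitrary: this is enough to define \<open>res\<close> and to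
  prove it injective. That \<open>N\<close> is a multiple of a power of the characteristic enters in
  \<open>periodic\<close>, to make \<open>res\<close> compatible with \<open>act\<close>.\<close>

locale shifted = two_parts n la mu for n la mu +
  fixes N :: nat
  assumes n: "n \<ge> 1" and mu_la: "part mu 1 \<le> part la 0"
begin

abbreviation "la' \<equiv> add_first N la"
abbreviation "mu' \<equiv> add_first N mu"

lemma add_first_nth:
  assumes "length nu = n" "i < n" shows "add_first N nu ! i = (if i = 0 then nu ! 0 + N else nu ! i)"
  using assms by (cases nu; cases i) (auto simp: add_first_def)

lemma part_ctxt_add_first: "part_ctxt n nu \<Longrightarrow> part_ctxt n (add_first N nu)"
  unfolding part_ctxt_def add_first_def by (cases nu) auto

sublocale ext: two_parts n la' mu'
  by (intro two_parts.intro part_ctxt_add_first la.part_ctxt_axioms mu.part_ctxt_axioms)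

lemma part_simps: "part la 0 = la ! 0" "part mu 0 = mu ! 0" "part la' 0 = la ! 0 + N" "part mu' 0 = mu ! 0 + N"
  using n la.len mu.len add_first_nth[of la 0] add_first_nth[of mu 0] by (auto simp: part_def add_first_def)

lemma chi': "chi n la' b = b 0 0 ^ N * chi n la b"
proof -
  have "{..<n} = insert 0 {1..<n}" using n by auto
  then have "chi n nu b = b 0 0 ^ (nu ! 0) * (\<Prod>i\<in>{1..<n}. b i i ^ (nu ! i))" for nu
    unfolding chi_def by simp
  moreover have "(\<Prod>i\<in>{1..<n}. b i i ^ (la' ! i)) = (\<Prod>i\<in>{1..<n}. b i i ^ (la ! i))"
    by (intro prod.cong) (auto simp: add_first_nth[OF la.len])
  moreover have "la' ! 0 = la ! 0 + N" using n add_first_nth[OF la.len, of 0] by simp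
  ultimately show ?thesis by (simp add: power_add mult_ac)
qed

lemma mu_nth_le: "0 < i \<Longrightarrow> i < n \<Longrightarrow> mu ! i \<le> part mu 1"
  using sorted_wrt_nth_less[OF mu.sorted, of 1 i] mu.len by (cases "i = 1") (auto simp: part_def)

lemma la_nth_le: "0 < i \<Longrightarrow> i < n \<Longrightarrow> la ! i \<le> part la 1"
  using sorted_wrt_nth_less[OF la.sorted, of 1 i] la.len by (cases "i = 1") (auto simp: part_def)

text \<open>For n = 1 the default value in \<open>part\<close> makes \<open>part mu 1\<close> zero,
  so every column counts as one of length one.\<close>

lemma mu_cs: "mu.cs = take (part mu 1) mu.cs @ replicate (part mu 0 - part mu 1) 1"
proof (rule nth_equalityI)
  have le: "part mu 1 \<le> part mu 0"
    using mu.nu_le_part[of 1] mu.len by (auto simp: part_def)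
  then show "length mu.cs = length (take (part mu 1) mu.cs @ replicate (part mu 0 - part mu 1) 1)"
    by (simp add: mu.length_conj)
  fix j assume "j < length mu.cs"
  then have j: "j < part mu 0" by (simp add: mu.length_conj)
  show "mu.cs ! j = (take (part mu 1) mu.cs @ replicate (part mu 0 - part mu 1) 1) ! j"
  proof (cases "j < part mu 1")
    case False
    have "0 < mu.cs ! j" using mu.conj_nth[OF j, of 0] n j part_simps by simp
    moreover have "\<not> 1 < mu.cs ! j"
      using mu.conj_nth[OF j, of 1] mu_nth_le[of 1] False by force
    ultimately have "mu.cs ! j = 1" by simp
    then show ?thesis using False j le by (simp add: nth_append mu.length_conj)
  qed (use j in \<open>simp add: nth_append mu.length_conj\<close>)
qed

lemma mu'_cs: "ext.mu.cs = mu.cs @ replicate N 1"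
proof (rule nth_equalityI)
  show "length ext.mu.cs = length (mu.cs @ replicate N 1)"
    by (simp add: mu.length_conj ext.mu.length_conj part_simps)
  fix j assume "j < length ext.mu.cs"
  then have j: "j < part mu' 0" by (simp add: ext.mu.length_conj)
  show "ext.mu.cs ! j = (mu.cs @ replicate N 1) ! j"
  proof (cases "j < part mu 0")
    case True
    have "i < ext.mu.cs ! j \<longleftrightarrow> i < mu.cs ! j" for i
      using ext.mu.conj_nth[OF j, of i] mu.conj_nth[OF True, of i] add_first_nth[OF mu.len, of i] True part_simps
      by (auto split: if_splits)
    then have "ext.mu.cs ! j = mu.cs ! j" by (metis linorder_neqE_nat less_irrefl)
    then show ?thesis using True by (simp add: nth_append mu.length_conj)
  next
    case False
    have "0 < ext.mu.cs ! j" using ext.mu.conj_nth[OF j, of 0] n j part_simps add_first_nth[OF mu.len, of 0] by simp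
    moreover have "\<not> 1 < ext.mu.cs ! j"
      using ext.mu.conj_nth[OF j, of 1] mu.nu_le_part[of 1] add_first_nth[OF mu.len, of 1] False by force
    ultimately have "ext.mu.cs ! j = 1" by simp
    then show ?thesis using False j part_simps by (simp add: nth_append mu.length_conj)
  qed
qed

definition res :: "(nat list list \<Rightarrow> 'k::field) \<Rightarrow> nat list list \<Rightarrow> 'k" where
  "res w = (\<lambda>Ss. if Ss \<in> ext_index n mu.cs then w (Ss @ sing (replicate N 0)) else 0)"

lemma res_add: "res (x + y) = res x + res y" and res_scl: "res (scl c x) = scl c (res x)"
  by (rule ext, simp add: res_def)+

lemma linear_res: "Vector_Spaces.linear scl scl res"
  unfolding Vector_Spaces.linear_iff
  by (intro conjI allI fs.vector_space_axioms res_add res_scl)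

lemma zeros_words: "replicate N 0 \<in> words n N"
  using n by (auto simp: words_def)

lemma res_vec: "res (vec n ext.mu.cs g) = scl (g 0 0 ^ N) (vec n mu.cs g)"
proof
  fix Ss
  show "res (vec n ext.mu.cs g) Ss = scl (g 0 0 ^ N) (vec n mu.cs g) Ss"
    using vec_append[OF _ zeros_words, of Ss mu.cs g]
    by (simp add: res_def mu'_cs mon_replicate vec_outside)
qed

text \<open>Each column contains at most one zero, and at most \<open>part mu 1 \<le> la ! 0\<close> columns are longer than one.\<close>
lemma many_zeros:
  assumes inf: "infinite (UNIV :: 'k::field set)" and T: "T \<in> ext_index n ext.mu.cs"
    and z: "la ! 0 + N \<le> count (tab_content T) 0"
  shows "\<exists>Ss\<in>ext_index n mu.cs. \<forall>w\<in>(weyl n mu' :: (nat list list \<Rightarrow> 'k) set). w T = res w Ss"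
proof -
  let ?c = "take (part mu 1) mu.cs" and ?m = "part mu 0 - part mu 1"
  have cs': "ext.mu.cs = ?c @ replicate (?m + N) 1"
    unfolding mu'_cs by (subst mu_cs) (simp add: replicate_add)
  obtain Rs qs where R: "Rs \<in> ext_index n ?c" and qs: "qs \<in> words n (?m + N)" and T_eq: "T = Rs @ sing qs"
    using T unfolding cs' by (rule ext_index_split)
  have "count (tab_content Rs) 0 \<le> length Rs"
    using R
  proof -
    have "distinct S" if "S \<in> set Rs" for S
      using R that by (auto simp: ext_index_def in_set_conv_nth strict_sorted_iff)
    then show ?thesis
    proof (induction Rs)
      case (Cons S Rs)
      then have "count (mset S) 0 \<le> 1" by (simp add: distinct_count_atmost_1)
      then show ?case using Cons by simp
    qed simp
  qed
  also have "length Rs \<le> la ! 0"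
    using ext_index_length[OF R] mu_la part_simps by simp
  finally have "count (tab_content Rs) 0 \<le> la ! 0" .
  moreover have "tab_content (sing qs) = mset qs" by (induction qs) auto
  then have "tab_content T = tab_content Rs + mset qs" unfolding T_eq by simp
  ultimately have "N \<le> count (mset qs) 0" using z by simp
  then have sub: "replicate_mset N 0 \<subseteq># mset qs" by (simp add: count_le_replicate_mset_subset_eq[symmetric])
  \<comment> \<open>The single columns left after \<open>N\<close> zeros are taken out. By
    \<open>weyl_permute_singles\<close> these zeros may be moved to the end, which is where
    \<open>res\<close> reads.\<close>
  define rs where "rs = some_list (mset qs - replicate_mset N 0)"
  have eq: "mset qs = mset (rs @ replicate N 0)" using sub by (simp add: rs_def)
  have lenset: "length (rs @ replicate N 0) = ?m + N" "set (rs @ replicate N 0) \<subseteq> {..<n}"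
    using qs arg_cong[OF eq, of size] arg_cong[OF eq, of set_mset]
    by (simp_all add: words_def set_replicate_conv_if)
  then have w0: "rs @ replicate N 0 \<in> words n (?m + N)" unfolding words_def by blast
  have rs: "rs \<in> words n ?m" using lenset by (simp add: words_def)
  have mem: "Rs @ sing rs \<in> ext_index n mu.cs" by (subst mu_cs) (rule ext_index_append[OF R rs])
  moreover have "w T = res w (Rs @ sing rs)" if w: "w \<in> weyl n mu'" for w :: "nat list list \<Rightarrow> 'k"
    using ext.mu.weyl_permute_singles[OF inf w cs' R qs w0 eq] mem by (simp add: T_eq res_def)
  ultimately show ?thesis by blast
qed

text \<open>Primitive vectors have weight \<open>la'\<close>, so they live on tableaux with as many
  zeros as \<open>many_zeros\<close> asks for, and there every value is a value of
  \<open>res\<close>.\<close>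

lemma res_inj:
  assumes inf: "infinite (UNIV :: 'k::field set)"
  shows "inj_on res (primitive n la' mu' :: (nat list list \<Rightarrow> 'k) set)"
proof (rule inj_onI)
  fix x y :: "nat list list \<Rightarrow> 'k"
  assume x: "x \<in> primitive n la' mu'" and y: "y \<in> primitive n la' mu'" and eq: "res x = res y"
  have W: "x \<in> weyl n mu'" "y \<in> weyl n mu'" using x y by (simp_all add: primitive_def)
  show "x = y"
  proof
    fix T
    show "x T = y T"
    proof (cases "T \<in> ext_index n ext.mu.cs \<and> la ! 0 + N \<le> count (tab_content T) 0")
      case True
      then show ?thesis using many_zeros[OF inf, of T] W eq by metis
    next
      case False
      have zero: "z T = 0" if z: "z \<in> primitive n la' mu'" for z :: "nat list list \<Rightarrow> 'k"
      proof (rule ccontr)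
        assume nz: "z T \<noteq> 0"
        then have "count (tab_content T) 0 = la ! 0 + N"
          using ext.primitive_content[OF inf z nz, of 0] n add_first_nth[OF la.len, of 0] by simp
        moreover have "T \<in> ext_index n ext.mu.cs"
          using nz z ext.mu.weyl_supported by (auto simp: primitive_def)
        ultimately show False using False by simp
      qed
      show ?thesis by (simp only: zero[OF x] zero[OF y])
    qed
  qed
qed

end

text \<open>Here Frobenius enters: the \<open>p\<^sup>d\<close>-th power of a linear form has no mixed terms.\<close>
lemma (in part_ctxt) frobenius_blocks:
  fixes b :: "nat \<Rightarrow> 'k::field"
  assumes inf: "infinite (UNIV :: 'k set)" and w: "w \<in> (weyl n nu :: (nat list list \<Rightarrow> 'k) set)"
    and p: "CHAR('k) > 0" and P: "P = CHAR('k) ^ d" and cs: "cs = c0 @ replicate (k * P) 1"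
    and Ss: "Ss \<in> ext_index n c0"
  shows "(\<Sum>qs\<in>words n (k * P). mon b (mset qs) * w (Ss @ sing qs))
    = (\<Sum>rs\<in>words n k. mon b (mset rs) ^ P * w (Ss @ sing (concat (map (replicate P) rs))))"
proof -
  have prime: "prime CHAR('k)" by (rule prime_CHAR_semidom[OF p])
  have sumwords: "(\<Sum>qs\<in>words n m. mon f (mset qs)) = (\<Sum>q<n. f q) ^ m" for m and f :: "nat \<Rightarrow> 'k"
  proof -
    have "(\<Sum>q<n. f q) ^ m = (\<Prod>i<m. \<Sum>q\<in>{..<n}. f q)" by simp
    also have "\<dots> = (\<Sum>qs\<in>words n m. \<Prod>i<m. f (qs ! i))"
      unfolding words_alt by (rule prod_sum_lists) simp
    also have "\<dots> = (\<Sum>qs\<in>words n m. mon f (mset qs))"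
      by (intro sum.cong refl) (rule prod_mset_words)
    finally show ?thesis by simp
  qed
  have monpow: "mon f (mset rs) ^ P = mon (\<lambda>q. f q ^ P) (mset rs)" for rs and f :: "nat \<Rightarrow> 'k"
    by (induction rs) (simp_all add: power_mult_distrib)
  have conc: "mset (concat (map (replicate P) rs)) = (\<Sum>r\<in>#mset rs. replicate_mset P r)" for rs :: "nat list"
    by (induction rs) simp_all
  have mon_conc: "mon f (mset (concat (map (replicate P) rs))) = mon f (mset rs) ^ P" for rs and f :: "nat \<Rightarrow> 'k"
    unfolding conc monpow by (induction rs) (simp_all add: mon_replicate)
  have conc_words: "concat (map (replicate P) rs) \<in> words n (k * P)" if "rs \<in> words n k" for rs
  proof -
    have "length (concat (map (replicate P) rs)) = length rs * P" by (induction rs) simp_all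
    then show ?thesis using that by (auto simp: words_def)
  qed
  have w: "w \<in> fs.span {vec n cs h | h. (\<lambda>_. 1 :: 'k) (case_prod h) \<noteq> 0}"
    using w weyl_span_dense[OF inf polyfun_const, of 1] by simp
  then show ?thesis
  proof (induction rule: fs.span_induct_alt)
    case base
    then show ?case by simp
  next
    case (step c x y)
    then obtain g where g: "x = vec n cs g" by blast
    have "(\<Sum>qs\<in>words n (k * P). mon b (mset qs) * x (Ss @ sing qs))
        = (\<Sum>qs\<in>words n (k * P). vec n c0 g Ss * mon (\<lambda>q. b q * g q 0) (mset qs))"
    proof (intro sum.cong refl)
      fix qs assume "qs \<in> words n (k * P)"
      from vec_append[OF Ss this, of g]
      show "mon b (mset qs) * x (Ss @ sing qs) = vec n c0 g Ss * mon (\<lambda>q. b q * g q 0) (mset qs)"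
        unfolding g cs mon_mult by (simp only: mult_ac)
    qed
    also have "\<dots> = vec n c0 g Ss * (\<Sum>q<n. b q * g q 0) ^ (k * P)"
      by (simp only: sum_distrib_left[symmetric] sumwords)
    \<comment> \<open>On the orbit the left side is a power of a single linear form. Taking the P-th
      power first and then expanding the k-th power leaves words made of constant blocks of length
      \<open>P\<close>.\<close>
    also have "(\<Sum>q<n. b q * g q 0) ^ (k * P) = ((\<Sum>q<n. b q * g q 0) ^ P) ^ k"
      by (metis power_mult mult.commute)
    also have "(\<Sum>q<n. b q * g q 0) ^ P = (\<Sum>q<n. (b q * g q 0) ^ P)"
      by (rule freshmans_dream_sum'[OF prime P])
    also have "vec n c0 g Ss * \<dots> ^ k = (\<Sum>rs\<in>words n k. vec n c0 g Ss * mon (\<lambda>q. (b q * g q 0) ^ P) (mset rs))"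
      by (simp only: sum_distrib_left[symmetric] sumwords)
    also have "\<dots> = (\<Sum>rs\<in>words n k. mon b (mset rs) ^ P * x (Ss @ sing (concat (map (replicate P) rs))))"
    proof (intro sum.cong refl)
      fix rs assume "rs \<in> words n k"
      from vec_append[OF Ss conc_words[OF this], of g]
      show "vec n c0 g Ss * mon (\<lambda>q. (b q * g q 0) ^ P) (mset rs)
          = mon b (mset rs) ^ P * x (Ss @ sing (concat (map (replicate P) rs)))"
        unfolding g cs by (simp only: mon_conc monpow[symmetric] mon_mult power_mult_distrib mult_ac)
    qed
    finally show ?case
      using step.IH by (simp add: distrib_left sum.distrib sum_distrib_left mult.left_commute)
        (simp add: sum_distrib_left[symmetric] mult.left_commute)
  qed
qed


section \<open>Restriction to trailing zeros as a bijection of primitive vectors\<close>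

text \<open>The difference in \<open>bound\<close> is truncated: when the first part of
  \<open>mu\<close> is smaller than that of \<open>la\<close>, the bound just says that
  \<open>P\<close> is positive. The parameter \<open>ty\<close> fixes the field.\<close>

locale periodic = shifted n la mu "k * P" for n la mu k P +
  fixes d :: nat and ty :: "'k::field itself"
  assumes inf: "infinite (UNIV :: 'k set)" and CHAR: "CHAR('k) > 0" and P: "P = CHAR('k) ^ d"
    and bound: "P > min (part la 1) (part mu 0 - part la 0)"
begin

lemma P_pos: "P > 0"
  using CHAR P by simp

lemma words_blocks:
  assumes "rs \<in> words n k"
  shows "concat (map (replicate P) rs) \<in> words n (k * P)"
    and "count (mset (concat (map (replicate P) rs))) i = P * count (mset rs) i"
proof -
  have "length (concat (map (replicate P) rs)) = length rs * P" by (induction rs) simp_all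
  then show "concat (map (replicate P) rs) \<in> words n (k * P)" using assms by (auto simp: words_def)
  show "count (mset (concat (map (replicate P) rs))) i = P * count (mset rs) i" by (induction rs) auto
qed

text \<open>A nonzero entry in the blocks would need \<open>P\<close> copies of some \<open>i > 0\<close>, exceeding \<open>la ! i\<close>, or
  leave too few columns for the zeros.\<close>
lemma mixed_block_zero:
  fixes w :: "nat list list \<Rightarrow> 'k"
  assumes supp: "\<And>T i. w T \<noteq> 0 \<Longrightarrow> i < n \<Longrightarrow> count (tab_content T) i = la' ! i"
    and Ss: "Ss \<in> ext_index n mu.cs" and rs: "rs \<in> words n k" and ne: "rs \<noteq> replicate k 0"
  shows "w (Ss @ sing (concat (map (replicate P) rs))) = 0"
proof (rule ccontr)
  let ?q = "concat (map (replicate P) rs)"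
  assume nz: "w (Ss @ sing ?q) \<noteq> 0"
  have content_eq: "tab_content (Ss @ sing ?q) = tab_content Ss + mset ?q"
  proof -
    have "tab_content (sing q) = mset q" for q by (induction q) auto
    then show ?thesis by (simp del: mset_concat)
  qed
  have len: "length rs = k" "set rs \<subseteq> {..<n}" using rs by (auto simp: words_def)
  obtain i where i: "i \<in> set rs" "i \<noteq> 0"
    using ne len(1) by (metis replicate_eqI)
  then have "i < n" using len(2) by auto
  have cnt: "count (tab_content (Ss @ sing ?q)) j = count (tab_content Ss) j + P * count (mset rs) j" for j
    unfolding content_eq using words_blocks(2)[OF rs] by simp
  have "0 < count (mset rs) i" using i(1) by simp
  then have "P \<le> P * count (mset rs) i" by simp
  also have "\<dots> \<le> la' ! i" using supp[OF nz \<open>i < n\<close>] cnt[of i] by simp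
  also have "\<dots> = la ! i" using add_first_nth[OF la.len \<open>i < n\<close>] i(2) by simp
  also have "\<dots> \<le> part la 1" using i(2) \<open>i < n\<close> by (intro la_nth_le) auto
  finally have small: "P > part mu 0 - part la 0" using bound by simp
  \<comment> \<open>One nonzero block leaves at most k - 1 blocks of zeros. With at most
    \<open>part mu 0\<close> zeros in \<open>Ss\<close>, the total falls short of the required
    \<open>la ! 0 + k * P\<close>.\<close>
  have "count (mset rs) 0 + count (mset rs) i \<le> k"
  proof -
    have "count M 0 + count M i \<le> size M" for M :: "nat multiset"
      using i(2) by (induction M) auto
    from this[of "mset rs"] show ?thesis using len(1) by simp
  qed
  then have "count (mset rs) 0 < k" using \<open>0 < count (mset rs) i\<close> by linarith
  then have "P * count (mset rs) 0 + P \<le> k * P"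
    by (metis Suc_leI mult.commute mult_Suc mult_le_mono2 add.commute)
  moreover have "count (tab_content Ss) 0 \<le> part mu 0"
  proof -
    have "distinct S" if "S \<in> set Ss" for S
      using Ss that by (auto simp: ext_index_def in_set_conv_nth strict_sorted_iff)
    then have "count (tab_content Ss) 0 \<le> length Ss"
    proof (induction Ss)
      case (Cons S Ss)
      then have "count (mset S) 0 \<le> 1" by (simp add: distinct_count_atmost_1)
      then show ?case using Cons by simp
    qed simp
    then show ?thesis using ext_index_length[OF Ss] by (simp add: mu.length_conj)
  qed
  moreover have "count (tab_content (Ss @ sing ?q)) 0 = la ! 0 + k * P"
    using supp[OF nz, of 0] n add_first_nth[OF la.len, of 0] by simp
  ultimately show False using small P_pos cnt[of 0] part_simps by simp
qed

text \<open>The output columns at the end are zeros, so only row 0 of b enters there.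
  \<open>frobenius_blocks\<close> groups the input words into blocks and
  \<open>mixed_block_zero\<close> removes all but the zero word, whose coefficient is the power of
  \<open>b 0 0\<close>.\<close>

lemma res_act:
  fixes w :: "nat list list \<Rightarrow> 'k"
  assumes w: "w \<in> weyl n mu'"
    and supp: "\<And>T i. w T \<noteq> 0 \<Longrightarrow> i < n \<Longrightarrow> count (tab_content T) i = la' ! i"
  shows "res (act n b w) = scl (b 0 0 ^ (k * P)) (act n b (res w))"
proof
  fix Ss
  show "res (act n b w) Ss = scl (b 0 0 ^ (k * P)) (act n b (res w)) Ss"
  proof (cases "Ss \<in> ext_index n mu.cs")
    case True
    let ?m = "\<lambda>Ts. \<Prod>j<length mu.cs. minor b (Ss ! j) (Ts ! j)"
    have inner: "(\<Sum>qs\<in>words n (k * P). mon (b 0) (mset qs) * w (Ts @ sing qs)) = b 0 0 ^ (k * P) * res w Ts"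
      if Ts: "Ts \<in> ext_index n mu.cs" for Ts
    proof -
      have z: "replicate k 0 \<in> words n k" using n by (auto simp: words_def)
      have "(\<Sum>qs\<in>words n (k * P). mon (b 0) (mset qs) * w (Ts @ sing qs))
          = (\<Sum>rs\<in>words n k. mon (b 0) (mset rs) ^ P * w (Ts @ sing (concat (map (replicate P) rs))))"
        by (rule ext.mu.frobenius_blocks[OF inf w CHAR P mu'_cs Ts])
      also have "\<dots> = (\<Sum>rs\<in>{replicate k 0}. mon (b 0) (mset rs) ^ P * w (Ts @ sing (concat (map (replicate P) rs))))"
        using z mixed_block_zero[OF supp Ts] by (intro sum.mono_neutral_right) auto
      also have "concat (map (replicate P) (replicate k 0)) = replicate (k * P) (0 :: nat)"
        by (induction k) (simp_all add: replicate_add)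
      then have "(\<Sum>rs\<in>{replicate k 0}. mon (b 0) (mset rs) ^ P * w (Ts @ sing (concat (map (replicate P) rs))))
          = b 0 0 ^ (k * P) * res w Ts"
        using Ts by (simp add: mon_replicate res_def power_mult)
      finally show ?thesis .
    qed
    have "res (act n b w) Ss = act n b w (Ss @ sing (replicate (k * P) 0))"
      using True by (simp add: res_def)
    also have "\<dots> = (\<Sum>T\<in>ext_index n ext.mu.cs. w T *
        (\<Prod>j<length ext.mu.cs. minor b ((Ss @ sing (replicate (k * P) 0)) ! j) (T ! j)))"
      using ext.mu.weyl_supported[OF w] ext_index_append[OF True zeros_words]
      by (subst act_supported[where cs = ext.mu.cs]) (simp_all only: mu'_cs if_True)
    also have "\<dots> = (\<Sum>Ts\<in>ext_index n mu.cs. \<Sum>qs\<in>words n (k * P). w (Ts @ sing qs) *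
        (\<Prod>j<length ext.mu.cs. minor b ((Ss @ sing (replicate (k * P) 0)) ! j) ((Ts @ sing qs) ! j)))"
      unfolding mu'_cs by (rule sum_ext_index_append)
    also have "\<dots> = (\<Sum>Ts\<in>ext_index n mu.cs. \<Sum>qs\<in>words n (k * P). ?m Ts * (mon (b 0) (mset qs) * w (Ts @ sing qs)))"
    proof (intro sum.cong refl)
      fix Ts qs assume Ts: "Ts \<in> ext_index n mu.cs" and qs: "qs \<in> words n (k * P)"
      have "(\<Prod>i<k * P. b (replicate (k * P) 0 ! i) (qs ! i)) = mon (b 0) (mset qs)"
        unfolding prod_mset_words[OF qs, of "b 0", symmetric] by (intro prod.cong) auto
      then show "w (Ts @ sing qs) *
          (\<Prod>j<length ext.mu.cs. minor b ((Ss @ sing (replicate (k * P) 0)) ! j) ((Ts @ sing qs) ! j))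
         = ?m Ts * (mon (b 0) (mset qs) * w (Ts @ sing qs))"
        unfolding mu'_cs prod_columns_append[OF True zeros_words Ts qs] by (simp only: mult_ac)
    qed
    also have "\<dots> = (\<Sum>Ts\<in>ext_index n mu.cs. ?m Ts * (b 0 0 ^ (k * P) * res w Ts))"
      by (intro sum.cong refl) (simp only: sum_distrib_left[symmetric] inner)
    also have "\<dots> = b 0 0 ^ (k * P) * act n b (res w) Ss"
    proof -
      have "act n b (res w) Ss = (\<Sum>Ts\<in>ext_index n mu.cs. res w Ts * ?m Ts)"
        using True by (subst act_supported[where cs = mu.cs]) (simp_all add: res_def)
      then show ?thesis by (simp only: sum_distrib_left mult_ac)
    qed
    finally show ?thesis by simp
  next
    case False
    have "act n b (res w) Ss = 0"
      using False by (subst act_supported[where cs = mu.cs]) (simp_all add: res_def)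
    then show ?thesis using False by (simp add: res_def)
  qed
qed

lemma primitive'_supp:
  "(w :: nat list list \<Rightarrow> 'k) \<in> primitive n la' mu' \<Longrightarrow> w T \<noteq> 0 \<Longrightarrow> i < n \<Longrightarrow> count (tab_content T) i = la' ! i"
  by (rule ext.primitive_content[OF inf])

lemma res_mem_weyl:
  assumes "(w :: nat list list \<Rightarrow> 'k) \<in> weyl n mu'"
  shows "res w \<in> weyl n mu"
proof -
  have "w \<in> fs.span {vec n ext.mu.cs h | h. (\<lambda>_. 1 :: 'k) (case_prod h) \<noteq> 0}"
    using assms ext.mu.weyl_span_dense[OF inf polyfun_const, of 1] by simp
  then show ?thesis
  proof (induction rule: fs.span_induct_alt)
    case base
    have "res (0 :: nat list list \<Rightarrow> 'k) = 0" using res_scl[of 0 0] by (simp only: fs.scale_zero_left)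
    then show ?case by (simp only: fs.subspace_0[OF mu.subspace_weyl])
  next
    case (step c x y)
    then obtain h where "x = vec n ext.mu.cs h" by blast
    then have "res x \<in> weyl n mu"
      by (simp only: res_vec fs.subspace_scale[OF mu.subspace_weyl mu.vec_mem_weyl])
    then show ?case
      unfolding res_add res_scl using step.IH
      by (intro fs.subspace_add[OF mu.subspace_weyl] fs.subspace_scale[OF mu.subspace_weyl])
  qed
qed

lemma res_primitive:
  assumes w: "(w :: nat list list \<Rightarrow> 'k) \<in> primitive n la' mu'"
  shows "res w \<in> primitive n la mu"
  unfolding primitive_def
proof (intro CollectI conjI allI impI)
  have W: "w \<in> weyl n mu'" using w by (simp add: primitive_def)
  then show "res w \<in> weyl n mu" by (rule res_mem_weyl)
  fix b :: "nat \<Rightarrow> nat \<Rightarrow> 'k" assume b: "upper b" "\<forall>i<n. b i i \<noteq> 0"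
  have "scl (b 0 0 ^ (k * P)) (act n b (res w)) = res (act n b w)"
    by (rule res_act[OF W primitive'_supp[OF w], symmetric])
  also have "act n b w = scl (chi n la' b) w" using w b by (simp add: primitive_def)
  also have "res \<dots> = scl (b 0 0 ^ (k * P)) (scl (chi n la b) (res w))"
    by (simp only: res_scl chi' fs.scale_scale)
  finally have "scl (b 0 0 ^ (k * P)) (act n b (res w)) = scl (b 0 0 ^ (k * P)) (scl (chi n la b) (res w))" .
  moreover have "b 0 0 ^ (k * P) \<noteq> 0" using b(2) n by simp
  ultimately show "act n b (res w) = scl (chi n la b) (res w)" by (rule fs.scale_left_imp_eq[rotated])
qed

text \<open>\<open>res_vec\<close> carries the factor \<open>h 0 0 ^ (k * P)\<close>. The matrices
  with nonzero corner entry are dense, so their orbit vectors still span, and for these the factor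
  can be divided out.\<close>

lemma res_weyl_surj:
  assumes w: "(w :: nat list list \<Rightarrow> 'k) \<in> weyl n mu"
  obtains v where "v \<in> weyl n mu'" "res v = w"
proof -
  have "polyfun UNIV (\<lambda>x :: nat \<times> nat \<Rightarrow> 'k. x (0, 0))" by (rule polyfun_var) simp
  from mu.weyl_span_dense[OF inf this, of "\<lambda>_. 1"] w
  have "w \<in> fs.span {vec n mu.cs h | h. h 0 0 \<noteq> 0}" by simp
  then have "\<exists>v\<in>weyl n mu'. res v = w"
  proof (induction rule: fs.span_induct_alt)
    case base
    have "res (0 :: nat list list \<Rightarrow> 'k) = 0" using res_scl[of 0 0] by (simp only: fs.scale_zero_left)
    then show ?case using fs.subspace_0[OF ext.mu.subspace_weyl] by blast
  next
    case (step c x y)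
    then obtain h v where h: "x = vec n mu.cs h" "h 0 0 \<noteq> 0" and v: "v \<in> weyl n mu'" "res v = y" by blast
    let ?x = "scl (c / h 0 0 ^ (k * P)) (vec n ext.mu.cs h)"
    have "res (?x + v) = scl c x + y"
      using h(2) by (simp only: res_add res_scl res_vec fs.scale_scale v(2) h(1)) simp
    moreover have "?x + v \<in> weyl n mu'"
      by (intro fs.subspace_add[OF ext.mu.subspace_weyl] fs.subspace_scale[OF ext.mu.subspace_weyl] ext.mu.vec_mem_weyl v(1))
    ultimately show ?case by blast
  qed
  then show thesis using that by blast
qed

text \<open>An upper triangular matrix passes from \<open>U\<close> to \<open>T\<close> only if each
  column of \<open>T\<close> is entrywise at most that of \<open>U\<close>; a column that contains a
  zero keeps it.\<close>

lemma zeros_act_upper: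
  assumes b: "upper b" and w: "(w :: nat list list \<Rightarrow> 'k) \<in> weyl n mu'"
    and supp: "\<And>T. w T \<noteq> 0 \<Longrightarrow> z \<le> count (tab_content T) 0" and nz: "act n b w T \<noteq> 0"
  shows "z \<le> count (tab_content T) 0"
proof -
  have T: "T \<in> ext_index n ext.mu.cs"
    using ext.mu.weyl_supported[OF ext.mu.act_mem_weyl[OF inf w]] nz by blast
  have "act n b w T = (\<Sum>U\<in>ext_index n ext.mu.cs. w U * (\<Prod>j<length ext.mu.cs. minor b (T ! j) (U ! j)))"
    using T ext.mu.weyl_supported[OF w] by (subst act_supported[where cs = ext.mu.cs]) (simp_all only: if_True)
  then obtain U where U: "U \<in> ext_index n ext.mu.cs" and "w U * (\<Prod>j<length ext.mu.cs. minor b (T ! j) (U ! j)) \<noteq> 0"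
    using nz by (metis (no_types, lifting) sum.neutral)
  then have wU: "w U \<noteq> 0" and m: "\<And>j. j < length ext.mu.cs \<Longrightarrow> minor b (T ! j) (U ! j) \<noteq> 0" by auto
  have content0: "count (tab_content V) 0 = (\<Sum>j<length V. count (mset (V ! j)) 0)" for V :: "nat list list"
    by (induction V) (simp_all add: sum.lessThan_Suc_shift del: sum.lessThan_Suc)
  have "count (mset (U ! j)) 0 \<le> count (mset (T ! j)) 0" if j: "j < length ext.mu.cs" for j
  proof -
    have S: "sorted_wrt (<) (T ! j)" "sorted_wrt (<) (U ! j)" "length (T ! j) = length (U ! j)"
      using ext_index_nth[OF T j] ext_index_nth[OF U j] by (auto simp: incr_lists_def)
    show ?thesis
    proof (cases "0 \<in> set (U ! j)")
      case True
      then obtain i where i: "i < length (U ! j)" "U ! j ! i = 0" by (auto simp: in_set_conv_nth)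
      then have "T ! j ! i = 0" using minor_upper_nonzero[OF b S m[OF j] i(1)] by simp
      then have "0 \<in> set (T ! j)" using i(1) S(3) nth_mem by metis
      then have "0 < count (mset (T ! j)) 0" by simp
      moreover have "distinct (U ! j)" using S(2) by (simp add: strict_sorted_iff)
      then have "count (mset (U ! j)) 0 \<le> 1" by (simp add: distinct_count_atmost_1)
      ultimately show ?thesis by linarith
    next
      case False
      then have "count (mset (U ! j)) 0 = 0" by (simp add: count_eq_zero_iff)
      then show ?thesis by linarith
    qed
  qed
  then have "count (tab_content U) 0 \<le> count (tab_content T) 0"
    unfolding content0 using ext_index_length[OF T] ext_index_length[OF U] by (auto intro!: sum_mono)
  then show ?thesis using supp[OF wU] by simp
qed

text \<open>Primitivity of the lift is tested index by index. Where there are enough zeros,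
  \<open>many_zeros\<close> reads both sides off their restrictions and \<open>res_act\<close>
  reduces the claim to \<open>w\<close>; elsewhere both sides vanish, by
  \<open>zeros_act_upper\<close>.\<close>

lemma res_surj:
  assumes w: "(w :: nat list list \<Rightarrow> 'k) \<in> primitive n la mu"
  shows "\<exists>v\<in>primitive n la' mu'. res v = w"
proof -
  have W: "w \<in> weyl n mu" using w by (simp add: primitive_def)
  obtain v0 where v0: "v0 \<in> weyl n mu'" "res v0 = w" by (rule res_weyl_surj[OF W])
  define \<kappa> where "\<kappa> = (\<Sum>i<n. replicate_mset (la' ! i) i)"
  have \<kappa>: "count \<kappa> i = (if i < n then la' ! i else 0)" for i
    by (simp add: \<kappa>_def count_sum)
  \<comment> \<open>An arbitrary lift may have components of other weights. Projecting to weight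
    \<open>la'\<close> does not disturb the restriction, because appending the zeros to an index of
    weight \<open>la\<close> gives one of weight \<open>la'\<close>.\<close>
  define v where "v = ext.mu.proj \<kappa> v0"
  have v: "v \<in> weyl n mu'" unfolding v_def by (rule ext.mu.proj_mem_weyl[OF inf v0(1)])
  have supp: "count (tab_content T) i = la' ! i" if "v T \<noteq> 0" "i < n" for T i
    using that \<kappa>[of i] by (auto simp: v_def ext.mu.proj_def simp del: mset_concat split: if_splits)
  have supp0: "la ! 0 + k * P \<le> count (tab_content T) 0" if "v T \<noteq> 0" for T
    using supp[OF that, of 0] n add_first_nth[OF la.len, of 0] by simp
  have res_v: "res v = w"
  proof
    fix Ss
    show "res v Ss = w Ss"
    proof (cases "w Ss = 0")
      case True
      have "res v0 Ss = 0" using v0(2) True by simp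
      then show ?thesis using True by (auto simp: res_def v_def ext.mu.proj_def)
    next
      case False
      then have Ss: "Ss \<in> ext_index n mu.cs" using mu.weyl_supported[OF W] by blast
      have "tab_content (Ss @ sing (replicate (k * P) 0)) = \<kappa>"
      proof (rule multiset_eqI)
        fix i
        have "tab_content (sing q) = mset q" for q by (induction q) auto
        then have "tab_content (Ss @ sing (replicate (k * P) 0)) = tab_content Ss + replicate_mset (k * P) 0"
          by (simp del: mset_concat map_replicate)
        moreover have "count (tab_content Ss) i = (if i < n then la ! i else 0)"
        proof (cases "i < n")
          case True
          then show ?thesis using primitive_content[OF inf w False] by simp
        next
          case False
          then have "i \<notin># tab_content Ss" using content_lt[OF Ss] by blast
          then have "count (tab_content Ss) i = 0" by (simp only: not_in_iff)
          then show ?thesis using False by simp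
        qed
        ultimately show "count (tab_content (Ss @ sing (replicate (k * P) 0))) i = count \<kappa> i"
          using \<kappa>[of i] add_first_nth[OF la.len, of i] n by (simp del: mset_concat)
      qed
      then have "res v Ss = res v0 Ss"
        using Ss by (simp add: res_def v_def ext.mu.proj_def del: mset_concat)
      then show ?thesis using v0(2) by simp
    qed
  qed
  have "act n b v = scl (chi n la' b) v" if b: "upper b" "\<forall>i<n. b i i \<noteq> 0" for b :: "nat \<Rightarrow> nat \<Rightarrow> 'k"
  proof
    fix T
    show "act n b v T = scl (chi n la' b) v T"
    proof (cases "T \<in> ext_index n ext.mu.cs \<and> la ! 0 + k * P \<le> count (tab_content T) 0")
      case True
      then obtain Ss where Ss: "\<And>u. u \<in> weyl n mu' \<Longrightarrow> (u :: nat list list \<Rightarrow> 'k) T = res u Ss"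
        using many_zeros[OF inf, of T] by blast
      have "act n b v T = res (act n b v) Ss" by (rule Ss[OF ext.mu.act_mem_weyl[OF inf v]])
      also have "res (act n b v) = scl (b 0 0 ^ (k * P)) (act n b (res v))"
        by (rule res_act[OF v supp])
      also note res_v
      also have "act n b w = scl (chi n la b) w" using w b by (simp add: primitive_def)
      also have "scl (b 0 0 ^ (k * P)) (scl (chi n la b) w) = res (scl (chi n la' b) v)"
        by (simp only: res_scl res_v chi' fs.scale_scale)
      also have "\<dots> Ss = scl (chi n la' b) v T"
        by (rule Ss[OF fs.subspace_scale[OF ext.mu.subspace_weyl v], symmetric])
      finally show ?thesis .
    next
      case False
      have "act n b v T = 0"
      proof (rule ccontr)
        assume nz: "act n b v T \<noteq> 0"
        then have "T \<in> ext_index n ext.mu.cs"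
          using ext.mu.weyl_supported[OF ext.mu.act_mem_weyl[OF inf v]] by blast
        with zeros_act_upper[OF b(1) v supp0 nz] False show False by blast
      qed
      moreover have "v T = 0" using False supp0 ext.mu.weyl_supported[OF v] by blast
      ultimately show ?thesis by simp
    qed
  qed
  then have "v \<in> primitive n la' mu'" using v by (simp add: primitive_def)
  then show ?thesis using res_v by blast
qed

theorem hom_dim_periodic: "hom_dim TYPE('k) n la mu = hom_dim TYPE('k) n la' mu'"
proof -
  have "res ` (primitive n la' mu' :: (nat list list \<Rightarrow> 'k) set) = primitive n la mu"
    using res_primitive res_surj by blast
  moreover have "fs.dim (res ` (primitive n la' mu' :: (nat list list \<Rightarrow> 'k) set)) = fs.dim (primitive n la' mu' :: (nat list list \<Rightarrow> 'k) set)"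
    by (rule fsp.dim_inj_image[OF linear_res ext.subspace_primitive res_inj[OF inf]])
  ultimately show ?thesis
    by (simp add: hom_dim_eq_dim_primitive[OF inf] ext.hom_dim_eq_dim_primitive[OF inf])
qed

end

theorem theorem2p1:
  fixes la mu :: "nat list" and n r p k d :: nat
  assumes "infinite (UNIV :: 'k::field set)"
    and "CHAR('k) = p" and "p > 0"
    and "n \<ge> 1"
    and "is_partition n r la" and "is_partition n r mu"
    and "part mu 1 \<le> part la 0"
    and "p ^ d > min (part la 1) (part mu 0 - part la 0)"
  shows "hom_dim TYPE('k) n la mu
       = hom_dim TYPE('k) n (add_first (k * p ^ d) la) (add_first (k * p ^ d) mu)"
proof -
  interpret periodic n la mu k "p ^ d" d "TYPE('k)"
    using assms by (intro periodic.intro shifted.intro two_parts.intro shifted_axioms.intro periodic_axioms.intro)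
      (auto intro: part_ctxtI)
  show ?thesis by (rule hom_dim_periodic)
qed

end
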